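(* Let $u_b\in\mathbf{L}^\infty([0,T]\times\partial\Omega;\mathbb{R})$ and $u\in(\mathbf{L}^\infty\cap\mathcal{TR}^\infty)([0,T]\times\Omega;\mathbb{R})$. Then the following statements are equivalent: 1. for any boundary entropy-entropy flux pair $(H,Q)$ and any $\beta\in\mathbf{L}^1(]0,T[\times\partial\Omega;\mathbb{R}_+)$, $$\operatorname*{ess\,lim}_{\rho\to0^+}\int_0^T\int_{\partial\Omega}Q\big(t,\xi,u(t,\xi-\rho\,\nu(\xi)),u_b(t,\xi)\big)\cdot\nu(\xi)\,\beta(t,\xi)\,\mathrm{d}\xi\,\mathrm{d}t\ge0;$$ 2. for any $\beta\in\mathbf{L}^1(]0,T[\times\partial\Omega;\mathbb{R}_+)$ and all $k\in\mathbb{R}$, $$\operatorname*{ess\,lim}_{\rho\to0^+}\int_0^T\int_{\partial\Omega}\mathcal{F}\big(t,\xi,u(t,\xi-\rho\,\nu(\xi)),u_b(t,\xi),k\big)\cdot\nu(\xi)\,\beta(t,\xi)\,\mathrm{d}\xi\,\mathrm{d}t\ge0;$$ 3. for a.e. $(t,\xi)\in]0,T[\times\partial\Omega$ and all $k\in\mathbb{R}$, $$\mathcal{F}\big(t,\xi,\mathrm{tr}\,u(t,\xi),u_b(t,\xi),k\big)\cdot\nu(\xi)\ge0;$$ 4. for a.e. $(t,\xi)\in]0,T[\times\partial\Omega$ and all $k\in\mathcal{I}[\mathrm{tr}\,u(t,\xi),u_b(t,\xi)]$, $$\mathrm{sgn}\big(\mathrm{tr}\,u(t,\xi)-u_b(t,\xi)\big)\big(f(t,\xi,\mathrm{tr}\,u(t,\xi))-f(t,\xi,k)\big)\cdot\nu(\xi)\ge0;$$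 5. for a.e. $(t,\xi)\in]0,T[\times\partial\Omega$ and any entropy-entropy flux pair $(\eta,q)$, $$\Big[q(t,\xi,\mathrm{tr}\,u(t,\xi))-q(t,\xi,u_b(t,\xi))-\eta'(u_b(t,\xi))\big(f(t,\xi,\mathrm{tr}\,u(t,\xi))-f(t,\xi,u_b(t,\xi))\big)\Big]\cdot\nu(\xi)\ge0;$$ 6. for a.e. $(t,\xi)\in]0,T[\times\partial\Omega$ and all entropy-entropy flux pairs $(\eta,q)$ such that $\eta'(u_b(t,\xi))=0$ and $q(t,\xi,u_b(t,\xi))=0$, $$q(t,\xi,\mathrm{tr}\,u(t,\xi))\cdot\nu(\xi)\ge0.$$
   Context: **Setting.** $N\ge 1$; $\Omega\subset\mathbb{R}^N$ is a bounded open set with smooth boundary $\partial\Omega$; $\nu(\xi)$ is the exterior (unit) normal at $\xi\in\partial\Omega$; $T>0$; $\mathbb{R}_+=[0,+\infty[$; $]a,b[$ denotes an open interval; $\mathrm{d}\xi$ is surface measure on $\partial\Omega$. **Standing assumption on the flux.** $f\in\mathbf{C}^2([0,T]\times\overline\Omega\times\mathbb{R};\mathbb{R}^N)$, $(t,x,u)\mapsto f(t,x,u)$, with $\partial_u f\in\mathbf{L}^\infty_{\mathrm{loc}}([0,T]\times\Omega\times\mathbb{R};\mathbb{R}^N)$ and $\nabla_x\partial_u f\in\mathbf{L}^\infty([0,T]\times\Omega\times\mathbb{R};\mathbb{R}^{N\times N})$. **Notation.** $\partial_i$ is the partial derivative with respect to the $i$-th argument (so $\partial_3 f=\partial_u f$).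 $\mathrm{sgn}(s)=1,0,-1$ for $s>0$, $s=0$, $s<0$ respectively. For $w,k\in\mathbb{R}$, $\mathcal{I}[w,k]=\{z\in\mathbb{R}:(w-z)(z-k)\ge0\}$ is the closed interval with end points $w$ and $k$. **Traces.** $u\in\mathcal{TR}^\infty([0,T]\times\Omega;\mathbb{R})$ if there is a function $\mathrm{tr}\,u\in\mathbf{L}^\infty([0,T]\times\partial\Omega;\mathbb{R})$ with $\operatorname{ess\,lim}_{r\to0^+}\int_0^T\int_{\partial\Omega}|u(t,\xi-r\,\nu(\xi))-\mathrm{tr}\,u(t,\xi)|\,\mathrm{d}\xi\,\mathrm{d}t=0$. **Entropy-entropy flux pair (with respect to $f$).** A pair $(\eta,q)\in\mathbf{C}^2(\mathbb{R};\mathbb{R})\times\mathbf{C}^2([0,T]\times\overline\Omega\times\mathbb{R};\mathbb{R}^N)$ with $\eta$ convex and $\partial_3 q(t,x,z)=\eta'(z)\,\partial_3 f(t,x,z)$ for all $t\in[0,T]$, $x\in\Omega$, $z\in\mathbb{R}$. **Boundary entropy-entropy flux pair (with respect to $f$).** A pair $(H,Q)\in\mathbf{C}^2(\mathbb{R}^2;\mathbb{R})\times\mathbf{C}^2([0,T]\times\overline\Omega\times\mathbb{R}^2;\mathbb{R}^N)$ such that: (i) $z\mapsto H(z,w)$ is convex for every $w\in\mathbb{R}$; (ii) $\partial_3 Q(t,x,z,w)=\partial_1 H(z,w)\,\partial_3 f(t,x,z)$ for all $t\in[0,T]$, $x\in\overline\Omega$, $z,w\in\mathbb{R}$; (iii)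 $H(w,w)=0$, $Q(t,x,w,w)=0$, $\partial_1H(w,w)=0$ for all $t\in[0,T]$, $x\in\overline\Omega$, $w\in\mathbb{R}$. **The function $\mathcal{F}$.** $\mathcal{F}\in\mathbf{C}^0([0,T]\times\overline\Omega\times\mathbb{R}^3;\mathbb{R}^N)$ is defined by $$\mathcal{F}(t,x,z,w,k)=\begin{cases} f(t,x,w)-f(t,x,z)&\text{for }z\le w\le k,\\ 0&\text{for }w\le z\le k,\\ f(t,x,z)-f(t,x,k)&\text{for }w\le k\le z,\\ f(t,x,k)-f(t,x,z)&\text{for }z\le k\le w,\\ 0&\text{for }k\le z\le w,\\ f(t,x,z)-f(t,x,w)&\text{for }k\le w\le z.\end{cases}$$ *)

theory Defs
  imports "HOL-Analysis.Analysis"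
begin

section \<open>Functions of class \<open>C\<^sup>k\<close>\<close>

text \<open>
  Derivatives are taken within \<open>S\<close>, so that the definition also applies to sets such as
  \<open>[0,T] \<times> closure \<Omega> \<times> \<real>\<close>, where it yields one-sided derivatives at boundary points and their
  continuity up to the boundary.  Continuity of the derivative is expressed direction by direction,
  which in finite dimension is continuity in operator norm.
\<close>

primrec Ck_on :: "nat \<Rightarrow> 'a::euclidean_space set \<Rightarrow> ('a \<Rightarrow> 'b::euclidean_space) \<Rightarrow> bool" where
  "Ck_on 0 S g \<longleftrightarrow> continuous_on S g"
| "Ck_on (Suc k) S g \<longleftrightarrow>
     (\<exists>g'. (\<forall>x\<in>S. (g has_derivative g' x) (at x within S)) \<and> (\<forall>v. Ck_on k S (\<lambda>x. g' x v)))"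

definition smooth_on :: "'a::euclidean_space set \<Rightarrow> ('a \<Rightarrow> 'b::euclidean_space) \<Rightarrow> bool" where
  "smooth_on S g \<longleftrightarrow> (\<forall>k. Ck_on k S g)"


section \<open>Geometry of the boundary\<close>

text \<open>
  Near each boundary point, up to the choice of a coordinate direction \<open>e\<close> and its orientation,
  \<open>\<Omega>\<close> is the set below the graph of a smooth function \<open>\<gamma>\<close> of the other \<open>N - 1\<close> coordinates; the
  condition \<open>\<gamma> (x + s e) = \<gamma> x\<close> says that \<open>\<gamma>\<close> does not depend on the coordinate along \<open>e\<close>.
\<close>

definition smooth_boundary :: "'a::euclidean_space set \<Rightarrow> bool" where
  "smooth_boundary \<Omega> \<longleftrightarrow>
     (\<forall>\<xi>\<in>frontier \<Omega>. \<exists>r>0. \<exists>e. \<exists>\<gamma>::'a \<Rightarrow> real.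
        (e \<in> Basis \<or> - e \<in> Basis) \<and> smooth_on UNIV \<gamma> \<and>
        (\<forall>x s. \<gamma> (x + s *\<^sub>R e) = \<gamma> x) \<and>
        \<Omega> \<inter> ball \<xi> r = {x \<in> ball \<xi> r. x \<bullet> e < \<gamma> x})"

definition tangent_vector :: "'a::euclidean_space set \<Rightarrow> 'a \<Rightarrow> 'a \<Rightarrow> bool" where
  "tangent_vector S \<xi> v \<longleftrightarrow>
     (\<exists>c. c 0 = \<xi> \<and> (\<forall>s::real. c s \<in> S) \<and> (c has_vector_derivative v) (at 0))"

definition exterior_normal :: "'a::euclidean_space set \<Rightarrow> 'a \<Rightarrow> 'a" where
  "exterior_normal \<Omega> \<xi> =
     (THE n. norm n = 1 \<and> (\<forall>v. tangent_vector (frontier \<Omega>) \<xi> v \<longrightarrow> n \<bullet> v = 0) \<and>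
        (\<exists>\<delta>>0. \<forall>s. 0 < s \<and> s < \<delta> \<longrightarrow> \<xi> - s *\<^sub>R n \<in> \<Omega> \<and> \<xi> + s *\<^sub>R n \<notin> closure \<Omega>))"

text \<open>
  Surface measure is the \<open>(N - 1)\<close>-dimensional Hausdorff measure, normalised so that it agrees with
  Lebesgue measure on hyperplanes (and with counting measure for \<open>N = 1\<close>, since \<open>0 ^ 0 = 1\<close>).
  The explicit \<open>bounded\<close> is needed because \<^const>\<open>diameter\<close> is not meaningful on unbounded sets.
  The Hausdorff outer measure is a metric outer measure, hence countably additive on Borel sets,
  so \<^const>\<open>measure_of\<close> does not degenerate here.
\<close>

definition hausdorff_gauge :: "nat \<Rightarrow> 'a::euclidean_space set \<Rightarrow> ennreal" where
  "hausdorff_gauge d A =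
     (if A = {} then 0 else ennreal (unit_ball_vol (real d) * (diameter A / 2) ^ d))"

definition hausdorff_pre :: "nat \<Rightarrow> real \<Rightarrow> 'a::euclidean_space set \<Rightarrow> ennreal" where
  "hausdorff_pre d \<delta> A =
     (INF C \<in> {C :: nat \<Rightarrow> 'a set. A \<subseteq> (\<Union>i. C i) \<and> (\<forall>i. bounded (C i) \<and> diameter (C i) \<le> \<delta>)}.
        \<Sum>i. hausdorff_gauge d (C i))"

definition hausdorff_outer :: "nat \<Rightarrow> 'a::euclidean_space set \<Rightarrow> ennreal" where
  "hausdorff_outer d A = (SUP \<delta> \<in> {0<..}. hausdorff_pre d \<delta> A)"

definition hausdorff_measure :: "nat \<Rightarrow> 'a::euclidean_space measure" where
  "hausdorff_measure d = measure_of UNIV (sets borel) (hausdorff_outer d)"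

definition surface_measure :: "'a::euclidean_space set \<Rightarrow> 'a measure" where
  "surface_measure \<Omega> = restrict_space (hausdorff_measure (DIM('a) - 1)) (frontier \<Omega>)"

text \<open>
  The completed product of Lebesgue measure on \<open>[0,T]\<close> and surface measure on \<open>\<partial>\<Omega>\<close>.  As \<open>{0, T}\<close> is
  a null set, it also serves for \<open>]0,T[ \<times> \<partial>\<Omega>\<close>.
\<close>

definition lateral_measure :: "real \<Rightarrow> 'a::euclidean_space set \<Rightarrow> (real \<times> 'a) measure" where
  "lateral_measure T \<Omega> =
     completion (restrict_space lborel {0..T} \<Otimes>\<^sub>M surface_measure \<Omega>)"


section \<open>Function spaces, essential limits and traces\<close>

definition L_infinity :: "'a measure \<Rightarrow> ('a \<Rightarrow> 'b::euclidean_space) \<Rightarrow> bool" where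
  "L_infinity M g \<longleftrightarrow> g \<in> borel_measurable M \<and> (\<exists>C. AE x in M. norm (g x) \<le> C)"

definition L_infinity_loc :: "'a::euclidean_space set \<Rightarrow> ('a \<Rightarrow> 'b::euclidean_space) \<Rightarrow> bool" where
  "L_infinity_loc S g \<longleftrightarrow> (\<forall>K. compact K \<and> K \<subseteq> S \<longrightarrow> L_infinity (lebesgue_on K) g)"

definition L1_nonneg :: "'a measure \<Rightarrow> ('a \<Rightarrow> real) \<Rightarrow> bool" where
  "L1_nonneg M g \<longleftrightarrow> integrable M g \<and> (AE x in M. 0 \<le> g x)"

text \<open>\<open>ess_lim g L\<close>: the essential limit of \<open>g\<close> at \<open>0+\<close> exists and equals \<open>L\<close>.\<close>

definition ess_lim :: "(real \<Rightarrow> 'b::topological_space) \<Rightarrow> 'b \<Rightarrow> bool" where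
  "ess_lim g L \<longleftrightarrow> (\<exists>Z. negligible Z \<and> (g \<longlongrightarrow> L) (at 0 within ({0<..} - Z)))"

text \<open>
  \<open>has_trace T \<Omega> u v\<close>: \<open>u\<close> belongs to \<open>TR\<^sup>\<infinity>([0,T] \<times> \<Omega>)\<close> and \<open>v\<close> is its trace.
\<close>

definition has_trace ::
  "real \<Rightarrow> 'a::euclidean_space set \<Rightarrow> (real \<Rightarrow> 'a \<Rightarrow> real) \<Rightarrow> (real \<Rightarrow> 'a \<Rightarrow> real) \<Rightarrow> bool" where
  "has_trace T \<Omega> u v \<longleftrightarrow>
     L_infinity (lateral_measure T \<Omega>) (\<lambda>(t, \<xi>). v t \<xi>) \<and>
     ess_lim (\<lambda>r. \<integral>\<^sup>+ (t, \<xi>). ennreal \<bar>u t (\<xi> - r *\<^sub>R exterior_normal \<Omega> \<xi>) - v t \<xi>\<bar>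
                   \<partial>lateral_measure T \<Omega>) 0"


section \<open>Fluxes, entropies and boundary entropies\<close>

text \<open>\<open>d3 g t x z\<close> is the partial derivative \<open>\<partial>\<^sub>3 g(t,x,z)\<close>.\<close>

definition d3 :: "(real \<Rightarrow> 'a \<Rightarrow> real \<Rightarrow> 'b::real_normed_vector) \<Rightarrow> real \<Rightarrow> 'a \<Rightarrow> real \<Rightarrow> 'b" where
  "d3 g t x z = vector_derivative (\<lambda>s. g t x s) (at z)"

definition admissible_flux ::
  "real \<Rightarrow> (real^'n) set \<Rightarrow> (real \<Rightarrow> real^'n \<Rightarrow> real \<Rightarrow> real^'n) \<Rightarrow> bool" where
  "admissible_flux T \<Omega> f \<longleftrightarrow>
     Ck_on 2 ({0..T} \<times> closure \<Omega> \<times> UNIV) (\<lambda>(t, x, z). f t x z) \<and>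
     L_infinity_loc ({0..T} \<times> \<Omega> \<times> UNIV) (\<lambda>(t, x, z). d3 f t x z) \<and>
     L_infinity (lebesgue_on ({0..T} \<times> \<Omega> \<times> UNIV))
       (\<lambda>(t, x, z). jacobian (\<lambda>y. d3 f t y z) (at x))"

definition entropy_pair ::
  "real \<Rightarrow> (real^'n) set \<Rightarrow> (real \<Rightarrow> real^'n \<Rightarrow> real \<Rightarrow> real^'n) \<Rightarrow>
   (real \<Rightarrow> real) \<Rightarrow> (real \<Rightarrow> real^'n \<Rightarrow> real \<Rightarrow> real^'n) \<Rightarrow> bool" where
  "entropy_pair T \<Omega> f \<eta> q \<longleftrightarrow>
     Ck_on 2 UNIV \<eta> \<and>
     Ck_on 2 ({0..T} \<times> closure \<Omega> \<times> UNIV) (\<lambda>(t, x, z). q t x z) \<and>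
     convex_on UNIV \<eta> \<and>
     (\<forall>t\<in>{0..T}. \<forall>x\<in>\<Omega>. \<forall>z. d3 q t x z = deriv \<eta> z *\<^sub>R d3 f t x z)"

definition boundary_entropy_pair ::
  "real \<Rightarrow> (real^'n) set \<Rightarrow> (real \<Rightarrow> real^'n \<Rightarrow> real \<Rightarrow> real^'n) \<Rightarrow>
   (real \<Rightarrow> real \<Rightarrow> real) \<Rightarrow> (real \<Rightarrow> real^'n \<Rightarrow> real \<Rightarrow> real \<Rightarrow> real^'n) \<Rightarrow> bool" where
  "boundary_entropy_pair T \<Omega> f H Q \<longleftrightarrow>
     Ck_on 2 UNIV (\<lambda>(z, w). H z w) \<and>
     Ck_on 2 ({0..T} \<times> closure \<Omega> \<times> UNIV) (\<lambda>(t, x, z, w). Q t x z w) \<and>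
     (\<forall>w. convex_on UNIV (\<lambda>z. H z w)) \<and>
     (\<forall>t\<in>{0..T}. \<forall>x\<in>closure \<Omega>. \<forall>z w.
        d3 (\<lambda>t x z. Q t x z w) t x z = deriv (\<lambda>s. H s w) z *\<^sub>R d3 f t x z) \<and>
     (\<forall>t\<in>{0..T}. \<forall>x\<in>closure \<Omega>. \<forall>w.
        H w w = 0 \<and> Q t x w w = 0 \<and> deriv (\<lambda>s. H s w) w = 0)"

definition interval_between :: "real \<Rightarrow> real \<Rightarrow> real set" where
  "interval_between w k = {z. (w - z) * (z - k) \<ge> 0}"

text \<open>The six cases overlap only where they agree, so their order is immaterial.\<close>

definition F_flux ::
  "(real \<Rightarrow> 'a \<Rightarrow> real \<Rightarrow> 'b::real_vector) \<Rightarrow> real \<Rightarrow> 'a \<Rightarrow> real \<Rightarrow> real \<Rightarrow> real \<Rightarrow> 'b" where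
  "F_flux f t x z w k =
     (if z \<le> w \<and> w \<le> k then f t x w - f t x z
      else if w \<le> z \<and> z \<le> k then 0
      else if w \<le> k \<and> k \<le> z then f t x z - f t x k
      else if z \<le> k \<and> k \<le> w then f t x k - f t x z
      else if k \<le> z \<and> z \<le> w then 0
      else f t x z - f t x w)"

end

theory Submission
  imports Defs
begin

text \<open>
  The trace turns each essential limit into an integral against the trace of \<open>u\<close>: for almost every
  small \<open>\<rho>\<close> the translate of \<open>u\<close> along the normal is measurable and bounded on the lateral boundary,
  because \<open>(\<xi>, \<rho>) \<mapsto> \<xi> - \<rho> \<nu>(\<xi>)\<close> has a Lipschitz inverse and therefore pulls null sets back to null
  sets, and convergence in mean along a sequence of radii allows dominated convergence along a
  subsequence.  Since the weight \<open>\<beta>\<close> is arbitrary, all six conditions become pointwise almost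
  everywhere.  Pointwise they are compared by integrating by parts: with \<open>a\<close> the trace, \<open>b\<close> the boundary
  datum and \<open>\<phi> = f \<bullet> \<nu>\<close>, the entropy expression is the integral of \<open>\<eta>'' s * (\<phi> a - \<phi> s)\<close> from \<open>b\<close> to \<open>a\<close>,
  and entropies whose second derivative is a bump on a rational interval recover the sign of
  \<open>\<phi> a - \<phi>\<close> between \<open>a\<close> and \<open>b\<close>.

  The surface measure is only estimated from above, by its outer measure; its countable additivity on
  Borel sets is never needed.
\<close>

section \<open>Calculus of \<open>C\<^sup>k\<close> functions\<close>

text \<open>Condition 4 is the hub with which the others are compared. The entropies natural for
  this, the distance \<open>\<bar>z - k\<bar>\<close> and its relatives, are not of class C^2, so
  smooth ones have to detect a sign on an interval, and their fluxes are the delicate point. The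
  obvious formula, the primitive of the derivative of \<eta> times \<open>d3 f\<close>, is not
  visibly C^2 in x when f is only C^2. Integration by parts rewrites it as the derivative of \<eta>
  times f minus a primitive that contains no derivative of f. Its regularity then rests on
  differentiation under the integral sign, with derivatives taken within \<open>[0,T]\<close> times
  the closure of \<Omega>. That closure need not be convex, so the mean value inequality is run
  along curves inside it, which the boundary charts provide. The second obstacle is the order of
  quantifiers: each test entropy and each k brings its own null set, so only countably many can be
  used, and continuity or openness has to supply the rest.\<close>

lemma Ck_on_const: "Ck_on k S (\<lambda>x. c)"
proof (induction k arbitrary: c)
  case (Suc k)
  then show ?case by (auto intro!: exI[of _ "\<lambda>x v. 0"])
qed simp

lemma Ck_on_Suc_D: "Ck_on (Suc k) S f \<Longrightarrow> Ck_on k S f"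
proof (induction k arbitrary: f)
  case 0
  then show ?case by (auto intro: has_derivative_continuous_on)
next
  case (Suc k)
  from Suc.prems obtain f' where f': "\<forall>x\<in>S. (f has_derivative f' x) (at x within S)"
    "\<forall>v. Ck_on (Suc k) S (\<lambda>x. f' x v)" by (subst (asm) Ck_on.simps(2)) blast
  then show ?case using Suc.IH by (subst Ck_on.simps(2)) blast
qed

lemma Ck_on_mono: "Ck_on m S f \<Longrightarrow> k \<le> m \<Longrightarrow> Ck_on k S f"
  by (induction m) (auto simp: le_Suc_eq dest: Ck_on_Suc_D simp del: Ck_on.simps(2))

lemma Ck_on_linear:
  assumes "bounded_linear L" shows "Ck_on k S L"
proof (cases k)
  case 0
  then show ?thesis using assms by (simp add: linear_continuous_on)
next
  case (Suc m)
  then show ?thesis using assms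
    by (auto intro!: exI[of _ "\<lambda>x. L"] bounded_linear_imp_has_derivative Ck_on_const)
qed

lemma Ck_on_linear_comp:
  assumes "bounded_linear L" "Ck_on k S f" shows "Ck_on k S (\<lambda>x. L (f x))"
  using assms(2)
proof (induction k arbitrary: f)
  case 0
  then show ?case using assms(1) by (simp add: bounded_linear.continuous_on)
next
  case (Suc k)
  then obtain f' where f': "\<forall>x\<in>S. (f has_derivative f' x) (at x within S)"
    "\<forall>v. Ck_on k S (\<lambda>x. f' x v)" by auto
  have "((\<lambda>x. L (f x)) has_derivative (\<lambda>v. L (f' x v))) (at x within S)" if "x \<in> S" for x
    using f'(1) that by (intro bounded_linear.has_derivative[OF assms(1)]) simp
  then show ?case
    by (subst Ck_on.simps(2), intro exI[of _ "\<lambda>x v. L (f' x v)"]) (use f' Suc.IH in simp)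
qed

text \<open>Affine inner maps cover what occurs below: projections, regrouping of variables, and
  freezing a variable at a constant. Their derivative is the constant \<open>L\<close>, so the
  induction produces no products of derivatives.\<close>

lemma Ck_on_comp_affine:
  assumes "bounded_linear L" "(\<lambda>x. L x + c) ` S \<subseteq> T" "Ck_on k T f" shows "Ck_on k S (\<lambda>x. f (L x + c))"
  using assms(3)
proof (induction k arbitrary: f)
  case 0
  have "continuous_on S (\<lambda>x. L x + c)"
    by (intro continuous_on_add linear_continuous_on assms(1) continuous_on_const)
  then show ?case using 0 continuous_on_compose2[OF _ _ assms(2)] by simp
next
  case (Suc k)
  then obtain f' where f': "\<forall>x\<in>T. (f has_derivative f' x) (at x within T)"
    "\<forall>v. Ck_on k T (\<lambda>x. f' x v)" by auto
  have "((\<lambda>x. f (L x + c)) has_derivative (\<lambda>v. f' (L x + c) (L v))) (at x within S)" if "x \<in> S" for x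
  proof (rule has_derivative_in_compose2[of T f f' "\<lambda>x. L x + c" S x L])
    show "((\<lambda>x. L x + c) has_derivative L) (at x within S)"
      by (intro has_derivative_add_const bounded_linear_imp_has_derivative assms(1))
  qed (use f'(1) assms(2) that in auto)
  then show ?case
    by (subst Ck_on.simps(2), intro exI[of _ "\<lambda>x v. f' (L x + c) (L v)"])
      (use f' Suc.IH in auto)
qed

lemma Ck_on_comp_linear:
  assumes "bounded_linear L" "L ` S \<subseteq> T" "Ck_on k T f" shows "Ck_on k S (\<lambda>x. f (L x))"
  using Ck_on_comp_affine[of L 0 S T k f] assms by simp

lemma Ck_on_add:
  assumes "Ck_on k S f" "Ck_on k S g" shows "Ck_on k S (\<lambda>x. f x + g x)"
  using assms
proof (induction k arbitrary: f g)
  case 0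
  then show ?case by (simp add: continuous_on_add)
next
  case (Suc k)
  then obtain f' g' where *: "\<forall>x\<in>S. (f has_derivative f' x) (at x within S)"
    "\<forall>v. Ck_on k S (\<lambda>x. f' x v)" "\<forall>x\<in>S. (g has_derivative g' x) (at x within S)"
    "\<forall>v. Ck_on k S (\<lambda>x. g' x v)" by auto
  show ?case
    by (subst Ck_on.simps(2), rule exI[of _ "\<lambda>x v. f' x v + g' x v"])
      (use * Suc.IH in \<open>auto intro!: has_derivative_add\<close>)
qed

lemma Ck_on_diff:
  assumes "Ck_on k S f" "Ck_on k S g" shows "Ck_on k S (\<lambda>x. f x - g x)"
  using Ck_on_add[OF assms(1) Ck_on_linear_comp[OF bounded_linear_minus[OF bounded_linear_ident] assms(2)]]
  by simp

lemma Ck_on_scaleR: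
  fixes f :: "'d::euclidean_space \<Rightarrow> real" and g :: "'d \<Rightarrow> 'b::euclidean_space"
  assumes "Ck_on k S f" "Ck_on k S g" shows "Ck_on k S (\<lambda>x. f x *\<^sub>R g x)"
  using assms
proof (induction k arbitrary: f g)
  case 0
  then show ?case by (simp add: continuous_on_scaleR)
next
  case (Suc k)
  then obtain f' g' where *: "\<forall>x\<in>S. (f has_derivative f' x) (at x within S)"
    "\<forall>v. Ck_on k S (\<lambda>x. f' x v)" "\<forall>x\<in>S. (g has_derivative g' x) (at x within S)"
    "\<forall>v. Ck_on k S (\<lambda>x. g' x v)" by auto
  have "Ck_on k S f" "Ck_on k S g" using Suc.prems Ck_on_Suc_D by blast+
  then have "\<forall>v. Ck_on k S (\<lambda>x. f x *\<^sub>R g' x v + f' x v *\<^sub>R g x)"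
    using * by (intro allI Ck_on_add Suc.IH) auto
  then show ?case
    by (subst Ck_on.simps(2), intro exI[of _ "\<lambda>x v. f x *\<^sub>R g' x v + f' x v *\<^sub>R g x"])
      (use * in \<open>auto intro!: has_derivative_scaleR\<close>)
qed

section \<open>Primitives of functions of one real variable\<close>

lemma Ck_on_real_derivative:
  assumes "\<And>z. (h has_real_derivative h' z) (at z)" "Ck_on k UNIV h'"
  shows "Ck_on (Suc k) UNIV h"
proof (subst Ck_on.simps(2), intro exI[of _ "\<lambda>x v. v *\<^sub>R h' x"] conjI ballI allI)
  show "(h has_derivative (\<lambda>v. v *\<^sub>R h' x)) (at x)" for x
    using assms(1)[of x] by (auto simp: has_field_derivative_def elim!: has_derivative_eq_rhs)
  show "Ck_on k UNIV (\<lambda>x. v *\<^sub>R h' x)" for v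
    by (intro Ck_on_scaleR Ck_on_const assms)
qed

text \<open>
  The oriented integral of \<open>h\<close> from \<open>0\<close> to \<open>z\<close>; the fixed domain of integration makes the same
  formula valid for negative \<open>z\<close>.
\<close>

definition prim :: "(real \<Rightarrow> 'b::euclidean_space) \<Rightarrow> real \<Rightarrow> 'b" where
  "prim h z = integral {0..1} (\<lambda>\<theta>. z *\<^sub>R h (z * \<theta>))"

text \<open>The substitution \<open>s = y * \<theta>\<close> identifies \<open>prim h y\<close> with
  \<open>H y - H 0\<close> for an antiderivative \<open>H\<close> of \<open>h\<close> on
  \<open>{-M..M}\<close>.\<close>

lemma prim_has_vector_derivative:
  assumes "continuous_on UNIV h"
  shows "(prim h has_vector_derivative h z) (at z)"
proof -
  \<comment> \<open>Exceeding \<open>\<bar>z\<bar>\<close> makes \<open>z\<close> an interior point,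
    so the formula holds in a neighbourhood and the derivative is two-sided.\<close>
  define M where "M = \<bar>z\<bar> + 1"
  obtain H where H: "\<And>x. x \<in> {-M..M} \<Longrightarrow> (H has_vector_derivative h x) (at x within {-M..M})"
    using antiderivative_continuous[of "-M" M h] continuous_on_subset[OF assms] by blast
  have eq: "prim h y = H y - H 0" if "y \<in> {-M..M}" for y
  proof -
    have sub: "(\<lambda>\<theta>. y * \<theta>) ` {0..1} \<subseteq> {-M..M}"
    proof safe
      fix \<theta> :: real assume "\<theta> \<in> {0..1}"
      then have "\<bar>y * \<theta>\<bar> \<le> \<bar>y\<bar> * 1" unfolding abs_mult by (intro mult_left_mono) auto
      then show "y * \<theta> \<in> {-M..M}" using that by auto
    qed
    have "((\<lambda>\<theta>. y *\<^sub>R h (y * \<theta>)) has_integral (H (y * 1) - H (y * 0))) {0..1}"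
    proof (rule fundamental_theorem_of_calculus)
      fix \<theta> :: real assume \<theta>: "\<theta> \<in> {0..1}"
      have "((H \<circ> (\<lambda>\<theta>. y * \<theta>)) has_vector_derivative y *\<^sub>R h (y * \<theta>)) (at \<theta> within {0..1})"
      proof (rule vector_diff_chain_within)
        show "((*) y has_vector_derivative y) (at \<theta> within {0..1})"
          by (auto intro!: derivative_eq_intros)
        show "(H has_vector_derivative h (y * \<theta>)) (at (y * \<theta>) within (*) y ` {0..1})"
          using H sub \<theta> by (meson has_vector_derivative_within_subset image_subset_iff)
      qed
      then show "((\<lambda>\<theta>. H (y * \<theta>)) has_vector_derivative y *\<^sub>R h (y * \<theta>)) (at \<theta> within {0..1})"
        by (simp add: o_def)
    qed simp
    from integral_unique[OF this] show ?thesis by (simp only: prim_def mult_1_right mult_zero_right)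
  qed
  have zi: "z \<in> interior {-M..M}" by (auto simp: M_def interior_atLeastAtMost_real)
  then have "(H has_vector_derivative h z) (at z)"
    using H[of z] by (metis at_within_interior interior_subset subsetD)
  then have "((\<lambda>y. H y - H 0) has_vector_derivative h z) (at z)"
    by (auto intro!: derivative_eq_intros)
  then show ?thesis
    by (rule has_vector_derivative_transform_within_open[OF _ open_interior zi])
      (use eq interior_subset in \<open>metis subsetD\<close>)
qed

section \<open>Differentiation under the integral sign on sets joined by short curves\<close>

text \<open>A local, pointed form of quasiconvexity (Whitney's condition): \<open>C\<close> and
  \<open>r\<close> may depend on \<open>a\<close>. It replaces convexity in the mean value
  inequality when derivatives are known within \<open>A\<close> only, where a segment from
  \<open>a\<close> to \<open>b\<close> may leave \<open>A\<close>.\<close>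

definition quasiconvex_set :: "'a::euclidean_space set \<Rightarrow> bool" where
  "quasiconvex_set A \<longleftrightarrow> (\<forall>a\<in>A. \<exists>C. \<exists>r>0. \<forall>b\<in>A \<inter> ball a r. \<exists>c c'. c (0::real) = a \<and> c 1 = b \<and>
     (\<forall>\<tau>\<in>{0..1}. c \<tau> \<in> A \<and> (c has_vector_derivative c' \<tau>) (at \<tau> within {0..1}) \<and>
        norm (c' \<tau>) \<le> C * dist a b))"

text \<open>\<open>Ck_on\<close> controls derivatives direction by direction; bounds in the basis
  directions give back a bound for the whole linear map, at the price of the factor
  \<open>DIM('a)\<close>.\<close>

lemma linear_norm_le_Basis:
  fixes L :: "'a::euclidean_space \<Rightarrow> 'b::real_normed_vector"
  assumes "linear L" "\<And>b. b \<in> Basis \<Longrightarrow> norm (L b) \<le> e"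
  shows "norm (L v) \<le> real DIM('a) * e * norm v"
proof -
  have "L v = (\<Sum>b\<in>Basis. (v \<bullet> b) *\<^sub>R L b)"
    by (subst euclidean_representation[of v, symmetric])
      (simp add: linear_sum[OF assms(1)] linear_cmul[OF assms(1)])
  also have "norm \<dots> \<le> (\<Sum>b\<in>(Basis::'a set). norm v * e)"
    by (intro sum_norm_le) (auto intro!: mult_mono assms Basis_le_norm)
  finally show ?thesis by (simp add: algebra_simps)
qed

text \<open>
  The remainder is estimated by integrating along the curves in \<open>A\<close>; a pointwise estimate would not
  be uniform in \<open>s\<close>.
\<close>

lemma uniform_differentiability:
  fixes f :: "'a::euclidean_space \<times> real \<Rightarrow> 'b::euclidean_space"
  assumes A: "compact A" "quasiconvex_set A" and a: "a \<in> A" and K: "compact K"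
    and f': "\<And>x. x \<in> A \<times> UNIV \<Longrightarrow> (f has_derivative f' x) (at x within A \<times> UNIV)"
    and cont: "\<And>v. continuous_on (A \<times> UNIV) (\<lambda>x. f' x v)" and e: "0 < e"
  shows "\<exists>d>0. \<forall>b\<in>A \<inter> ball a d. \<forall>s\<in>K. norm (f (b, s) - f (a, s) - f' (a, s) (b - a, 0)) \<le> e * norm (b - a)"
proof -
  obtain C r where r: "r > 0" and Cr: "\<And>b. b \<in> A \<inter> ball a r \<Longrightarrow> \<exists>c c'. c (0::real) = a \<and> c 1 = b \<and>
     (\<forall>\<tau>\<in>{0..1}. c \<tau> \<in> A \<and> (c has_vector_derivative c' \<tau>) (at \<tau> within {0..1}) \<and>
        norm (c' \<tau>) \<le> C * dist a b)"
    using A(2) a unfolding quasiconvex_set_def by metis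
  define C' where "C' = max C 1"
  define n where "n = real DIM('a \<times> real)"
  \<comment> \<open>\<open>n\<close> pays for passing from basis directions to the norm,
    \<open>C'\<close> for the speed of the curve; \<open>C'\<close> is at least 1 so that the
    quotient is positive.\<close>
  define e' where "e' = e / (n * C')"
  have n: "n > 0" unfolding n_def by simp
  have e': "e' > 0" using e n by (auto simp: e'_def C'_def)
  have "\<exists>d>0. \<forall>b'\<in>A. \<forall>s\<in>K. dist b' a < d \<longrightarrow> norm (f' (b', s) b - f' (a, s) b) \<le> e'" for b
  proof -
    have "uniformly_continuous_on (A \<times> K) (\<lambda>x. f' x b)"
      by (intro compact_uniformly_continuous continuous_on_subset[OF cont] compact_Times A K) auto
    from uniformly_continuous_onE[OF this e'] obtain d where d: "d > 0"
      "\<And>x x'. x \<in> A \<times> K \<Longrightarrow> x' \<in> A \<times> K \<Longrightarrow> dist x' x < d \<Longrightarrow> dist (f' x' b) (f' x b) < e'" by metis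
    show ?thesis
    proof (intro exI[of _ d] conjI d ballI impI)
      fix b' s assume "b' \<in> A" "s \<in> K" "dist b' a < d"
      then show "norm (f' (b', s) b - f' (a, s) b) \<le> e'"
        using d(2)[of "(a, s)" "(b', s)"] a by (simp add: dist_Pair_Pair dist_norm)
    qed
  qed
  then obtain D where D: "\<And>b. D b > 0"
    "\<And>b b' s. b' \<in> A \<Longrightarrow> s \<in> K \<Longrightarrow> dist b' a < D b \<Longrightarrow> norm (f' (b', s) b - f' (a, s) b) \<le> e'" by metis
  define d0 where "d0 = Min (D ` Basis)"
  have d0: "d0 > 0" "\<And>b. b \<in> Basis \<Longrightarrow> d0 \<le> D b" using D(1) by (auto simp: d0_def)
  \<comment> \<open>A curve of speed at most \<open>C' * dist a b\<close> then stays within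
    \<open>d0\<close> of \<open>a\<close>; the \<open>+ 1\<close> makes the inequality
    strict.\<close>
  define d where "d = min r (d0 / (C' + 1))"
  have C': "C' \<ge> 1" "C \<le> C'" by (auto simp: C'_def)
  have "d > 0" using d0 r C' by (auto simp: d_def)
  moreover have "norm (f (b, s) - f (a, s) - f' (a, s) (b - a, 0)) \<le> e * norm (b - a)"
    if b: "b \<in> A \<inter> ball a d" and s: "s \<in> K" for b s
  proof -
    have "b \<in> A \<inter> ball a r" using b by (auto simp: d_def)
    then obtain c c' where c: "c (0::real) = a" "c 1 = b"
      "\<And>\<tau>. \<tau>\<in>{0..1} \<Longrightarrow> c \<tau> \<in> A" "\<And>\<tau>. \<tau>\<in>{0..1} \<Longrightarrow> (c has_vector_derivative c' \<tau>) (at \<tau> within {0..1})"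
      "\<And>\<tau>. \<tau>\<in>{0..1} \<Longrightarrow> norm (c' \<tau>) \<le> C * dist a b"
      using Cr by metis
    have c'C: "norm (c' \<tau>) \<le> C' * dist a b" if "\<tau>\<in>{0..1}" for \<tau>
      using c(5)[OF that] C' by (meson mult_right_mono order_trans zero_le_dist)
    have near: "dist (c \<tau>) a < d0" if "\<tau>\<in>{0..1}" for \<tau>
    proof -
      have "norm (c \<tau> - c 0) \<le> (C' * dist a b) * norm (\<tau> - 0)"
      proof (rule differentiable_bound)
        show "convex {0..1::real}" by simp
        show "(c has_derivative (\<lambda>h. h *\<^sub>R c' x)) (at x within {0..1})" if "x \<in> {0..1}" for x
          using c(4)[OF that] by (simp add: has_vector_derivative_def)
        show "onorm (\<lambda>h. h *\<^sub>R c' x) \<le> C' * dist a b" if "x \<in> {0..1}" for x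
          using c'C[OF that] by (simp add: onorm_scaleR_left onorm_id bounded_linear_ident)
      qed (use that in auto)
      also have "\<dots> \<le> C' * dist a b * 1" using that C' by (intro mult_left_mono) auto
      also have "\<dots> \<le> C' * (d0 / (C' + 1))" unfolding mult_1_right
        using b C' by (intro mult_left_mono) (auto simp: d_def)
      also have "\<dots> < d0" using C' d0 by (simp add: field_simps)
      finally show ?thesis by (simp add: c dist_norm)
    qed
    have lin: "linear (f' x)" if "x \<in> A \<times> UNIV" for x using f'[OF that]
      by (simp add: has_derivative_linear)
    \<comment> \<open>The increment of \<open>G\<close> over \<open>{0..1}\<close> is exactly the
      remainder to be bounded, and \<open>G'\<close> compares \<open>f'\<close> at two points that
      share the same \<open>s\<close>.\<close>
    define G where "G = (\<lambda>\<tau>. f (c \<tau>, s) - f' (a, s) (c \<tau>, 0))"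
    define G' where "G' = (\<lambda>\<tau>. f' (c \<tau>, s) (c' \<tau>, 0) - f' (a, s) (c' \<tau>, 0))"
    have Gle: "norm (G 1 - G 0) \<le> (e * dist a b) * norm (1 - 0 :: real)"
    proof (rule differentiable_bound)
      show "convex {0..1::real}" by simp
      fix \<tau> :: real assume \<tau>: "\<tau> \<in> {0..1}"
      have cd: "(c has_derivative (\<lambda>h. h *\<^sub>R c' \<tau>)) (at \<tau> within {0..1})"
        using c(4)[OF \<tau>] by (simp add: has_vector_derivative_def)
      have pd: "((\<lambda>\<tau>. (c \<tau>, s)) has_derivative (\<lambda>h. (h *\<^sub>R c' \<tau>, 0))) (at \<tau> within {0..1})"
        "((\<lambda>\<tau>. (c \<tau>, 0::real)) has_derivative (\<lambda>h. (h *\<^sub>R c' \<tau>, 0))) (at \<tau> within {0..1})"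
        by (auto intro!: derivative_eq_intros cd)
      have sc: "f' x (h *\<^sub>R c' \<tau>, 0) = h *\<^sub>R f' x (c' \<tau>, 0)" if "x \<in> A \<times> UNIV" for h x
        using linear_cmul[OF lin[OF that], of h "(c' \<tau>, 0)"] by simp
      have "((\<lambda>\<tau>. f (c \<tau>, s)) has_derivative (\<lambda>h. f' (c \<tau>, s) (h *\<^sub>R c' \<tau>, 0))) (at \<tau> within {0..1})"
        by (rule has_derivative_in_compose2[OF f' _ _ pd(1)]) (use c(3) \<tau> in auto)
      moreover have "((\<lambda>\<tau>. f' (a, s) (c \<tau>, 0)) has_derivative (\<lambda>h. f' (a, s) (h *\<^sub>R c' \<tau>, 0))) (at \<tau> within {0..1})"
        using bounded_linear.has_derivative[OF has_derivative_bounded_linear[OF f'] pd(2)] a by auto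
      ultimately show "(G has_derivative (\<lambda>h. h *\<^sub>R G' \<tau>)) (at \<tau> within {0..1})"
        unfolding G_def G'_def using sc[of "(c \<tau>, s)"] sc[of "(a, s)"] c(3)[OF \<tau>] a
        by (auto intro!: derivative_eq_intros simp: scaleR_diff_right)
      have "linear (\<lambda>v. f' (c \<tau>, s) v - f' (a, s) v)"
        using lin c(3)[OF \<tau>] a by (intro linear_compose_sub) auto
      then have "norm (G' \<tau>) \<le> n * e' * norm (c' \<tau>, 0::real)"
        unfolding G'_def n_def
        by (rule linear_norm_le_Basis)
          (use D(2) c(3) s near d0(2) \<tau> in \<open>force intro: less_le_trans\<close>)
      also have "\<dots> \<le> n * e' * (C' * dist a b)"
        using c'C[OF \<tau>] n e' by (intro mult_left_mono) (auto simp: norm_Pair)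
      also have "\<dots> = e * dist a b" using n C' by (simp add: e'_def)
      finally show "onorm (\<lambda>h. h *\<^sub>R G' \<tau>) \<le> e * dist a b"
        by (simp add: onorm_scaleR_left onorm_id bounded_linear_ident)
    qed auto
    have "f' (a, s) (b - a, 0) = f' (a, s) (b, 0) - f' (a, s) (a, 0)"
      using linear_diff[OF lin, of "(a,s)" "(b,0)" "(a,0)"] a by simp
    then have G01: "G 1 - G 0 = f (b, s) - f (a, s) - f' (a, s) (b - a, 0)"
      by (simp add: G_def c algebra_simps)
    from Gle show ?thesis unfolding G01 by (simp add: dist_norm norm_minus_commute[of a b])
  qed
  ultimately show ?thesis by blast
qed

lemma prim_param_continuous:
  fixes f :: "'a::euclidean_space \<times> real \<Rightarrow> 'b::euclidean_space"
  assumes "continuous_on (A \<times> UNIV) f" "continuous_on UNIV g"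
  shows "continuous_on (A \<times> UNIV) (\<lambda>(a, z). prim (\<lambda>s. g s *\<^sub>R f (a, s)) z)"
proof -
  have "continuous_on ((A \<times> UNIV) \<times> cbox 0 1)
     (\<lambda>(x, \<theta>). snd x *\<^sub>R (g (snd x * \<theta>) *\<^sub>R f (fst x, snd x * \<theta>)))"
    unfolding case_prod_unfold
    by (intro continuous_intros continuous_on_compose2[OF assms(1)] continuous_on_compose2[OF assms(2)]) auto
  from integral_continuous_on_param[OF this] show ?thesis
    by (simp add: prim_def case_prod_unfold)
qed

text \<open>At fixed \<open>z\<close> the derivative in \<open>a\<close> is taken under the integral
  sign, with the uniform remainder estimate applied to all \<open>s\<close> between 0 and
  \<open>z\<close>. The derivative in \<open>z\<close> exists everywhere and is jointly continuous,
  which is what \<open>has_derivative_partialsI\<close> needs to combine the two.\<close>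

lemma prim_param_has_derivative:
  fixes f :: "'a::euclidean_space \<times> real \<Rightarrow> 'b::euclidean_space"
  assumes A: "compact A" "quasiconvex_set A" and a: "a \<in> A"
    and f': "\<And>x. x \<in> A \<times> UNIV \<Longrightarrow> (f has_derivative f' x) (at x within A \<times> UNIV)"
    and cont: "\<And>v. continuous_on (A \<times> UNIV) (\<lambda>x. f' x v)"
    and g: "continuous_on UNIV g"
  shows "((\<lambda>(a, z). prim (\<lambda>s. g s *\<^sub>R f (a, s)) z) has_derivative
     (\<lambda>(v, w). prim (\<lambda>s. g s *\<^sub>R f' (a, s) (v, 0)) z + w *\<^sub>R (g z *\<^sub>R f (a, z)))) (at (a, z) within A \<times> UNIV)"
proof -
  have fc: "continuous_on (A \<times> UNIV) f"
    using f' by (rule has_derivative_continuous_on)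
  have lin: "linear (f' x)" if "x \<in> A \<times> UNIV" for x using f'[OF that]
    by (simp add: has_derivative_linear)
  have gz: "continuous_on {0..1} (\<lambda>\<theta>. z *\<^sub>R g (z * \<theta>) *\<^sub>R h (z * \<theta>))" if "continuous_on UNIV h" for h :: "real \<Rightarrow> 'b"
    by (intro continuous_intros continuous_on_compose2[OF g] continuous_on_compose2[OF that]) auto
  have fa: "continuous_on UNIV (\<lambda>s. f (b, s))" if "b \<in> A" for b
    using that by (intro continuous_on_compose2[OF fc] continuous_intros) auto
  have fa': "continuous_on UNIV (\<lambda>s. f' (a, s) v)" for v
    using a by (intro continuous_on_compose2[OF cont] continuous_intros) auto
  note int1 = integrable_continuous_real[OF gz[OF fa]] and int2 = integrable_continuous_real[OF gz[OF fa']]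
  define P where "P = (\<lambda>v. prim (\<lambda>s. g s *\<^sub>R f' (a, s) (v, 0)) z)"
  have Plin: "linear P"
  proof (rule linearI)
    fix v w
    have "f' (a, s) (v + w, 0) = f' (a, s) (v, 0) + f' (a, s) (w, 0)" for s
      using linear_add[OF lin, of "(a,s)" "(v,0)" "(w,0)"] a by simp
    then show "P (v + w) = P v + P w" unfolding P_def prim_def
      by (simp add: scaleR_add_right) (rule integral_add; use int2 in simp)
  next
    fix r v
    have "f' (a, s) (r *\<^sub>R v, 0) = r *\<^sub>R f' (a, s) (v, 0)" for s
      using linear_cmul[OF lin, of "(a,s)" r "(v,0)"] a by simp
    then have "P (r *\<^sub>R v) = integral {0..1} (\<lambda>\<theta>. r *\<^sub>R (z *\<^sub>R g (z * \<theta>) *\<^sub>R f' (a, z * \<theta>) (v, 0)))"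
      unfolding P_def prim_def by (simp add: mult_ac)
    also have "\<dots> = r *\<^sub>R P v" unfolding P_def prim_def by (rule integral_cmul)
    finally show "P (r *\<^sub>R v) = r *\<^sub>R P v" .
  qed
  \<comment> \<open>Bounds the weight that multiplies the remainder, so that the tolerance
    \<open>e / B\<close> integrates to at most \<open>e\<close>.\<close>
  obtain B where B: "B > 0" "\<And>\<theta>. \<theta> \<in> {0..1} \<Longrightarrow> norm (z *\<^sub>R g (z * \<theta>)) \<le> B"
  proof -
    have "continuous_on {0..1} (\<lambda>\<theta>. z *\<^sub>R g (z * \<theta>))"
      by (intro continuous_intros continuous_on_compose2[OF g]) auto
    then have "bounded ((\<lambda>\<theta>. z *\<^sub>R g (z * \<theta>)) ` {0..1})"
      by (intro compact_imp_bounded compact_continuous_image) auto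
    then show ?thesis using that unfolding bounded_pos by auto
  qed
  have "((\<lambda>b. prim (\<lambda>s. g s *\<^sub>R f (b, s)) z) has_derivative P) (at a within A)"
    unfolding has_derivative_within_alt
  proof (intro conjI allI impI)
    show "bounded_linear P" using Plin by (simp add: linear_conv_bounded_linear)
    fix e :: real assume "0 < e"
    then have "0 < e / B" using B by simp
    have "compact ((\<lambda>\<theta>. z * \<theta>) ` {0..1})" by (intro compact_continuous_image continuous_intros) auto
    from uniform_differentiability[OF A a this f' cont \<open>0 < e / B\<close>] obtain d where d: "d > 0"
      "\<And>b \<theta>. b \<in> A \<inter> ball a d \<Longrightarrow> \<theta> \<in> {0..1} \<Longrightarrow>
        norm (f (b, z * \<theta>) - f (a, z * \<theta>) - f' (a, z * \<theta>) (b - a, 0)) \<le> e / B * norm (b - a)" by fast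
    show "\<exists>d>0. \<forall>y\<in>A. norm (y - a) < d \<longrightarrow>
      norm (prim (\<lambda>s. g s *\<^sub>R f (y, s)) z - prim (\<lambda>s. g s *\<^sub>R f (a, s)) z - P (y - a)) \<le> e * norm (y - a)"
    proof (intro exI[of _ d] conjI d ballI impI)
      fix b assume b: "b \<in> A" "norm (b - a) < d"
      have "prim (\<lambda>s. g s *\<^sub>R f (b, s)) z - prim (\<lambda>s. g s *\<^sub>R f (a, s)) z - P (b - a)
        = integral {0..1} (\<lambda>\<theta>. (z *\<^sub>R g (z * \<theta>)) *\<^sub>R (f (b, z * \<theta>) - f (a, z * \<theta>) - f' (a, z * \<theta>) (b - a, 0)))"
        unfolding prim_def P_def
        by (subst integral_diff[symmetric], use a b int1 int2 in \<open>(auto intro!: integrable_diff)[2]\<close>)+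
          (simp add: algebra_simps)
      also have "norm \<dots> \<le> e * norm (b - a) * (1 - 0)"
      proof (rule integral_bound)
        show "continuous_on {0..1} (\<lambda>\<theta>. (z *\<^sub>R g (z * \<theta>)) *\<^sub>R (f (b, z * \<theta>) - f (a, z * \<theta>) - f' (a, z * \<theta>) (b - a, 0)))"
          using gz[OF fa[OF b(1)]] gz[OF fa[OF a]] gz[OF fa'[of "(b-a,0)"]]
          by (simp add: scaleR_diff_right continuous_on_diff)
        fix \<theta> :: real assume \<theta>: "\<theta> \<in> {0..1}"
        have "norm (f (b, z * \<theta>) - f (a, z * \<theta>) - f' (a, z * \<theta>) (b - a, 0)) \<le> e / B * norm (b - a)"
          using b by (intro d(2)[OF _ \<theta>]) (simp add: dist_norm norm_minus_commute[of a])
        then have "norm ((z *\<^sub>R g (z * \<theta>)) *\<^sub>R (f (b, z * \<theta>) - f (a, z * \<theta>) - f' (a, z * \<theta>) (b - a, 0)))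
          \<le> B * (e / B * norm (b - a))"
          unfolding norm_scaleR[of "z *\<^sub>R g (z * \<theta>)"] using B(2)[OF \<theta>] B(1) by (intro mult_mono) auto
        then show "norm ((z *\<^sub>R g (z * \<theta>)) *\<^sub>R (f (b, z * \<theta>) - f (a, z * \<theta>) - f' (a, z * \<theta>) (b - a, 0)))
          \<le> e * norm (b - a)" using B(1) by simp
      qed simp
      finally show "norm (prim (\<lambda>s. g s *\<^sub>R f (b, s)) z - prim (\<lambda>s. g s *\<^sub>R f (a, s)) z - P (b - a)) \<le> e * norm (b - a)"
        by simp
    qed
  qed
  moreover have "((\<lambda>z. prim (\<lambda>s. g s *\<^sub>R f (b, s)) z) has_derivative
       blinfun_apply (blinfun_scaleR_left (g y *\<^sub>R f (b, y)))) (at y within UNIV)" if "b \<in> A" for b y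
    using prim_has_vector_derivative[of "\<lambda>s. g s *\<^sub>R f (b, s)" y] continuous_on_scaleR[OF g fa[OF that]]
    by (simp add: has_vector_derivative_def)
  moreover have "continuous (at (a, z) within A \<times> UNIV) (\<lambda>(b, y). blinfun_scaleR_left (g y *\<^sub>R f (b, y)))"
  proof -
    have "continuous_on (A \<times> UNIV) (\<lambda>x. blinfun_scaleR_left (g (snd x) *\<^sub>R f x))"
      by (intro continuous_intros continuous_on_compose2[OF g] fc) auto
    then show ?thesis using a by (simp add: continuous_on_eq_continuous_within case_prod_unfold)
  qed
  ultimately have "((\<lambda>(a, z). prim (\<lambda>s. g s *\<^sub>R f (a, s)) z) has_derivative
     (\<lambda>(v, w). P v + blinfun_apply (blinfun_scaleR_left (g z *\<^sub>R f (a, z))) w)) (at (a, z) within A \<times> UNIV)"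
    by (intro has_derivative_partialsI) auto
  then show ?thesis by (simp add: P_def)
qed

text \<open>The derivative in \<open>a\<close> is again such a primitive, with \<open>f\<close>
  replaced by \<open>f'\<close> in a fixed direction, and falls to the induction hypothesis; the
  derivative in \<open>z\<close> is \<open>g z *\<^sub>R f (a, z)\<close>. Hence \<open>g\<close>
  may have one derivative less than \<open>f\<close>.\<close>

lemma prim_param_Ck:
  fixes f :: "'a::euclidean_space \<times> real \<Rightarrow> 'b::euclidean_space"
  assumes A: "compact A" "quasiconvex_set A"
    and "Ck_on k UNIV g" "Ck_on (Suc k) (A \<times> UNIV) f"
  shows "Ck_on (Suc k) (A \<times> UNIV) (\<lambda>(a, z). prim (\<lambda>s. g s *\<^sub>R f (a, s)) z)"
  using assms(3,4)
proof (induction k arbitrary: f)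
  case (0 f)
  then obtain f' where f': "\<And>x. x \<in> A \<times> UNIV \<Longrightarrow> (f has_derivative f' x) (at x within A \<times> UNIV)"
    "\<And>v. continuous_on (A \<times> UNIV) (\<lambda>x. f' x v)" by auto
  have g: "continuous_on UNIV g" and fc: "continuous_on (A \<times> UNIV) f"
    using 0 has_derivative_continuous_on[OF f'(1)] by auto
  define D where "D = (\<lambda>(a, z) (v, w). prim (\<lambda>s. g s *\<^sub>R f' (a, s) (v, 0)) z + w *\<^sub>R (g z *\<^sub>R f (a, z)))"
  have cv: "continuous_on (A \<times> UNIV) (\<lambda>x. D x (v, w))" for v w
    unfolding D_def case_prod_unfold
    using prim_param_continuous[OF f'(2) g, of "(v, 0)"]
    by (auto simp: case_prod_unfold intro!: continuous_intros fc continuous_on_compose2[OF g])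
  have "((\<lambda>(a, z). prim (\<lambda>s. g s *\<^sub>R f (a, s)) z) has_derivative D x) (at x within A \<times> UNIV)"
    if "x \<in> A \<times> UNIV" for x
    using that prim_param_has_derivative[OF A _ f' g, of "fst x" "snd x"]
    by (auto simp: D_def split: prod.splits)
  moreover have "continuous_on (A \<times> UNIV) (\<lambda>x. D x vw)" for vw
    by (cases vw) (use cv in simp)
  ultimately show ?case
    by (subst Ck_on.simps(2), intro exI[of _ D] conjI ballI allI) (simp_all only: Ck_on.simps(1))
next
  case (Suc k f)
  then obtain f' where f': "\<And>x. x \<in> A \<times> UNIV \<Longrightarrow> (f has_derivative f' x) (at x within A \<times> UNIV)"
    "\<And>v. Ck_on (Suc k) (A \<times> UNIV) (\<lambda>x. f' x v)" by (subst (asm) (2) Ck_on.simps(2)) blast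
  have gk: "Ck_on k UNIV g" using Suc.prems Ck_on_Suc_D by blast
  have g: "continuous_on UNIV g" and f'c: "\<And>v. continuous_on (A \<times> UNIV) (\<lambda>x. f' x v)"
    using Ck_on_mono[OF gk, of 0] Ck_on_mono[OF f'(2), of 0] by auto
  define D where "D = (\<lambda>(a, z) (v, w). prim (\<lambda>s. g s *\<^sub>R f' (a, s) (v, 0)) z + w *\<^sub>R (g z *\<^sub>R f (a, z)))"
  have cv: "Ck_on (Suc k) (A \<times> UNIV) (\<lambda>x. D x (v, w))" for v w
  proof -
    have "Ck_on (Suc k) (A \<times> UNIV) (\<lambda>x. (case x of (a, z) \<Rightarrow> prim (\<lambda>s. g s *\<^sub>R f' (a, s) (v, 0)) z) + w *\<^sub>R (g (snd x) *\<^sub>R f x))"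
      by (intro Ck_on_add Ck_on_scaleR Ck_on_const Suc.IH[OF gk f'(2)] Ck_on_Suc_D[OF Suc.prems(2)]
        Ck_on_comp_linear[OF bounded_linear_snd _ Suc.prems(1)]) auto
    then show ?thesis by (simp add: D_def case_prod_unfold)
  qed
  have "((\<lambda>(a, z). prim (\<lambda>s. g s *\<^sub>R f (a, s)) z) has_derivative D x) (at x within A \<times> UNIV)"
    if "x \<in> A \<times> UNIV" for x
    using that prim_param_has_derivative[OF A _ f'(1) f'c g, of "fst x" "snd x"]
    by (auto simp: D_def split: prod.splits)
  moreover have "Ck_on (Suc k) (A \<times> UNIV) (\<lambda>x. D x vw)" for vw
    by (cases vw) (use cv in \<open>simp only: prod.case\<close>)
  ultimately show ?case
    by (subst Ck_on.simps(2), intro exI[of _ D] conjI ballI allI) (simp_all only: Ck_on.simps(1))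
qed

section \<open>Boundary charts and the exterior normal\<close>

lemma Ck_on_sum:
  assumes "finite I" "\<And>i. i \<in> I \<Longrightarrow> Ck_on k S (f i)"
  shows "Ck_on k S (\<lambda>x. \<Sum>i\<in>I. f i x)"
  using assms by (induction I rule: finite_induct) (auto intro: Ck_on_const Ck_on_add)

lemma Ck_on_Lipschitz_cball:
  fixes h :: "'a::euclidean_space \<Rightarrow> 'b::euclidean_space"
  assumes "Ck_on 1 UNIV h"
  obtains L where "0 \<le> L" "\<And>x y. x \<in> cball a r \<Longrightarrow> y \<in> cball a r \<Longrightarrow> norm (h x - h y) \<le> L * norm (x - y)"
proof -
  obtain h' where h': "\<And>x. (h has_derivative h' x) (at x)" "\<And>v. continuous_on UNIV (\<lambda>x. h' x v)"
    using assms by auto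
  have "\<exists>B. \<forall>x\<in>cball a r. norm (h' x b) \<le> B" for b
  proof -
    have "bounded ((\<lambda>x. h' x b) ` cball a r)"
      by (intro compact_imp_bounded compact_continuous_image continuous_on_subset[OF h'(2)]) auto
    then show ?thesis by (auto simp: bounded_iff)
  qed
  then obtain B where B: "\<And>b x. x \<in> cball a r \<Longrightarrow> norm (h' x b) \<le> B b" by metis
  define K where "K = Max (insert 0 (B ` Basis))"
  have K: "0 \<le> K" "\<And>b. b \<in> Basis \<Longrightarrow> B b \<le> K" using Max_ge[of "insert 0 (B ` Basis)"] by (auto simp: K_def simp del: Max_insert)
  show ?thesis
  proof (rule that[of "real DIM('a) * K"])
    show "0 \<le> real DIM('a) * K" using K by simp
    fix x y assume xy: "x \<in> cball a r" "y \<in> cball a r"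
    show "norm (h x - h y) \<le> real DIM('a) * K * norm (x - y)"
    proof (rule differentiable_bound[where S = "cball a r"])
      show "(h has_derivative h' x) (at x within cball a r)" for x
        using h'(1) by (rule has_derivative_at_withinI)
      show "onorm (h' x) \<le> real DIM('a) * K" if "x \<in> cball a r" for x
      proof (rule onorm_le, rule linear_norm_le_Basis)
        show "linear (h' x)" using h'(1) by (rule has_derivative_linear)
        show "norm (h' x b) \<le> K" if "b \<in> Basis" for b
          using B[of x b] K(2)[of b] \<open>x \<in> cball a r\<close> that by simp
      qed
    qed (use xy in auto)
  qed
qed

text \<open>\<open>g\<close> grows strictly along \<open>e\<close>, so a point with
  \<open>g x \<le> 0\<close> is the limit of the points \<open>x + s *\<^sub>R e\<close> with
  \<open>s < 0\<close>, which lie in \<Omega>. The frontier is what the closure adds to the open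
  set.\<close>

lemma frontier_chart:
  fixes \<Omega> :: "'a::euclidean_space set"
  assumes "open \<Omega>"
    and chart: "\<Omega> \<inter> ball \<xi> r = {x \<in> ball \<xi> r. g x < (0::real)}"
    and g: "continuous_on UNIV g" and e: "\<And>x s. g (x + s *\<^sub>R e) = g x + s"
  shows "closure \<Omega> \<inter> ball \<xi> r = {x \<in> ball \<xi> r. g x \<le> 0}"
    and "frontier \<Omega> \<inter> ball \<xi> r = {x \<in> ball \<xi> r. g x = 0}"
proof -
  show cl: "closure \<Omega> \<inter> ball \<xi> r = {x \<in> ball \<xi> r. g x \<le> 0}"
  proof safe
    fix x assume x: "x \<in> closure \<Omega>" "x \<in> ball \<xi> r"
    have "x \<in> closure (\<Omega> \<inter> ball \<xi> r)"
      unfolding Int_commute[of \<Omega>] using open_Int_closure_subset[OF open_ball] x by blast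
    also have "\<dots> \<subseteq> {x. g x \<le> 0}"
    proof (rule closure_minimal)
      show "\<Omega> \<inter> ball \<xi> r \<subseteq> {x. g x \<le> 0}" unfolding chart by auto
      show "closed {x. g x \<le> 0}" using g by (intro closed_Collect_le continuous_on_const)
    qed
    finally show "g x \<le> 0" by simp
  next
    fix x assume x: "x \<in> ball \<xi> r" "g x \<le> 0"
    have lim: "((\<lambda>s::real. x + s *\<^sub>R e) \<longlongrightarrow> x + 0 *\<^sub>R e) (at_left 0)"
      by (rule tendsto_add[OF tendsto_const tendsto_scaleR[OF tendsto_ident_at tendsto_const]])
    have "\<forall>\<^sub>F s in at_left 0. x + s *\<^sub>R e \<in> ball \<xi> r"
      by (rule topological_tendstoD[OF lim open_ball]) (use x in simp)
    moreover have "\<forall>\<^sub>F s::real in at_left 0. s < 0"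
      by (simp add: eventually_at_filter)
    ultimately have "\<forall>\<^sub>F s in at_left 0. x + s *\<^sub>R e \<in> \<Omega>"
    proof eventually_elim
      case (elim s)
      then have "x + s *\<^sub>R e \<in> {x \<in> ball \<xi> r. g x < 0}" using x(2) e[of x s] by simp
      then show ?case unfolding chart[symmetric] by blast
    qed
    then have "\<forall>\<^sub>F s in at_left 0. x + s *\<^sub>R e \<in> closure \<Omega>"
      by eventually_elim (rule subsetD[OF closure_subset])
    then have "x + 0 *\<^sub>R e \<in> closure \<Omega>"
      by (rule Lim_in_closed_set[OF closed_closure _ _ lim]) simp
    then show "x \<in> closure \<Omega>" by simp
  qed
  show "frontier \<Omega> \<inter> ball \<xi> r = {x \<in> ball \<xi> r. g x = 0}"
  proof -
    have "frontier \<Omega> \<inter> ball \<xi> r = closure \<Omega> \<inter> ball \<xi> r - \<Omega> \<inter> ball \<xi> r"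
      unfolding frontier_def interior_open[OF assms(1)] by blast
    also have "\<dots> = {x \<in> ball \<xi> r. g x = 0}" unfolding cl chart by force
    finally show ?thesis .
  qed
qed

text \<open>\<open>g\<close> is a defining function of \<Omega> near \<xi>, the coordinate along
  \<open>e\<close> minus the graph function, and \<open>w\<close> is its gradient. The component of
  \<open>w\<close> along \<open>e\<close> is 1, whence the lower bound on its norm.\<close>

definition boundary_chart ::
  "'a::euclidean_space set \<Rightarrow> 'a \<Rightarrow> real \<Rightarrow> real \<Rightarrow> 'a \<Rightarrow> ('a \<Rightarrow> real) \<Rightarrow> ('a \<Rightarrow> 'a) \<Rightarrow> bool" where
  "boundary_chart \<Omega> \<xi> r L e g w \<longleftrightarrow> 0 < r \<and> 0 < L \<and> norm e = 1 \<and>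
    (\<forall>x s. g (x + s *\<^sub>R e) = g x + s) \<and>
    (\<forall>x. (g has_derivative (\<lambda>v. w x \<bullet> v)) (at x)) \<and>
    (\<forall>x. 1 \<le> norm (w x)) \<and>
    (\<forall>x\<in>ball \<xi> r. \<forall>y\<in>ball \<xi> r. norm (w x - w y) \<le> L * norm (x - y)) \<and>
    \<Omega> \<inter> ball \<xi> r = {x \<in> ball \<xi> r. g x < 0} \<and>
    closure \<Omega> \<inter> ball \<xi> r = {x \<in> ball \<xi> r. g x \<le> 0} \<and>
    frontier \<Omega> \<inter> ball \<xi> r = {x \<in> ball \<xi> r. g x = 0}"

lemma smooth_boundary_chart:
  fixes \<Omega> :: "'a::euclidean_space set"
  assumes "open \<Omega>" "smooth_boundary \<Omega>" "\<xi> \<in> frontier \<Omega>"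
  obtains r L e g w where "boundary_chart \<Omega> \<xi> r L e g w"
proof -
  obtain r e and \<gamma> :: "'a \<Rightarrow> real" where r: "r > 0" and e: "e \<in> Basis \<or> - e \<in> Basis"
    and sm: "smooth_on UNIV \<gamma>" and inv: "\<And>x s. \<gamma> (x + s *\<^sub>R e) = \<gamma> x"
    and chart: "\<Omega> \<inter> ball \<xi> r = {x \<in> ball \<xi> r. x \<bullet> e < \<gamma> x}"
    using assms(2)[unfolded smooth_boundary_def, rule_format, OF assms(3)] by blast
  have ne: "norm e = 1" using e norm_Basis[of e] norm_Basis[of "- e"] by auto
  obtain \<gamma>' where \<gamma>': "\<And>x. (\<gamma> has_derivative \<gamma>' x) (at x)" "\<And>v. Ck_on 1 UNIV (\<lambda>x. \<gamma>' x v)"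
    using sm[unfolded smooth_on_def, rule_format, of "Suc 1"] by (subst (asm) Ck_on.simps(2)) blast
  have lin: "linear (\<gamma>' x)" for x using \<gamma>'(1) by (rule has_derivative_linear)
  define D where "D = (\<lambda>x. \<Sum>b\<in>Basis. \<gamma>' x b *\<^sub>R b)"
  have D: "\<gamma>' x v = D x \<bullet> v" for x v
  proof -
    have "\<gamma>' x v = \<gamma>' x (\<Sum>b\<in>Basis. (v \<bullet> b) *\<^sub>R b)" by (simp add: euclidean_representation)
    also have "\<dots> = (\<Sum>b\<in>Basis. \<gamma>' x b * (b \<bullet> v))"
      by (simp add: linear_sum[OF lin] linear_cmul[OF lin] inner_commute mult.commute)
    finally show ?thesis by (simp add: D_def inner_sum_left)
  qed
  have "Ck_on 1 UNIV D" unfolding D_def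
    by (intro Ck_on_sum Ck_on_scaleR \<gamma>'(2) Ck_on_const) auto
  then obtain L where L: "0 \<le> L" "\<And>x y. x \<in> cball \<xi> r \<Longrightarrow> y \<in> cball \<xi> r \<Longrightarrow> norm (D x - D y) \<le> L * norm (x - y)"
    using Ck_on_Lipschitz_cball by metis
  define g where "g = (\<lambda>x. x \<bullet> e - \<gamma> x)"
  define w where "w = (\<lambda>x. e - D x)"
  have De: "D x \<bullet> e = 0" for x
  proof -
    have "((\<lambda>s. \<gamma> (x + s *\<^sub>R e)) has_derivative (\<lambda>s. \<gamma>' x (s *\<^sub>R e))) (at 0)"
    proof -
      have "((\<lambda>s::real. x + s *\<^sub>R e) has_derivative (\<lambda>s. s *\<^sub>R e)) (at 0)"
        by (auto intro!: derivative_eq_intros)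
      from has_derivative_compose[OF this, of \<gamma> "\<gamma>' x"] \<gamma>'(1)[of x] show ?thesis by simp
    qed
    then have "(\<lambda>s. \<gamma>' x (s *\<^sub>R e)) = (\<lambda>s. 0)"
      unfolding inv by (rule has_derivative_unique) (rule has_derivative_const)
    then show ?thesis using D[of x e] by (metis scaleR_one)
  qed
  have ge: "g (x + s *\<^sub>R e) = g x + s" for x s
    using inv ne by (simp add: g_def inner_add_left dot_square_norm)
  have gd: "(g has_derivative (\<lambda>v. w x \<bullet> v)) (at x)" for x
  proof -
    have "(g has_derivative (\<lambda>v. v \<bullet> e - \<gamma>' x v)) (at x)"
      unfolding g_def by (intro has_derivative_diff \<gamma>'(1) has_derivative_inner_left has_derivative_ident)
    then show ?thesis by (simp add: w_def D inner_diff_left inner_commute[of e])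
  qed
  have gc: "continuous_on UNIV g"
    using gd by (rule has_derivative_continuous_on)
  have ch: "\<Omega> \<inter> ball \<xi> r = {x \<in> ball \<xi> r. g x < 0}" using chart by (auto simp: g_def)
  have w1: "1 \<le> norm (w x)" for x
  proof -
    have "w x \<bullet> e = 1" using De ne by (simp add: w_def inner_diff_left dot_square_norm)
    then show ?thesis using Cauchy_Schwarz_ineq2[of "w x" e] ne by simp
  qed
  \<comment> \<open>The chart records a strictly positive Lipschitz constant, whereas
    \<open>L\<close> may be 0.\<close>
  have wL: "norm (w x - w y) \<le> (L + 1) * norm (x - y)" if "x \<in> ball \<xi> r" "y \<in> ball \<xi> r" for x y
  proof -
    have "norm (D y - D x) \<le> L * norm (y - x)" using that by (intro L(2)) auto
    also have "\<dots> \<le> (L + 1) * norm (y - x)" by (intro mult_right_mono) auto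
    finally show ?thesis by (simp add: w_def norm_minus_commute)
  qed
  have "0 < L + 1" using L by simp
  then have "boundary_chart \<Omega> \<xi> r (L + 1) e g w"
    unfolding boundary_chart_def
    using r ne ge gd w1 wL ch frontier_chart[OF assms(1) ch gc ge] by blast
  then show ?thesis by (rule that)
qed

section \<open>Quasiconvexity of the closed domain\<close>

lemma onorm_inner_le:
  fixes a :: "'a::euclidean_space"
  shows "norm a \<le> M \<Longrightarrow> onorm (\<lambda>v. a \<bullet> v) \<le> M"
proof (rule onorm_le)
  fix v assume "norm a \<le> M"
  then show "norm (a \<bullet> v) \<le> M * norm v"
    using Cauchy_Schwarz_ineq2[of a v] mult_right_mono[of "norm a" M "norm v"] by simp
qed

text \<open>The mean value inequality for \<open>g\<close> minus its linear part at
  \<open>x\<close>: the gradient \<open>w z - w x\<close> of the difference is at most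
  \<open>L * norm (y - x)\<close> along the segment.\<close>

lemma gradient_quadratic_bound:
  fixes g :: "'a::euclidean_space \<Rightarrow> real"
  assumes S: "convex S" and gd: "\<And>x. (g has_derivative (\<lambda>v. w x \<bullet> v)) (at x)"
    and wL: "\<And>x y. x \<in> S \<Longrightarrow> y \<in> S \<Longrightarrow> norm (w x - w y) \<le> L * norm (x - y)"
    and "x \<in> S" "y \<in> S" "0 \<le> L"
  shows "\<bar>g y - g x - w x \<bullet> (y - x)\<bar> \<le> L * (norm (y - x))\<^sup>2"
proof -
  define h where "h = (\<lambda>z. g z - w x \<bullet> z)"
  have sub: "closed_segment x y \<subseteq> S" using S assms(4,5) by (simp add: closed_segment_subset)
  have "norm (h y - h x) \<le> (L * norm (y - x)) * norm (y - x)"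
  proof (rule differentiable_bound[where S = "closed_segment x y"])
    fix z assume z: "z \<in> closed_segment x y"
    show "(h has_derivative (\<lambda>v. (w z - w x) \<bullet> v)) (at z within closed_segment x y)"
      unfolding h_def inner_diff_left
      by (intro has_derivative_diff has_derivative_at_withinI[OF gd] has_derivative_inner_right has_derivative_ident)
    have "norm (w z - w x) \<le> L * norm (z - x)" using z sub assms by (intro wL) auto
    also have "\<dots> \<le> L * norm (y - x)"
      using segment_bound(1)[OF z] assms(6) by (intro mult_left_mono) (auto simp: norm_minus_commute)
    finally show "onorm (\<lambda>v. (w z - w x) \<bullet> v) \<le> L * norm (y - x)"
      by (rule onorm_inner_le)
  qed auto
  then show ?thesis by (simp add: h_def power2_eq_square inner_diff_right algebra_simps)
qed

text \<open>Near an interior point segments suffice. Near a boundary point each point of the segment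
  is pushed along \<open>e\<close> until \<open>g\<close> interpolates linearly between
  \<open>g a\<close> and \<open>g b\<close>; both are nonpositive, so the curve cannot leave the
  closure, and the Lipschitz bound on \<open>g\<close> controls the extra speed.\<close>

lemma quasiconvex_closure_smooth:
  fixes \<Omega> :: "'a::euclidean_space set"
  assumes "open \<Omega>" "smooth_boundary \<Omega>"
  shows "quasiconvex_set (closure \<Omega>)"
  unfolding quasiconvex_set_def
proof
  fix a assume a: "a \<in> closure \<Omega>"
  show "\<exists>C. \<exists>r>0. \<forall>b\<in>closure \<Omega> \<inter> ball a r. \<exists>c c'. c (0::real) = a \<and> c 1 = b \<and>
     (\<forall>\<tau>\<in>{0..1}. c \<tau> \<in> closure \<Omega> \<and> (c has_vector_derivative c' \<tau>) (at \<tau> within {0..1}) \<and>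
        norm (c' \<tau>) \<le> C * dist a b)"
  proof (cases "a \<in> \<Omega>")
    case True
    then obtain r where r: "r > 0" "ball a r \<subseteq> \<Omega>" using assms(1) open_contains_ball by blast
    have "a + \<tau> *\<^sub>R (b - a) \<in> closure \<Omega>" if "b \<in> ball a r" "\<tau> \<in> {0..1}" for b \<tau>
    proof -
      have "a + \<tau> *\<^sub>R (b - a) \<in> ball a r"
        using convexD_alt[OF convex_ball, of a a r b \<tau>] that r(1) by (simp add: algebra_simps)
      then show ?thesis using r(2) closure_subset by blast
    qed
    then have "\<exists>c c'. c (0::real) = a \<and> c 1 = b \<and>
       (\<forall>\<tau>\<in>{0..1}. c \<tau> \<in> closure \<Omega> \<and> (c has_vector_derivative c' \<tau>) (at \<tau> within {0..1}) \<and>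
        norm (c' \<tau>) \<le> 1 * dist a b)" if "b \<in> closure \<Omega> \<inter> ball a r" for b
      using that by (intro exI[of _ "\<lambda>\<tau>. a + \<tau> *\<^sub>R (b - a)"] exI[of _ "\<lambda>_. b - a"])
       (auto intro!: derivative_eq_intros simp: dist_norm norm_minus_commute)
    then show ?thesis using r(1) by blast
  next
    case False
    then have fr: "a \<in> frontier \<Omega>" using a assms(1) by (simp add: frontier_def interior_open)
    obtain r L e g w where ch: "boundary_chart \<Omega> a r L e g w"
      using smooth_boundary_chart[OF assms fr] by blast
    have r: "0 < r" "0 < L" "norm e = 1" and ge: "\<And>x s. g (x + s *\<^sub>R e) = g x + s"
      and gd: "\<And>x. (g has_derivative (\<lambda>v. w x \<bullet> v)) (at x)"
      and wL: "\<And>x y. x \<in> ball a r \<Longrightarrow> y \<in> ball a r \<Longrightarrow> norm (w x - w y) \<le> L * norm (x - y)"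
      and cl: "closure \<Omega> \<inter> ball a r = {x \<in> ball a r. g x \<le> 0}"
      using ch unfolding boundary_chart_def by blast+
    define M where "M = norm (w a) + L * r"
    have wM: "norm (w x) \<le> M" if "x \<in> ball a r" for x
    proof -
      have "norm (w x - w a) \<le> L * norm (x - a)" using that r by (intro wL) auto
      also have "\<dots> \<le> L * r" using that r by (intro mult_left_mono) (auto simp: dist_norm norm_minus_commute)
      finally show ?thesis using norm_triangle_sub[of "w x" "w a"] by (simp add: M_def)
    qed
    have M: "M \<ge> 0" using r by (simp add: M_def)
    \<comment> \<open>The pushed curve has speed at most \<open>(1 + 2 * M) * dist a b\<close>: one
      \<open>dist a b\<close> from the segment, and \<open>M * dist a b\<close> each from the slope
      of the interpolation and from the gradient. With this radius it remains in the chart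
      ball.\<close>
    define r' where "r' = r / (1 + 2 * M)"
    have r': "r' > 0" "r' \<le> r" using r M by (auto simp: r'_def divide_le_eq algebra_simps)
    have gLip: "\<bar>g x - g y\<bar> \<le> M * norm (x - y)" if "x \<in> ball a r" "y \<in> ball a r" for x y
    proof -
      have "norm (g x - g y) \<le> M * norm (x - y)"
      proof (rule differentiable_bound[where S="ball a r"])
        show "(g has_derivative (\<lambda>v. w x \<bullet> v)) (at x within ball a r)" for x
          using gd by (rule has_derivative_at_withinI)
        show "onorm (\<lambda>v. w x \<bullet> v) \<le> M" if "x \<in> ball a r" for x
          using wM[OF that] by (rule onorm_inner_le)
      qed (use that in auto)
      then show ?thesis by simp
    qed
    text \<open>The curve is chosen so that \<open>g\<close> is affine along it.\<close>
    have "\<exists>c c'. c (0::real) = a \<and> c 1 = b \<and>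
       (\<forall>\<tau>\<in>{0..1}. c \<tau> \<in> closure \<Omega> \<and> (c has_vector_derivative c' \<tau>) (at \<tau> within {0..1}) \<and>
        norm (c' \<tau>) \<le> (1 + 2 * M) * dist a b)" if b: "b \<in> closure \<Omega> \<inter> ball a r'" for b
    proof -
      define p where "p = (\<lambda>\<tau>. a + \<tau> *\<^sub>R (b - a))"
      define k where "k = (\<lambda>\<tau>. g a + \<tau> * (g b - g a) - g (p \<tau>))"
      define c where "c = (\<lambda>\<tau>. p \<tau> + k \<tau> *\<^sub>R e)"
      define c' where "c' = (\<lambda>\<tau>. (b - a) + ((g b - g a) - w (p \<tau>) \<bullet> (b - a)) *\<^sub>R e)"
      have br: "b \<in> ball a r" "a \<in> ball a r" using b r(1) r'(2) by (simp_all add: mem_ball)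
      have "a \<in> {x \<in> ball a r. g x \<le> 0}" "b \<in> {x \<in> ball a r. g x \<le> 0}"
        unfolding cl[symmetric] using a b br by blast+
      then have ga: "g a \<le> 0" "g b \<le> 0" by simp_all
      have pr: "p \<tau> \<in> ball a r" if "\<tau> \<in> {0..1}" for \<tau>
        using convexD_alt[OF convex_ball br(2,1), of \<tau>] that by (simp add: p_def algebra_simps)
      have c'b: "norm (c' \<tau>) \<le> (1 + 2 * M) * dist a b" if "\<tau> \<in> {0..1}" for \<tau>
      proof -
        have "\<bar>w (p \<tau>) \<bullet> (b - a)\<bar> \<le> M * norm (b - a)"
          using wM[OF pr[OF that]] Cauchy_Schwarz_ineq2[of "w (p \<tau>)" "b - a"]
            mult_right_mono[of "norm (w (p \<tau>))" M "norm (b - a)"] by simp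
        then have "\<bar>(g b - g a) - w (p \<tau>) \<bullet> (b - a)\<bar> \<le> 2 * M * norm (b - a)"
          using gLip[of b a] br by linarith
        then have "norm (((g b - g a) - w (p \<tau>) \<bullet> (b - a)) *\<^sub>R e) \<le> 2 * M * norm (b - a)"
          using r(3) by simp
        then show ?thesis unfolding c'_def
          using norm_triangle_ineq[of "b - a" "((g b - g a) - w (p \<tau>) \<bullet> (b - a)) *\<^sub>R e"]
          by (simp add: dist_norm norm_minus_commute[of a] distrib_right)
      qed
      have c01: "c 0 = a" "c 1 = b" by (simp_all add: c_def p_def k_def)
      have cd: "(c has_vector_derivative c' \<tau>) (at \<tau> within {0..1})" for \<tau>
      proof -
        have pd: "(p has_derivative (\<lambda>s. s *\<^sub>R (b - a))) (at \<tau>)"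
          unfolding p_def by (auto intro!: derivative_eq_intros)
        have gp: "((\<lambda>\<tau>. g (p \<tau>)) has_derivative (\<lambda>s. w (p \<tau>) \<bullet> (s *\<^sub>R (b - a)))) (at \<tau>)"
          by (rule has_derivative_compose[OF pd gd])
        have kd: "(k has_derivative (\<lambda>s. s * (g b - g a) - w (p \<tau>) \<bullet> (s *\<^sub>R (b - a)))) (at \<tau>)"
          unfolding k_def by (rule derivative_eq_intros gp refl)+ simp
        have "(c has_derivative (\<lambda>s. s *\<^sub>R (b - a) +
            (s * (g b - g a) - w (p \<tau>) \<bullet> (s *\<^sub>R (b - a))) *\<^sub>R e)) (at \<tau>)"
          unfolding c_def by (intro has_derivative_add pd has_derivative_scaleR_left kd)
        moreover have "s *\<^sub>R (b - a) + (s * (g b - g a) - w (p \<tau>) \<bullet> (s *\<^sub>R (b - a))) *\<^sub>R e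
            = s *\<^sub>R c' \<tau>" for s
          by (simp add: c'_def scaleR_add_right inner_scaleR_right right_diff_distrib)
        ultimately have "(c has_derivative (\<lambda>s. s *\<^sub>R c' \<tau>)) (at \<tau>)" by simp
        then show ?thesis
          by (simp add: has_vector_derivative_def has_derivative_at_withinI)
      qed
      have "c \<tau> \<in> closure \<Omega>" if \<tau>: "\<tau> \<in> {0..1}" for \<tau>
      proof -
        have "norm (c \<tau> - c 0) \<le> ((1 + 2 * M) * dist a b) * norm (\<tau> - 0)"
        proof (rule differentiable_bound)
          show "convex {0..1::real}" by simp
          show "(c has_derivative (\<lambda>h. h *\<^sub>R c' x)) (at x within {0..1})" if "x \<in> {0..1}" for x
            using cd by (simp add: has_vector_derivative_def)
          show "onorm (\<lambda>h. h *\<^sub>R c' x) \<le> (1 + 2 * M) * dist a b" if "x \<in> {0..1}" for x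
            using c'b[OF that] by (simp add: onorm_scaleR_left onorm_id bounded_linear_ident)
        qed (use \<tau> in auto)
        also have "\<dots> \<le> ((1 + 2 * M) * dist a b) * 1" using \<tau> M by (intro mult_left_mono) auto
        also have "\<dots> < r" using b M by (simp add: r'_def less_divide_eq mult.commute mem_ball)
        finally have "c \<tau> \<in> ball a r" by (simp add: c01 dist_norm norm_minus_commute)
        moreover have "g (c \<tau>) = (1 - \<tau>) * g a + \<tau> * g b"
          unfolding c_def ge by (simp add: k_def algebra_simps)
        then have "g (c \<tau>) \<le> 0" using ga \<tau>
          by (simp add: add_nonpos_nonpos mult_nonneg_nonpos)
        ultimately have "c \<tau> \<in> {x \<in> ball a r. g x \<le> 0}" by simp
        then show ?thesis unfolding cl[symmetric] by blast
      qed
      then show ?thesis using c01 cd c'b by (intro exI[of _ c] exI[of _ c']) simp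
    qed
    then show ?thesis by (intro exI[of _ "1 + 2 * M"] exI[of _ r'] conjI r'(1) ballI)
  qed
qed

text \<open>A segment in the convex factor is paired with a short curve in the other one, and the
  speeds add up.\<close>

lemma quasiconvex_Times:
  fixes A :: "'a::euclidean_space set" and B :: "'b::euclidean_space set"
  assumes "convex A" "quasiconvex_set B"
  shows "quasiconvex_set (A \<times> B)"
  unfolding quasiconvex_set_def
proof safe
  fix t b assume tb: "t \<in> A" "b \<in> B"
  obtain C r where r: "r > 0" and Cr: "\<And>b'. b' \<in> B \<inter> ball b r \<Longrightarrow> \<exists>c c'. c (0::real) = b \<and> c 1 = b' \<and>
     (\<forall>\<tau>\<in>{0..1}. c \<tau> \<in> B \<and> (c has_vector_derivative c' \<tau>) (at \<tau> within {0..1}) \<and>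
        norm (c' \<tau>) \<le> C * dist b b')"
    using assms(2)[unfolded quasiconvex_set_def, rule_format, OF tb(2)] by blast
  have "\<exists>c c'. c (0::real) = (t, b) \<and> c 1 = x \<and>
     (\<forall>\<tau>\<in>{0..1}. c \<tau> \<in> A \<times> B \<and> (c has_vector_derivative c' \<tau>) (at \<tau> within {0..1}) \<and>
        norm (c' \<tau>) \<le> (1 + \<bar>C\<bar>) * dist (t, b) x)" if x: "x \<in> A \<times> B \<inter> ball (t, b) r" for x
  proof -
    obtain t' b' where x': "x = (t', b')" by fastforce
    have d: "dist t t' \<le> dist (t, b) x" "dist b b' \<le> dist (t, b) x"
      using dist_fst_le[of "(t, b)" x] dist_snd_le[of "(t, b)" x] by (auto simp: x')
    have "b' \<in> B \<inter> ball b r" using x d(2) by (auto simp: x')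
    then obtain c c' where c: "c (0::real) = b" "c 1 = b'"
      "\<And>\<tau>. \<tau>\<in>{0..1} \<Longrightarrow> c \<tau> \<in> B" "\<And>\<tau>. \<tau>\<in>{0..1} \<Longrightarrow> (c has_vector_derivative c' \<tau>) (at \<tau> within {0..1})"
      "\<And>\<tau>. \<tau>\<in>{0..1} \<Longrightarrow> norm (c' \<tau>) \<le> C * dist b b'"
      using Cr by blast
    have "t + \<tau> *\<^sub>R (t' - t) \<in> A" if "\<tau> \<in> {0..1}" for \<tau>
      using convexD_alt[OF assms(1) tb(1), of t' \<tau>] that x by (simp add: x' algebra_simps)
    moreover have "norm (t' - t, c' \<tau>) \<le> (1 + \<bar>C\<bar>) * dist (t, b) x" if "\<tau> \<in> {0..1}" for \<tau>
    proof -
      have "norm (t' - t, c' \<tau>) \<le> norm (t' - t) + norm (c' \<tau>)"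
        using sqrt_sum_squares_le_sum_abs[of "norm (t' - t)" "norm (c' \<tau>)"] by (simp add: norm_Pair)
      also have "\<dots> \<le> dist t t' + \<bar>C\<bar> * dist b b'"
        using order_trans[OF c(5)[OF that] mult_right_mono[OF abs_ge_self[of C] zero_le_dist]]
        by (simp add: dist_norm norm_minus_commute)
      also have "\<dots> \<le> dist (t, b) x + \<bar>C\<bar> * dist (t, b) x"
        using d by (intro add_mono mult_left_mono) auto
      finally show ?thesis by (simp add: algebra_simps)
    qed
    ultimately show ?thesis
      by (intro exI[of _ "\<lambda>\<tau>. (t + \<tau> *\<^sub>R (t' - t), c \<tau>)"] exI[of _ "\<lambda>\<tau>. (t' - t, c' \<tau>)"])
        (auto simp: c x' intro!: has_vector_derivative_Pair[OF _ c(4)] derivative_eq_intros c(3))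
  qed
  then show "\<exists>C. \<exists>r>0. \<forall>x\<in>A \<times> B \<inter> ball (t, b) r. \<exists>c c'. c (0::real) = (t, b) \<and> c 1 = x \<and>
     (\<forall>\<tau>\<in>{0..1}. c \<tau> \<in> A \<times> B \<and> (c has_vector_derivative c' \<tau>) (at \<tau> within {0..1}) \<and>
        norm (c' \<tau>) \<le> C * dist (t, b) x)" using r by blast
qed

section \<open>The exterior normal and the tube of inner normals\<close>

text \<open>Tangent vectors at \<open>x\<close> form exactly the hyperplane orthogonal to
  \<open>w x\<close>: \<open>g\<close> vanishes along curves in the frontier, and every direction
  orthogonal to \<open>w x\<close> is the velocity of such a curve. A unit vector orthogonal to all
  of them is one of the two unit multiples of \<open>w x\<close>, and the side condition selects the
  outward one.\<close>

lemma exterior_normal_chart: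
  fixes \<Omega> :: "'a::euclidean_space set"
  assumes ch: "boundary_chart \<Omega> \<xi> r L e g w" and x: "x \<in> frontier \<Omega>" "x \<in> ball \<xi> r"
  shows "exterior_normal \<Omega> x = w x /\<^sub>R norm (w x)"
proof -
  have ge: "\<And>x s. g (x + s *\<^sub>R e) = g x + s"
    and gd: "\<And>x. (g has_derivative (\<lambda>v. w x \<bullet> v)) (at x)" and w1: "\<And>x. 1 \<le> norm (w x)"
    and in_chart: "\<Omega> \<inter> ball \<xi> r = {x \<in> ball \<xi> r. g x < 0}"
    and cl_chart: "closure \<Omega> \<inter> ball \<xi> r = {x \<in> ball \<xi> r. g x \<le> 0}"
    and fr_chart: "frontier \<Omega> \<inter> ball \<xi> r = {x \<in> ball \<xi> r. g x = 0}"
    using ch unfolding boundary_chart_def by blast+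
  have gx: "g x = 0" using fr_chart x by blast
  define n where "n = w x /\<^sub>R norm (w x)"
  have w0: "norm (w x) > 0" using w1[of x] by linarith
  have nn: "norm n = 1" using w0 by (simp add: n_def)
  have wn: "w x = norm (w x) *\<^sub>R n" using w0 by (simp add: n_def)
  have near: "\<forall>\<^sub>F s in at 0. c s \<in> ball \<xi> r" if "isCont c 0" "c 0 = x" for c :: "real \<Rightarrow> 'a"
    using that x(2) by (intro topological_tendstoD[OF _ open_ball]) (auto simp: isCont_def)
  have perp: "n \<bullet> v = 0" if tv: "tangent_vector (frontier \<Omega>) x v" for v
  proof -
    obtain c where c: "c 0 = x" "\<And>s::real. c s \<in> frontier \<Omega>" "(c has_vector_derivative v) (at 0)"
      using tv unfolding tangent_vector_def by blast
    have cd: "(c has_derivative (\<lambda>s. s *\<^sub>R v)) (at 0)" using c(3) by (simp add: has_vector_derivative_def)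
    have "((\<lambda>s. g (c s)) has_derivative (\<lambda>s. w x \<bullet> (s *\<^sub>R v))) (at 0)"
      using has_derivative_compose[OF cd, of g "\<lambda>v. w x \<bullet> v"] gd[of x] c(1) by simp
    moreover have "((\<lambda>s. g (c s)) has_derivative (\<lambda>s. 0)) (at 0)"
    proof (rule has_derivative_transform_eventually)
      show "((\<lambda>s::real. 0::real) has_derivative (\<lambda>s. 0)) (at 0)" by simp
      have "isCont c 0" using cd by (rule has_derivative_continuous)
      from near[OF this c(1)] show "\<forall>\<^sub>F s in at 0. 0 = g (c s)"
      proof eventually_elim
        case (elim s)
        then have "c s \<in> {x \<in> ball \<xi> r. g x = 0}" unfolding fr_chart[symmetric] using c(2) by blast
        then show ?case by simp
      qed
      show "0 = g (c 0)" using c(1) gx by simp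
    qed simp
    ultimately have "(\<lambda>s. w x \<bullet> (s *\<^sub>R v)) = (\<lambda>s. 0)" by (rule has_derivative_unique)
    from fun_cong[OF this, of 1] have "w x \<bullet> v = 0" by simp
    then show ?thesis by (simp add: n_def)
  qed
  have tang: "tangent_vector (frontier \<Omega>) x v" if v: "w x \<bullet> v = 0" for v
  proof -
    \<comment> \<open>\<open>x + s *\<^sub>R v\<close> is slid along \<open>e\<close> back to the
      level set of \<open>g\<close> at 0; the correction has zero derivative at 0 because
      \<open>w x \<bullet> v = 0\<close>.\<close>
    define c0 where "c0 = (\<lambda>s. (x + s *\<^sub>R v) + (- g (x + s *\<^sub>R v)) *\<^sub>R e)"
    have pd: "((\<lambda>s. x + s *\<^sub>R v) has_derivative (\<lambda>s. s *\<^sub>R v)) (at 0)"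
      by (auto intro!: derivative_eq_intros)
    have "((\<lambda>s. g (x + s *\<^sub>R v)) has_derivative (\<lambda>s. w x \<bullet> (s *\<^sub>R v))) (at 0)"
      using has_derivative_compose[OF pd, of g "\<lambda>v. w x \<bullet> v"] gd[of x] by simp
    then have "(c0 has_derivative (\<lambda>s. s *\<^sub>R v + (- (w x \<bullet> (s *\<^sub>R v))) *\<^sub>R e)) (at 0)"
      unfolding c0_def by (intro has_derivative_add pd has_derivative_scaleR_left has_derivative_minus)
    then have c0d: "(c0 has_derivative (\<lambda>s. s *\<^sub>R v)) (at 0)" using v by simp
    have c00: "c0 0 = x" by (simp add: c0_def gx)
    have ev: "\<forall>\<^sub>F s in at 0. c0 s \<in> ball \<xi> r"
      using near has_derivative_continuous[OF c0d] c00 by blast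
    \<comment> \<open>\<open>tangent_vector\<close> asks for a curve in the frontier at all real
      parameters. Where \<open>c0\<close> leaves the chart the curve is parked at \<open>x\<close>,
      which does not affect the derivative at 0.\<close>
    define c where "c = (\<lambda>s. if c0 s \<in> ball \<xi> r then c0 s else x)"
    have "c s \<in> frontier \<Omega>" for s
    proof (cases "c0 s \<in> ball \<xi> r")
      case True
      have "g (c0 s) = 0" unfolding c0_def ge by simp
      with True have "c0 s \<in> {x \<in> ball \<xi> r. g x = 0}" by blast
      then show ?thesis using True unfolding fr_chart[symmetric] by (simp add: c_def)
    qed (use x in \<open>simp add: c_def\<close>)
    moreover have "(c has_derivative (\<lambda>s. s *\<^sub>R v)) (at 0)"
    proof (rule has_derivative_transform_eventually[OF c0d])
      show "\<forall>\<^sub>F s in at 0. c0 s = c s" using ev by eventually_elim (simp add: c_def)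
    qed (use x(2) c00 in \<open>simp_all add: c_def\<close>)
    moreover have "c 0 = x" using x(2) c00 by (simp add: c_def)
    ultimately show ?thesis unfolding tangent_vector_def has_vector_derivative_def by blast
  qed
  have side: "\<forall>\<^sub>F s in at 0. 0 < s \<longrightarrow> x - s *\<^sub>R n \<in> \<Omega>" "\<forall>\<^sub>F s in at 0. 0 < s \<longrightarrow> x + s *\<^sub>R n \<notin> closure \<Omega>"
  proof -
    have D: "((\<lambda>s. g (x + s *\<^sub>R (k *\<^sub>R n))) has_real_derivative k * norm (w x)) (at 0)" for k
    proof -
      have pd: "((\<lambda>s. x + s *\<^sub>R (k *\<^sub>R n)) has_derivative (\<lambda>s. s *\<^sub>R (k *\<^sub>R n))) (at 0)"
        by (auto intro!: derivative_eq_intros)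
      have "((\<lambda>s. g (x + s *\<^sub>R (k *\<^sub>R n))) has_derivative (\<lambda>s. w x \<bullet> (s *\<^sub>R (k *\<^sub>R n)))) (at 0)"
        using has_derivative_compose[OF pd, of g "\<lambda>v. w x \<bullet> v"] gd[of x] by simp
      moreover have "w x \<bullet> n = norm (w x)" by (subst wn) (simp add: dot_square_norm nn)
      ultimately show ?thesis by (simp add: has_field_derivative_def mult_ac mult_commute_abs)
    qed
    have ev: "\<forall>\<^sub>F s in at 0. x + s *\<^sub>R (k *\<^sub>R n) \<in> ball \<xi> r" for k
      by (rule near) (auto intro!: continuous_intros)
    obtain d1 where d1: "d1 > 0" "\<And>h. 0 < h \<Longrightarrow> h < d1 \<Longrightarrow> g (x + h *\<^sub>R ((-1) *\<^sub>R n)) < 0"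
      using DERIV_neg_dec_right[OF D[of "-1"]] w0 gx by auto
    have "\<forall>\<^sub>F s in at 0. s < d1" by (rule order_tendstoD(2)[OF tendsto_ident_at d1(1)])
    with ev[of "-1"] show "\<forall>\<^sub>F s in at 0. 0 < s \<longrightarrow> x - s *\<^sub>R n \<in> \<Omega>"
    proof eventually_elim
      case (elim s)
      have "x - s *\<^sub>R n \<in> \<Omega>" if "0 < s"
      proof -
        have "x - s *\<^sub>R n \<in> {x \<in> ball \<xi> r. g x < 0}" using elim d1(2)[of s] that by simp
        then show ?thesis unfolding in_chart[symmetric] by blast
      qed
      then show ?case by blast
    qed
    obtain d2 where d2: "d2 > 0" "\<And>h. 0 < h \<Longrightarrow> h < d2 \<Longrightarrow> g (x + h *\<^sub>R (1 *\<^sub>R n)) > 0"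
      using DERIV_pos_inc_right[OF D[of 1]] w0 gx by auto
    have "\<forall>\<^sub>F s in at 0. s < d2" by (rule order_tendstoD(2)[OF tendsto_ident_at d2(1)])
    with ev[of 1] show "\<forall>\<^sub>F s in at 0. 0 < s \<longrightarrow> x + s *\<^sub>R n \<notin> closure \<Omega>"
    proof eventually_elim
      case (elim s)
      have "x + s *\<^sub>R n \<notin> closure \<Omega>" if "0 < s"
      proof
        assume "x + s *\<^sub>R n \<in> closure \<Omega>"
        then have "x + s *\<^sub>R n \<in> {x \<in> ball \<xi> r. g x \<le> 0}" unfolding cl_chart[symmetric] using elim by simp
        then show False using d2(2)[of s] elim that by simp
      qed
      then show ?case by blast
    qed
  qed
  have "\<forall>\<^sub>F s in at 0. 0 < s \<longrightarrow> x - s *\<^sub>R n \<in> \<Omega> \<and> x + s *\<^sub>R n \<notin> closure \<Omega>"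
    using side by eventually_elim blast
  then obtain \<delta> where \<delta>: "\<delta> > 0" "\<And>s. 0 < s \<Longrightarrow> s < \<delta> \<Longrightarrow> x - s *\<^sub>R n \<in> \<Omega> \<and> x + s *\<^sub>R n \<notin> closure \<Omega>"
    unfolding eventually_at by (auto simp: dist_real_def)
  show ?thesis unfolding exterior_normal_def n_def[symmetric]
  proof (rule the_equality)
    show "norm n = 1 \<and> (\<forall>v. tangent_vector (frontier \<Omega>) x v \<longrightarrow> n \<bullet> v = 0) \<and>
      (\<exists>\<delta>>0. \<forall>s. 0 < s \<and> s < \<delta> \<longrightarrow> x - s *\<^sub>R n \<in> \<Omega> \<and> x + s *\<^sub>R n \<notin> closure \<Omega>)"
      using nn perp \<delta> by blast
    fix m assume m: "norm m = 1 \<and> (\<forall>v. tangent_vector (frontier \<Omega>) x v \<longrightarrow> m \<bullet> v = 0) \<and>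
      (\<exists>\<delta>>0. \<forall>s. 0 < s \<and> s < \<delta> \<longrightarrow> x - s *\<^sub>R m \<in> \<Omega> \<and> x + s *\<^sub>R m \<notin> closure \<Omega>)"
    \<comment> \<open>The part of \<open>m\<close> orthogonal to \<open>n\<close> is tangent, hence
      orthogonal to \<open>m\<close> as well, hence zero.\<close>
    define v where "v = m - (m \<bullet> n) *\<^sub>R n"
    have nv: "n \<bullet> v = 0" using nn by (simp add: v_def inner_diff_right inner_commute dot_square_norm)
    then have "w x \<bullet> v = 0" by (subst wn) simp
    then have "m \<bullet> v = 0" using m tang by blast
    then have "v \<bullet> v = 0" using nv by (simp add: v_def inner_diff_left)
    then have mn: "m = (m \<bullet> n) *\<^sub>R n" by (simp add: v_def)
    then have "\<bar>m \<bullet> n\<bar> = 1" using m nn by (metis mult_cancel_left1 norm_scaleR mult.right_neutral)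
    then consider "m \<bullet> n = 1" | "m \<bullet> n = -1" by linarith
    then show "m = n"
    proof cases
      case 1
      then show ?thesis using mn by simp
    next
      case 2
      then have mn': "m = - n" using mn by simp
      obtain \<delta>' where \<delta>': "\<delta>' > 0" "\<And>s. 0 < s \<Longrightarrow> s < \<delta>' \<Longrightarrow> x - s *\<^sub>R m \<in> \<Omega>" using m by blast
      \<comment> \<open>At this depth \<open>m = - n\<close> would place
        \<open>x + s *\<^sub>R n\<close> both in \<Omega> and outside its closure.\<close>
      define s where "s = min \<delta> \<delta>' / 2"
      have s: "0 < s" "s < \<delta>" "s < \<delta>'" using \<delta> \<delta>' by (auto simp: s_def)
      have "x + s *\<^sub>R n \<in> \<Omega>" using \<delta>'(2)[OF s(1,3)] by (simp add: mn')
      then show ?thesis using \<delta>(2)[OF s(1,2)] closure_subset[of \<Omega>] by blast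
    qed
  qed
qed

lemma norm_exterior_normal:
  assumes "open \<Omega>" "smooth_boundary \<Omega>" "\<xi> \<in> frontier \<Omega>"
  shows "norm (exterior_normal \<Omega> \<xi>) = 1"
proof -
  obtain r L e g w where ch: "boundary_chart \<Omega> \<xi> r L e g w"
    using smooth_boundary_chart[OF assms] by blast
  then have "\<xi> \<in> ball \<xi> r" "norm (w \<xi>) \<ge> 1" by (auto simp: boundary_chart_def)
  moreover from this have "norm (w \<xi>) \<noteq> 0" by linarith
  ultimately show ?thesis using exterior_normal_chart[OF ch assms(3)] by simp
qed

text \<open>The difference splits into \<open>(a - b) /\<^sub>R norm a\<close> and a multiple of the
  unit vector along \<open>b\<close>, each of norm at most \<open>norm (a - b)\<close>. It carries
  the Lipschitz property from the gradient of a chart to the unit normal.\<close>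

lemma norm_normalize_diff_le:
  fixes a b :: "'a::real_normed_vector"
  assumes "1 \<le> norm a" "1 \<le> norm b"
  shows "norm (a /\<^sub>R norm a - b /\<^sub>R norm b) \<le> 2 * norm (a - b)"
proof -
  have a0: "norm a > 0" "norm b > 0" using assms by linarith+
  have eq: "a /\<^sub>R norm a - b /\<^sub>R norm b = (a - b) /\<^sub>R norm a + ((norm b - norm a) / norm a) *\<^sub>R (b /\<^sub>R norm b)"
    using a0 by (simp add: algebra_simps divide_inverse)
  have "norm ((a - b) /\<^sub>R norm a) \<le> norm (a - b)"
  proof -
    have "norm ((a - b) /\<^sub>R norm a) = norm (a - b) / norm a" by (simp add: divide_inverse mult.commute)
    then show ?thesis
      using a0 mult_left_mono[OF assms(1), of "norm (a - b)"] by (simp add: pos_divide_le_eq)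
  qed
  moreover have "\<bar>(norm b - norm a) / norm a\<bar> \<le> norm (a - b)"
  proof -
    have "\<bar>norm b - norm a\<bar> \<le> norm (a - b)" by (metis norm_minus_commute norm_triangle_ineq3)
    then have "\<bar>norm b - norm a\<bar> \<le> norm (a - b) * norm a"
      using mult_left_mono[OF assms(1), of "norm (a - b)"] by simp
    then show ?thesis using a0 by (simp add: abs_divide pos_divide_le_eq)
  qed
  then have "norm (((norm b - norm a) / norm a) *\<^sub>R (b /\<^sub>R norm b)) \<le> norm (a - b)"
  proof -
    assume "\<bar>(norm b - norm a) / norm a\<bar> \<le> norm (a - b)"
    moreover have "norm (b /\<^sub>R norm b) = 1" using a0 by simp
    ultimately show ?thesis
      unfolding norm_scaleR[of "(norm b - norm a) / norm a"] by simp
  qed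
  ultimately show ?thesis unfolding eq by (intro order_trans[OF norm_triangle_ineq]) simp
qed

text \<open>Quantitative injectivity of the normal tube over \<open>K\<close>, one coordinate at a
  time. It is meant for a small patch \<open>K\<close>, because the near orthogonality behind it is
  a local fact; patches are combined by subadditivity.\<close>

definition tube_injective :: "real \<Rightarrow> 'a::euclidean_space set \<Rightarrow> ('a \<Rightarrow> 'a) \<Rightarrow> bool" where
  "tube_injective \<rho>\<^sub>0 K \<nu> \<longleftrightarrow> (\<forall>\<xi>\<in>K. \<forall>\<xi>'\<in>K. \<forall>\<rho>\<in>{0<..<\<rho>\<^sub>0}. \<forall>\<rho>'\<in>{0<..<\<rho>\<^sub>0}.
     dist \<xi> \<xi>' \<le> 2 * dist (\<xi> - \<rho> *\<^sub>R \<nu> \<xi>) (\<xi>' - \<rho>' *\<^sub>R \<nu> \<xi>') \<and>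
     dist \<rho> \<rho>' \<le> 2 * dist (\<xi> - \<rho> *\<^sub>R \<nu> \<xi>) (\<xi>' - \<rho>' *\<^sub>R \<nu> \<xi>'))"

text \<open>
  Near a boundary point, \<open>(\<xi>, \<rho>) \<mapsto> \<xi> - \<rho> \<nu>(\<xi>)\<close> maps into \<open>\<Omega>\<close> and its inverse is Lipschitz, because
  \<open>\<xi> - \<xi>'\<close> is nearly orthogonal to \<open>\<nu>(\<xi>)\<close> and \<open>\<nu>\<close> is Lipschitz.
\<close>

lemma normal_tube_local:
  fixes \<Omega> :: "'a::euclidean_space set"
  assumes "open \<Omega>" "smooth_boundary \<Omega>" "\<xi>\<^sub>0 \<in> frontier \<Omega>"
  defines "\<nu> \<equiv> exterior_normal \<Omega>"
  obtains r \<rho>\<^sub>0 where "0 < r" "0 < \<rho>\<^sub>0" "continuous_on (frontier \<Omega> \<inter> ball \<xi>\<^sub>0 r) \<nu>"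
    "\<forall>\<xi>\<in>frontier \<Omega> \<inter> ball \<xi>\<^sub>0 r. \<forall>\<rho>\<in>{0<..<\<rho>\<^sub>0}. \<xi> - \<rho> *\<^sub>R \<nu> \<xi> \<in> \<Omega>"
    "tube_injective \<rho>\<^sub>0 (frontier \<Omega> \<inter> ball \<xi>\<^sub>0 r) \<nu>"
proof -
  obtain R L e g w where ch: "boundary_chart \<Omega> \<xi>\<^sub>0 R L e g w"
    using smooth_boundary_chart[OF assms(1-3)] by blast
  have R: "R > 0" "L > 0"
    and gd: "\<And>x. (g has_derivative (\<lambda>v. w x \<bullet> v)) (at x)" and w1: "\<And>x. 1 \<le> norm (w x)"
    and wL: "\<And>x y. x \<in> ball \<xi>\<^sub>0 R \<Longrightarrow> y \<in> ball \<xi>\<^sub>0 R \<Longrightarrow> norm (w x - w y) \<le> L * norm (x - y)"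
    and in_chart: "\<Omega> \<inter> ball \<xi>\<^sub>0 R = {x \<in> ball \<xi>\<^sub>0 R. g x < 0}"
    and fr_chart: "frontier \<Omega> \<inter> ball \<xi>\<^sub>0 R = {x \<in> ball \<xi>\<^sub>0 R. g x = 0}"
    using ch unfolding boundary_chart_def by blast+
  note quad = gradient_quadratic_bound[OF convex_ball gd wL]
  have \<nu>: "\<nu> \<xi> = w \<xi> /\<^sub>R norm (w \<xi>)" if "\<xi> \<in> frontier \<Omega> \<inter> ball \<xi>\<^sub>0 R" for \<xi>
    using exterior_normal_chart[OF ch] that by (auto simp: \<nu>_def)
  have n1: "norm (\<nu> \<xi>) = 1" if "\<xi> \<in> frontier \<Omega>" for \<xi>
    unfolding \<nu>_def by (rule norm_exterior_normal[OF assms(1,2) that])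
  have \<nu>L: "norm (\<nu> \<xi> - \<nu> \<xi>') \<le> 2 * L * norm (\<xi> - \<xi>')"
    if "\<xi> \<in> frontier \<Omega> \<inter> ball \<xi>\<^sub>0 R" "\<xi>' \<in> frontier \<Omega> \<inter> ball \<xi>\<^sub>0 R" for \<xi> \<xi>'
    using norm_normalize_diff_le[OF w1 w1, of \<xi> \<xi>'] wL[of \<xi> \<xi>'] that by (simp add: \<nu>)
  have \<nu>c: "continuous_on (frontier \<Omega> \<inter> ball \<xi>\<^sub>0 R) \<nu>"
    by (rule lipschitz_on_continuous_on[of "2 * L"], rule lipschitz_onI)
      (use \<nu>L R in \<open>auto simp: dist_norm\<close>)
  \<comment> \<open>\<open>1 / (8 * L)\<close> makes \<open>L * d \<le> 1 / 4\<close> for two points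
    at distance \<open>d < 2 * r\<close>. Below, \<open>1 / (16 * L)\<close> makes the depth times
    the variation \<open>2 * L * d\<close> of the normal at most \<open>d / 8\<close>. The bounds
    \<open>R / 2\<close> keep all points in the chart.\<close>
  define r where "r = min (R / 2) (1 / (8 * L))"
  define \<rho>\<^sub>0 where "\<rho>\<^sub>0 = min (R / 2) (1 / (16 * L))"
  have r: "r > 0" "r \<le> R / 2" "r * (8 * L) \<le> 1" and \<rho>\<^sub>0: "\<rho>\<^sub>0 > 0" "\<rho>\<^sub>0 \<le> R / 2" "\<rho>\<^sub>0 * (16 * L) \<le> 1"
    using R by (auto simp: r_def \<rho>\<^sub>0_def min_mult_distrib_right min_le_iff_disj)
  have sub: "frontier \<Omega> \<inter> ball \<xi>\<^sub>0 r \<subseteq> frontier \<Omega> \<inter> ball \<xi>\<^sub>0 R" using r R by auto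
  show ?thesis
  proof (rule that[OF r(1) \<rho>\<^sub>0(1) continuous_on_subset[OF \<nu>c sub]])
    have "\<xi> - \<rho> *\<^sub>R \<nu> \<xi> \<in> \<Omega>"
      if \<xi>: "\<xi> \<in> frontier \<Omega> \<inter> ball \<xi>\<^sub>0 r" and \<rho>: "0 < \<rho>" "\<rho> < \<rho>\<^sub>0" for \<xi> \<rho>
    proof -
      have \<xi>R: "\<xi> \<in> frontier \<Omega> \<inter> ball \<xi>\<^sub>0 R" using \<xi> sub by blast
      then have g\<xi>: "g \<xi> = 0" using fr_chart by blast
      have n\<xi>: "norm (\<nu> \<xi>) = 1" using \<xi> n1 by blast
      have y: "\<xi> - \<rho> *\<^sub>R \<nu> \<xi> \<in> ball \<xi>\<^sub>0 R"
      proof -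
        have "dist \<xi> (\<xi> - \<rho> *\<^sub>R \<nu> \<xi>) = \<rho>" using n\<xi> \<rho> by (simp add: dist_norm)
        then show ?thesis using dist_triangle[of \<xi>\<^sub>0 "\<xi> - \<rho> *\<^sub>R \<nu> \<xi>" \<xi>] \<xi> r \<rho>\<^sub>0 \<rho> by simp
      qed
      have "\<bar>g (\<xi> - \<rho> *\<^sub>R \<nu> \<xi>) - g \<xi> - w \<xi> \<bullet> (\<xi> - \<rho> *\<^sub>R \<nu> \<xi> - \<xi>)\<bar> \<le> L * (norm (\<xi> - \<rho> *\<^sub>R \<nu> \<xi> - \<xi>))\<^sup>2"
        using \<xi>R y R by (intro quad) auto
      moreover have "w \<xi> \<bullet> \<nu> \<xi> = norm (w \<xi>)"
      proof -
        have "norm (w \<xi>) \<noteq> 0" using w1[of \<xi>] by linarith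
        then show ?thesis by (simp add: \<nu>[OF \<xi>R] dot_square_norm power2_eq_square)
      qed
      ultimately have "g (\<xi> - \<rho> *\<^sub>R \<nu> \<xi>) + \<rho> * norm (w \<xi>) \<le> L * \<rho>\<^sup>2"
        using g\<xi> n\<xi> \<rho> by simp
      moreover have "\<rho> * 1 \<le> \<rho> * norm (w \<xi>)" using \<rho> w1 by (intro mult_left_mono) auto
      moreover have "L * \<rho> < 1"
      proof -
        have "\<rho> * (16 * L) \<le> \<rho>\<^sub>0 * (16 * L)" using \<rho> R by (intro mult_right_mono) auto
        then have "\<rho> * (16 * L) \<le> 1" using \<rho>\<^sub>0(3) by (rule order_trans)
        then have "16 * (L * \<rho>) \<le> 1" by (simp add: mult_ac)
        then show ?thesis using mult_pos_pos[OF R(2) \<rho>(1)] by linarith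
      qed
      then have "L * \<rho>\<^sup>2 < \<rho> * 1" using \<rho> by (simp add: power2_eq_square)
      ultimately have "g (\<xi> - \<rho> *\<^sub>R \<nu> \<xi>) < 0" by linarith
      then have "\<xi> - \<rho> *\<^sub>R \<nu> \<xi> \<in> {x \<in> ball \<xi>\<^sub>0 R. g x < 0}" using y by simp
      then show ?thesis unfolding in_chart[symmetric] by blast
    qed
    then show "\<forall>\<xi>\<in>frontier \<Omega> \<inter> ball \<xi>\<^sub>0 r. \<forall>\<rho>\<in>{0<..<\<rho>\<^sub>0}. \<xi> - \<rho> *\<^sub>R \<nu> \<xi> \<in> \<Omega>" by simp
    show "tube_injective \<rho>\<^sub>0 (frontier \<Omega> \<inter> ball \<xi>\<^sub>0 r) \<nu>"
      unfolding tube_injective_def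
    proof (intro ballI)
      fix \<xi> \<xi>' \<rho> \<rho>' assume \<xi>: "\<xi> \<in> frontier \<Omega> \<inter> ball \<xi>\<^sub>0 r" "\<xi>' \<in> frontier \<Omega> \<inter> ball \<xi>\<^sub>0 r"
        and "\<rho> \<in> {0<..<\<rho>\<^sub>0}" and \<rho>: "\<rho>' \<in> {0<..<\<rho>\<^sub>0}"
      have \<xi>R: "\<xi> \<in> frontier \<Omega> \<inter> ball \<xi>\<^sub>0 R" "\<xi>' \<in> frontier \<Omega> \<inter> ball \<xi>\<^sub>0 R" using \<xi> sub by blast+
      then have g\<xi>: "g \<xi> = 0" "g \<xi>' = 0" using fr_chart by blast+
      define d where "d = norm (\<xi> - \<xi>')"
      define \<tau> where "\<tau> = \<rho> - \<rho>'"
      define X where "X = (\<xi> - \<rho> *\<^sub>R \<nu> \<xi>) - (\<xi>' - \<rho>' *\<^sub>R \<nu> \<xi>')"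
      have n\<xi>: "norm (\<nu> \<xi>) = 1" using \<xi> n1 by blast
      have d: "0 \<le> d" "d < 2 * r"
        using \<xi> dist_triangle[of \<xi> \<xi>' \<xi>\<^sub>0] by (auto simp: d_def dist_norm[symmetric] dist_commute)
      then have dL: "L * d \<le> 1 / 4"
      proof -
        have "L * d \<le> L * (2 * r)" using d R by (intro mult_left_mono) auto
        also have "\<dots> = (r * (8 * L)) / 4" by simp
        also have "\<dots> \<le> 1 / 4" using r(3) by (intro divide_right_mono) auto
        finally show ?thesis .
      qed
      \<comment> \<open>Both points are zeros of \<open>g\<close>, so the quadratic bound says that
        their difference is orthogonal to the normal up to second order in \<open>d\<close>.\<close>
      have "\<bar>g \<xi>' - g \<xi> - w \<xi> \<bullet> (\<xi>' - \<xi>)\<bar> \<le> L * (norm (\<xi>' - \<xi>))\<^sup>2"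
        using \<xi>R R by (intro quad) auto
      then have "\<bar>(\<xi> - \<xi>') \<bullet> w \<xi>\<bar> \<le> L * d\<^sup>2"
        by (simp add: g\<xi> d_def norm_minus_commute[of \<xi>] inner_commute[of _ "w \<xi>"] inner_diff_right)
      also have "\<dots> \<le> (1 / 4) * d"
        using mult_right_mono[OF dL d(1)] by (simp add: power2_eq_square)
      also have "\<dots> \<le> (1 / 4) * d * norm (w \<xi>)" using w1[of \<xi>] d mult_left_mono[of 1 "norm (w \<xi>)" "1 / 4 * d"] by simp
      finally have "\<bar>(\<xi> - \<xi>') \<bullet> \<nu> \<xi>\<bar> \<le> (1 / 4) * d"
      proof -
        assume *: "\<bar>(\<xi> - \<xi>') \<bullet> w \<xi>\<bar> \<le> (1 / 4) * d * norm (w \<xi>)"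
        have "0 < norm (w \<xi>)" using w1[of \<xi>] by linarith
        moreover have "\<bar>(\<xi> - \<xi>') \<bullet> \<nu> \<xi>\<bar> = \<bar>(\<xi> - \<xi>') \<bullet> w \<xi>\<bar> / norm (w \<xi>)"
          by (simp add: \<nu>[OF \<xi>R(1)] abs_mult divide_inverse mult.commute)
        ultimately show ?thesis using * by (simp only: pos_divide_le_eq)
      qed
      then have inn: "\<bar>\<tau> * ((\<xi> - \<xi>') \<bullet> \<nu> \<xi>)\<bar> \<le> \<bar>\<tau>\<bar> * ((1 / 4) * d)"
        unfolding abs_mult by (intro mult_left_mono) auto
      \<comment> \<open>\<open>X\<close> with the normal at \<xi>' replaced by the one at \<xi>, so
        that Pythagoras applies up to a small cross term.\<close>
      define Y where "Y = (\<xi> - \<xi>') - \<tau> *\<^sub>R \<nu> \<xi>"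
      have "(norm Y)\<^sup>2 = d\<^sup>2 + \<tau>\<^sup>2 - 2 * (\<tau> * ((\<xi> - \<xi>') \<bullet> \<nu> \<xi>))"
      proof -
        have "(norm (a - \<tau> *\<^sub>R b))\<^sup>2 = (norm a)\<^sup>2 + \<tau>\<^sup>2 * (norm b)\<^sup>2 - 2 * (\<tau> * (a \<bullet> b))" for a b :: 'a
          unfolding power2_norm_eq_inner
          by (simp add: inner_diff_left inner_diff_right inner_commute power2_eq_square)
        from this[of "\<xi> - \<xi>'" "\<nu> \<xi>"] show ?thesis by (simp add: Y_def d_def n\<xi>)
      qed
      then have Y2: "(norm Y)\<^sup>2 \<ge> d\<^sup>2 + \<tau>\<^sup>2 - \<bar>\<tau>\<bar> * d / 2" using inn by linarith
      have "\<bar>\<tau>\<bar> * d \<le> (d\<^sup>2 + \<tau>\<^sup>2) / 2" using sum_squares_bound[of d "\<bar>\<tau>\<bar>"] by (simp add: mult_ac)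
      then have Y3: "(norm Y)\<^sup>2 \<ge> (3/4) * (d\<^sup>2 + \<tau>\<^sup>2)" using Y2 by (simp add: field_simps)
      have Yd: "norm Y \<ge> (3/4) * m" if "m\<^sup>2 \<le> d\<^sup>2 + \<tau>\<^sup>2" for m
      proof (rule power2_le_imp_le)
        have "((3/4) * m)\<^sup>2 \<le> (3/4) * m\<^sup>2" by (simp add: power2_eq_square)
        also have "\<dots> \<le> (3/4) * (d\<^sup>2 + \<tau>\<^sup>2)" using that by simp
        also have "\<dots> \<le> (norm Y)\<^sup>2" by (rule Y3)
        finally show "((3/4) * m)\<^sup>2 \<le> (norm Y)\<^sup>2" .
      qed simp
      have XY: "X = Y - \<rho>' *\<^sub>R (\<nu> \<xi> - \<nu> \<xi>')" by (simp add: X_def Y_def \<tau>_def algebra_simps)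
      have "norm (\<rho>' *\<^sub>R (\<nu> \<xi> - \<nu> \<xi>')) \<le> \<rho>' * (2 * L * d)"
        using \<nu>L[OF \<xi>R] \<rho> by (simp add: d_def)
      also have "\<dots> \<le> \<rho>\<^sub>0 * (2 * L * d)" using \<rho> d R by (intro mult_right_mono) auto
      also have "\<dots> \<le> d / 8" using mult_right_mono[OF \<rho>\<^sub>0(3) d(1)] by simp
      finally have "norm X \<ge> norm Y - d / 8"
        unfolding XY using norm_triangle_ineq2[of Y "\<rho>' *\<^sub>R (\<nu> \<xi> - \<nu> \<xi>')"] by linarith
      moreover have "norm Y \<ge> (3/4) * d" "norm Y \<ge> (3/4) * \<bar>\<tau>\<bar>" by (intro Yd; simp)+
      \<comment> \<open>Since \<open>d / 8 \<le> norm Y / 6\<close>, \<open>norm X\<close> is at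
        least 5/6 of \<open>norm Y\<close> and so at least 5/8 of both \<open>d\<close> and
        \<open>\<bar>\<tau>\<bar>\<close>.\<close>
      ultimately have "d \<le> 2 * norm X" "\<bar>\<tau>\<bar> \<le> 2 * norm X" using d by linarith+
      then show "dist \<xi> \<xi>' \<le> 2 * dist (\<xi> - \<rho> *\<^sub>R \<nu> \<xi>) (\<xi>' - \<rho>' *\<^sub>R \<nu> \<xi>') \<and> dist \<rho> \<rho>' \<le> 2 * dist (\<xi> - \<rho> *\<^sub>R \<nu> \<xi>) (\<xi>' - \<rho>' *\<^sub>R \<nu> \<xi>')"
        by (simp add: d_def \<tau>_def X_def dist_norm)
    qed
  qed
qed

lemma continuous_on_exterior_normal:
  fixes \<Omega> :: "'a::euclidean_space set"
  assumes "open \<Omega>" "smooth_boundary \<Omega>"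
  shows "continuous_on (frontier \<Omega>) (exterior_normal \<Omega>)"
  unfolding continuous_on_eq_continuous_within
proof
  fix \<xi> assume \<xi>: "\<xi> \<in> frontier \<Omega>"
  show "continuous (at \<xi> within frontier \<Omega>) (exterior_normal \<Omega>)"
  proof (rule normal_tube_local[OF assms \<xi>])
    fix r :: real
    assume r: "0 < r" "continuous_on (frontier \<Omega> \<inter> ball \<xi> r) (exterior_normal \<Omega>)"
    then have "continuous (at \<xi> within (frontier \<Omega> \<inter> ball \<xi> r)) (exterior_normal \<Omega>)"
      using \<xi> by (simp add: continuous_on_eq_continuous_within)
    then show ?thesis
      using at_within_nhd[of \<xi> "ball \<xi> r" "frontier \<Omega>" "frontier \<Omega> \<inter> ball \<xi> r"] r(1)
      by (simp add: Int_assoc)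
  qed
qed

section \<open>Hausdorff measure of slices\<close>

text \<open>The pieces are cubes, so the \<open>DIM('a)\<close>-th power of a diameter is at most
  \<open>DIM('a) ^ DIM('a)\<close> times the volume. Their interiors are disjoint and lie in
  \<open>U\<close>, so the volumes add up to at most that of \<open>U\<close>.\<close>

lemma cube_cover:
  fixes W U :: "'a::euclidean_space set"
  assumes W: "bounded W" "W \<subseteq> U" and U: "open U" and \<delta>: "0 < \<delta>"
  obtains C :: "nat \<Rightarrow> 'a set" where "W \<subseteq> (\<Union>i. C i)" "\<And>i. bounded (C i)" "\<And>i. diameter (C i) \<le> \<delta>"
    "(\<Sum>i. ennreal (diameter (C i) ^ DIM('a))) \<le> ennreal (real DIM('a) ^ DIM('a)) * emeasure lborel U"
proof -
  obtain B where B: "B > 0" "\<And>x. x \<in> W \<Longrightarrow> norm x \<le> B" using W(1) by (auto simp: bounded_pos)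
  \<comment> \<open>All sides are equal, so the dyadic subdivision supplied by
    \<open>covering_lemma\<close> consists of cubes.\<close>
  define a b where "a = (- B) *\<^sub>R (One :: 'a)" and "b = B *\<^sub>R (One :: 'a)"
  have ab: "a \<bullet> i = - B" "b \<bullet> i = B" if "i \<in> Basis" for i using that by (auto simp: a_def b_def)
  have sub: "W \<subseteq> cbox a b"
  proof
    fix x assume "x \<in> W"
    then have "\<bar>x \<bullet> i\<bar> \<le> B" if "i \<in> Basis" for i using B(2) Basis_le_norm[OF that, of x] by force
    then show "x \<in> cbox a b" by (simp add: mem_box ab abs_le_iff) (metis minus_le_iff)
  qed
  have ne: "box a b \<noteq> {}" using B(1) by (simp add: box_ne_empty ab)
  \<comment> \<open>Every piece lies in the gauge set of a point of \<open>W\<close>, hence in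
    \<open>U\<close> and in a ball of diameter \<delta>.\<close>
  define g where "g = (\<lambda>x. ball x (\<delta> / 2) \<inter> (if x \<in> U then U else UNIV))"
  have "gauge g" using \<delta> U by (auto simp: gauge_def g_def)
  from covering_lemma[OF sub ne this] obtain \<D> where
    \<D>: "countable \<D>" "\<And>K. K \<in> \<D> \<Longrightarrow> interior K \<noteq> {} \<and> (\<exists>c d. K = cbox c d)"
    "pairwise (\<lambda>A B. interior A \<inter> interior B = {}) \<D>"
    "\<And>K. K \<in> \<D> \<Longrightarrow> \<exists>x \<in> W \<inter> K. K \<subseteq> g x"
    "\<And>u v. cbox u v \<in> \<D> \<Longrightarrow> \<exists>n. \<forall>i \<in> Basis. v \<bullet> i - u \<bullet> i = (b \<bullet> i - a \<bullet> i) / 2^n"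
    "W \<subseteq> \<Union>\<D>" by metis
  have K: "bounded K \<and> diameter K \<le> \<delta> \<and> interior K \<subseteq> U \<and>
     ennreal (diameter K ^ DIM('a)) \<le> ennreal (real DIM('a) ^ DIM('a)) * emeasure lborel (interior K)"
    if KD: "K \<in> \<D>" for K
  proof -
    obtain u v where uv: "K = cbox u v" "interior K \<noteq> {}" using \<D>(2)[OF KD] by blast
    obtain n where n: "\<And>i. i \<in> Basis \<Longrightarrow> v \<bullet> i - u \<bullet> i = (b \<bullet> i - a \<bullet> i) / 2^n"
      using \<D>(5) KD uv by blast
    define s where "s = 2 * B / 2^n"
    have s: "v \<bullet> i - u \<bullet> i = s" if "i \<in> Basis" for i using n[OF that] ab[OF that] by (simp add: s_def)
    have s0: "s > 0" using B(1) by (simp add: s_def)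
    have le: "u \<bullet> i \<le> v \<bullet> i" if "i \<in> Basis" for i using s[OF that] s0 by linarith
    obtain x where x: "x \<in> W" "K \<subseteq> g x" using \<D>(4)[OF KD] by blast
    then have sub: "K \<subseteq> ball x (\<delta> / 2)" "K \<subseteq> U" using W(2) by (auto simp: g_def split: if_splits)
    have "diameter K \<le> diameter (ball x (\<delta> / 2))" by (rule diameter_subset[OF sub(1)]) simp
    also have "\<dots> \<le> \<delta>" using \<delta> by simp
    finally have d: "diameter K \<le> \<delta>" .
    have "diameter K = norm (v - u)" using le by (simp add: uv diameter_cbox dist_norm norm_minus_commute)
    also have "\<dots> \<le> (\<Sum>i\<in>Basis. \<bar>(v - u) \<bullet> i\<bar>)" by (rule norm_le_l1)
    also have "\<dots> = real DIM('a) * s" using s s0 by (simp add: inner_diff_left)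
    finally have "diameter K \<le> real DIM('a) * s" .
    then have "diameter K ^ DIM('a) \<le> (real DIM('a) * s) ^ DIM('a)"
      by (intro power_mono) (simp_all add: uv diameter_ge_0)
    moreover have "emeasure lborel (interior K) = ennreal (s ^ DIM('a))"
    proof -
      have "emeasure lborel (box u v) = (\<Prod>b\<in>Basis. (v - u) \<bullet> b)" using le by (intro emeasure_lborel_box) auto
      also have "(\<Prod>b\<in>Basis. (v - u) \<bullet> b) = s ^ DIM('a)" using s by (simp add: inner_diff_left)
      finally show ?thesis by (simp add: uv)
    qed
    ultimately have "ennreal (diameter K ^ DIM('a)) \<le> ennreal (real DIM('a) ^ DIM('a)) * emeasure lborel (interior K)"
      using s0 by (simp add: ennreal_mult[symmetric] power_mult_distrib ennreal_leI)
    then show ?thesis using d sub(2) interior_subset[of K] uv by auto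
  qed
  \<comment> \<open>Enumerates the countable family; an index that is no code gives the empty set,
    whose diameter 0 contributes nothing to the sum.\<close>
  define C where "C = (\<lambda>i. \<Union>{K \<in> \<D>. to_nat_on \<D> K = i})"
  have inj: "inj_on (to_nat_on \<D>) \<D>" using \<D>(1) by (rule inj_on_to_nat_on)
  have CK: "C (to_nat_on \<D> K) = K" if "K \<in> \<D>" for K
  proof -
    have "{K' \<in> \<D>. to_nat_on \<D> K' = to_nat_on \<D> K} = {K}" using inj that by (auto dest: inj_onD)
    then show ?thesis by (simp add: C_def)
  qed
  have Ccases: "C i = {} \<or> (C i \<in> \<D> \<and> to_nat_on \<D> (C i) = i)" for i
  proof (cases "\<exists>K\<in>\<D>. to_nat_on \<D> K = i")
    case True
    then show ?thesis using CK by metis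
  next
    case False
    then have "{K \<in> \<D>. to_nat_on \<D> K = i} = {}" by blast
    then have "C i = {}" unfolding C_def by (simp only: Union_empty)
    then show ?thesis by simp
  qed
  show ?thesis
  proof (rule that[of C])
    show "W \<subseteq> (\<Union>i. C i)" using \<D>(6) CK by blast
    show "bounded (C i)" "diameter (C i) \<le> \<delta>" for i using Ccases[of i] K \<delta> by fastforce+
    have dis: "disjoint_family (\<lambda>i. interior (C i))"
      unfolding disjoint_family_on_def
    proof safe
      fix i j x assume "i \<noteq> j" "x \<in> interior (C i)" "x \<in> interior (C j)"
      moreover from this have "C i \<in> \<D>" "C j \<in> \<D>" "C i \<noteq> C j"
        using Ccases[of i] Ccases[of j] by auto
      ultimately show "x \<in> {}" using \<D>(3) unfolding pairwise_def by blast
    qed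
    have "(\<Sum>i. ennreal (diameter (C i) ^ DIM('a))) \<le>
        (\<Sum>i. ennreal (real DIM('a) ^ DIM('a)) * emeasure lborel (interior (C i)))"
    proof (intro suminf_le summableI)
      show "ennreal (diameter (C i) ^ DIM('a)) \<le> ennreal (real DIM('a) ^ DIM('a)) * emeasure lborel (interior (C i))" for i
        using Ccases[of i] K[of "C i"] by (auto simp: power_0_left)
    qed
    also have "\<dots> = ennreal (real DIM('a) ^ DIM('a)) * (\<Sum>i. emeasure lborel (interior (C i)))" by simp
    also have "(\<Sum>i. emeasure lborel (interior (C i))) = emeasure lborel (\<Union>i. interior (C i))"
      by (intro suminf_emeasure dis) auto
    also have "\<dots> \<le> emeasure lborel U"
    proof (rule emeasure_mono)
      have "interior (C i) \<subseteq> U" for i using Ccases[of i] K[of "C i"] by auto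
      then show "(\<Union>i. interior (C i)) \<subseteq> U" by blast
    qed (use U in simp)
    finally show "(\<Sum>i. ennreal (diameter (C i) ^ DIM('a))) \<le> ennreal (real DIM('a) ^ DIM('a)) * emeasure lborel U"
      by (simp add: mult_left_mono)
  qed
qed

lemma hausdorff_pre_antimono: "\<delta> \<le> \<delta>' \<Longrightarrow> hausdorff_pre d \<delta>' A \<le> hausdorff_pre d \<delta> A"
  unfolding hausdorff_pre_def by (intro INF_superset_mono) (auto intro: order_trans)

text \<open>
  An Eilenberg-type inequality: \<open>C i\<close> contributes to the slice at \<open>\<rho>\<close> a set of diameter at most
  \<open>2 * diameter (C i)\<close>, and only for \<open>\<rho>\<close> in an interval of length \<open>4 * diameter (C i)\<close>.
\<close>

lemma hausdorff_slices:
  fixes K :: "'a::euclidean_space set" and \<nu> :: "'a \<Rightarrow> 'a" and \<rho>\<^sub>0 :: real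
  assumes inv: "tube_injective \<rho>\<^sub>0 K \<nu>"
    and C: "\<And>i::nat. bounded (C i)" "\<And>i. diameter (C i) \<le> \<delta>"
  shows "\<exists>h. h \<in> borel_measurable lborel \<and>
    (\<integral>\<^sup>+\<rho>. h \<rho> \<partial>lborel) \<le> ennreal (4 * unit_ball_vol (real (DIM('a) - 1))) * (\<Sum>i. ennreal (diameter (C i) ^ DIM('a))) \<and>
    (\<forall>\<rho>\<in>{0<..<\<rho>\<^sub>0}. \<forall>E\<subseteq>K. (\<forall>\<xi>\<in>E. \<xi> - \<rho> *\<^sub>R \<nu> \<xi> \<in> (\<Union>i. C i)) \<longrightarrow>
       hausdorff_pre (DIM('a) - 1) (2 * \<delta>) E \<le> h \<rho>)"
proof -
  define d where "d = DIM('a) - 1"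
  define V where "V = unit_ball_vol (real d)"
  have V: "V \<ge> 0" by (simp add: V_def)
  have Suc_d: "DIM('a) = Suc d" by (simp add: d_def)
  define D where "D = (\<lambda>i. diameter (C i))"
  have D0: "D i \<ge> 0" for i using C(1) by (simp add: D_def diameter_ge_0)
  have DC: "dist x y \<le> D i" if "x \<in> C i" "y \<in> C i" for x y i
    using diameter_bounded_bound[OF C(1) that] by (simp add: D_def)
  define R where "R = (\<lambda>i. {\<rho> \<in> {0<..<\<rho>\<^sub>0}. \<exists>\<xi>\<in>K. \<xi> - \<rho> *\<^sub>R \<nu> \<xi> \<in> C i})"
  define p where "p = (\<lambda>i. SOME \<rho>. \<rho> \<in> R i)"
  \<comment> \<open>\<open>R i\<close>, the set of depths whose slice meets \<open>C i\<close>, may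
    fail to be measurable; injectivity of the tube puts it in this interval around one of its
    points.\<close>
  define J where "J = (\<lambda>i. if R i = {} then {} else {p i - 2 * D i .. p i + 2 * D i})"
  have RJ: "R i \<subseteq> J i" for i
  proof
    fix \<rho> assume \<rho>: "\<rho> \<in> R i"
    then have "p i \<in> R i" unfolding p_def by (rule someI)
    then obtain \<xi> \<xi>' where "\<xi> \<in> K" "\<xi>' \<in> K" "p i \<in> {0<..<\<rho>\<^sub>0}" "\<rho> \<in> {0<..<\<rho>\<^sub>0}"
      "\<xi> - p i *\<^sub>R \<nu> \<xi> \<in> C i" "\<xi>' - \<rho> *\<^sub>R \<nu> \<xi>' \<in> C i" using \<rho> unfolding R_def by blast
    then have "dist (p i) \<rho> \<le> 2 * D i" using inv[unfolded tube_injective_def, rule_format, of \<xi> \<xi>' "p i" \<rho>] DC[of "\<xi> - p i *\<^sub>R \<nu> \<xi>" i "\<xi>' - \<rho> *\<^sub>R \<nu> \<xi>'"] by linarith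
    then show "\<rho> \<in> J i" using \<rho> by (auto simp: J_def dist_real_def abs_le_iff)
  qed
  \<comment> \<open>A set of diameter at most \<open>2 * D i\<close> has gauge at most
    \<open>V * D i ^ d\<close>: the halved diameter in the gauge absorbs the Lipschitz constant 2.
    Integrating over \<open>J i\<close> produces the factor 4 and raises the exponent to
    \<open>DIM('a)\<close>.\<close>
  define h where "h = (\<lambda>\<rho>. \<Sum>i. ennreal (V * D i ^ d) * indicator (J i) \<rho>)"
  have Jm [measurable]: "J i \<in> sets lborel" for i by (simp add: J_def)
  show ?thesis
  proof (intro exI[of _ h] conjI ballI allI impI)
    show "h \<in> borel_measurable lborel" unfolding h_def by measurable
    have "(\<integral>\<^sup>+\<rho>. h \<rho> \<partial>lborel) = (\<Sum>i. ennreal (V * D i ^ d) * emeasure lborel (J i))"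
    proof -
      have "(\<integral>\<^sup>+\<rho>. h \<rho> \<partial>lborel) = (\<Sum>i. \<integral>\<^sup>+\<rho>. ennreal (V * D i ^ d) * indicator (J i) \<rho> \<partial>lborel)"
        unfolding h_def by (rule nn_integral_suminf) measurable
      also have "\<dots> = (\<Sum>i. ennreal (V * D i ^ d) * emeasure lborel (J i))"
        by (simp only: nn_integral_cmult_indicator[OF Jm])
      finally show ?thesis .
    qed
    also have "\<dots> \<le> (\<Sum>i. ennreal (4 * V) * ennreal (D i ^ Suc d))"
    proof (intro suminf_le summableI)
      fix i
      have "emeasure lborel (J i) \<le> ennreal (4 * D i)" using D0[of i] by (simp add: J_def)
      then have "ennreal (V * D i ^ d) * emeasure lborel (J i) \<le> ennreal (V * D i ^ d) * ennreal (4 * D i)"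
        by (intro mult_left_mono) auto
      also have "\<dots> = ennreal (4 * V) * ennreal (D i ^ Suc d)"
        using V D0 by (simp add: ennreal_mult[symmetric] mult_ac)
      finally show "ennreal (V * D i ^ d) * emeasure lborel (J i) \<le> ennreal (4 * V) * ennreal (D i ^ Suc d)" .
    qed
    finally show "(\<integral>\<^sup>+\<rho>. h \<rho> \<partial>lborel) \<le> ennreal (4 * unit_ball_vol (real (DIM('a) - 1))) * (\<Sum>i. ennreal (diameter (C i) ^ DIM('a)))"
      by (simp add: Suc_d V_def D_def)
    fix \<rho> E assume \<rho>: "\<rho> \<in> {0<..<\<rho>\<^sub>0}" and E: "E \<subseteq> K" "\<forall>\<xi>\<in>E. \<xi> - \<rho> *\<^sub>R \<nu> \<xi> \<in> (\<Union>i. C i)"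
    define G where "G = (\<lambda>i. {\<xi> \<in> E. \<xi> - \<rho> *\<^sub>R \<nu> \<xi> \<in> C i})"
    have Gd: "dist x y \<le> 2 * D i" if "x \<in> G i" "y \<in> G i" for x y i
      using inv[unfolded tube_injective_def, rule_format, of x y \<rho> \<rho>] DC[of "x - \<rho> *\<^sub>R \<nu> x" i "y - \<rho> *\<^sub>R \<nu> y"] that E(1) \<rho> by (force simp: G_def)
    have Gb: "bounded (G i)" for i unfolding bounded_def using Gd by blast
    have GD: "diameter (G i) \<le> 2 * D i" for i
      using Gd D0[of i] by (intro diameter_le) (auto simp: dist_norm)
    have "hausdorff_pre d (2 * \<delta>) E \<le> (\<Sum>i. hausdorff_gauge d (G i))"
      unfolding hausdorff_pre_def
    proof (rule INF_lower, safe)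
      show "x \<in> (\<Union>i. G i)" if "x \<in> E" for x using that E(2) by (auto simp: G_def)
      show "bounded (G i)" for i by (rule Gb)
      show "diameter (G i) \<le> 2 * \<delta>" for i using GD[of i] C(2)[of i] by (simp add: D_def)
    qed
    also have "\<dots> \<le> h \<rho>" unfolding h_def
    proof (intro suminf_le summableI)
      fix i
      show "hausdorff_gauge d (G i) \<le> ennreal (V * D i ^ d) * indicator (J i) \<rho>"
      proof (cases "G i = {}")
        case False
        then have "\<rho> \<in> R i" using \<rho> E(1) by (auto simp: G_def R_def)
        then have "\<rho> \<in> J i" using RJ by blast
        moreover have "diameter (G i) / 2 \<le> D i" "0 \<le> diameter (G i) / 2"
          using GD[of i] diameter_ge_0[OF Gb] by auto
        then have "V * (diameter (G i) / 2) ^ d \<le> V * D i ^ d"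
          using V by (intro mult_left_mono power_mono)
        ultimately show ?thesis using False by (simp add: hausdorff_gauge_def V_def ennreal_leI)
      qed (simp add: hausdorff_gauge_def)
    qed
    finally show "hausdorff_pre (DIM('a) - 1) (2 * \<delta>) E \<le> h \<rho>" by (simp add: d_def)
  qed
qed

text \<open>At every depth the slice of the whole tube is \<open>K\<close> itself. Integrating the
  slice estimate over the depths bounds \<open>\<rho>\<^sub>0\<close> times the premeasure of
  \<open>K\<close> by a dimensional multiple of the volume of a ball containing the tube, uniformly
  in \<delta>.\<close>

lemma hausdorff_outer_finite:
  fixes K :: "'a::euclidean_space set" and \<nu> :: "'a \<Rightarrow> 'a" and \<rho>\<^sub>0 :: real
  assumes inv: "tube_injective \<rho>\<^sub>0 K \<nu>"
    and \<rho>0: "0 < \<rho>\<^sub>0" and K: "bounded K" and n: "\<And>\<xi>. \<xi> \<in> K \<Longrightarrow> norm (\<nu> \<xi>) = 1"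
  shows "hausdorff_outer (DIM('a) - 1) K < \<infinity>"
proof -
  obtain B where B: "\<And>x. x \<in> K \<Longrightarrow> norm x \<le> B" using K by (auto simp: bounded_iff)
  define U where "U = ball (0::'a) (B + \<rho>\<^sub>0 + 1)"
  define W where "W = {\<xi> - \<rho> *\<^sub>R \<nu> \<xi> | \<xi> \<rho>. \<xi> \<in> K \<and> \<rho> \<in> {0<..<\<rho>\<^sub>0}}"
  have WU: "W \<subseteq> U"
  proof
    fix y assume "y \<in> W"
    then obtain \<xi> \<rho> where y: "y = \<xi> - \<rho> *\<^sub>R \<nu> \<xi>" "\<xi> \<in> K" "\<rho> \<in> {0<..<\<rho>\<^sub>0}" unfolding W_def by blast
    then show "y \<in> U" using norm_triangle_ineq4[of \<xi> "\<rho> *\<^sub>R \<nu> \<xi>"] B[of \<xi>] n[of \<xi>] by (simp add: U_def)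
  qed
  have Wb: "bounded W" using WU bounded_ball bounded_subset unfolding U_def by blast
  define c where "c = ennreal (4 * unit_ball_vol (real (DIM('a) - 1))) * (ennreal (real DIM('a) ^ DIM('a)) * emeasure lborel U)"
  have "emeasure lborel U < \<infinity>" unfolding U_def by (intro emeasure_bounded_finite) simp
  then have cfin: "c < \<infinity>" by (simp add: c_def ennreal_mult_less_top)
  have bnd: "ennreal \<rho>\<^sub>0 * hausdorff_pre (DIM('a) - 1) \<delta> K \<le> c" if "\<delta> \<in> {0<..}" for \<delta>
  proof -
    \<comment> \<open>Slicing doubles the diameters, hence a cover by sets of size
      \<open>\<delta> / 2\<close>.\<close>
    have "0 < \<delta> / 2" using that by simp
    from cube_cover[OF Wb WU _ this] obtain C :: "nat \<Rightarrow> 'a set" where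
      C: "W \<subseteq> (\<Union>i. C i)" "\<And>i. bounded (C i)" "\<And>i. diameter (C i) \<le> \<delta> / 2"
      "(\<Sum>i. ennreal (diameter (C i) ^ DIM('a))) \<le> ennreal (real DIM('a) ^ DIM('a)) * emeasure lborel U"
      unfolding U_def by blast
    from hausdorff_slices[OF inv, of C, OF C(2,3)] obtain h where
      h: "h \<in> borel_measurable lborel"
      "(\<integral>\<^sup>+\<rho>. h \<rho> \<partial>lborel) \<le> ennreal (4 * unit_ball_vol (real (DIM('a) - 1))) * (\<Sum>i. ennreal (diameter (C i) ^ DIM('a)))"
      "\<forall>\<rho>\<in>{0<..<\<rho>\<^sub>0}. \<forall>E\<subseteq>K. (\<forall>\<xi>\<in>E. \<xi> - \<rho> *\<^sub>R \<nu> \<xi> \<in> (\<Union>i. C i)) \<longrightarrow>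
       hausdorff_pre (DIM('a) - 1) (2 * (\<delta> / 2)) E \<le> h \<rho>" by blast
    have "hausdorff_pre (DIM('a) - 1) \<delta> K \<le> h \<rho>" if "\<rho> \<in> {0<..<\<rho>\<^sub>0}" for \<rho>
    proof -
      have "\<forall>\<xi>\<in>K. \<xi> - \<rho> *\<^sub>R \<nu> \<xi> \<in> (\<Union>i. C i)"
        using that C(1) unfolding W_def by blast
      with h(3) that have "hausdorff_pre (DIM('a) - 1) (2 * (\<delta> / 2)) K \<le> h \<rho>" by blast
      then show ?thesis by simp
    qed
    then have "(\<integral>\<^sup>+\<rho>. hausdorff_pre (DIM('a) - 1) \<delta> K * indicator {0<..<\<rho>\<^sub>0} \<rho> \<partial>lborel) \<le> (\<integral>\<^sup>+\<rho>. h \<rho> \<partial>lborel)"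
      by (intro nn_integral_mono) (auto split: split_indicator)
    also have "\<dots> \<le> c"
      unfolding c_def by (rule order_trans[OF h(2) mult_left_mono[OF C(4)]]) simp
    finally have "hausdorff_pre (DIM('a) - 1) \<delta> K * emeasure lborel {0<..<\<rho>\<^sub>0} \<le> c"
      by (subst (asm) nn_integral_cmult_indicator) auto
    then show ?thesis using \<rho>0 by (simp add: mult.commute)
  qed
  have "ennreal \<rho>\<^sub>0 * hausdorff_outer (DIM('a) - 1) K \<le> c"
    unfolding hausdorff_outer_def SUP_mult_left_ennreal by (intro SUP_least bnd)
  then have "ennreal \<rho>\<^sub>0 * hausdorff_outer (DIM('a) - 1) K < \<infinity>" using cfin by (rule le_less_trans)
  then show ?thesis using \<rho>0 by (auto simp: ennreal_mult_less_top)
qed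

text \<open>A null set has open neighbourhoods of volume at most \<open>(1/2)^m\<close>, so the
  majorants \<open>h m\<close> of the slices have integrals tending to 0. By Fatou their lower limit
  vanishes almost everywhere, and it dominates the premeasure at every scale because the covering
  sizes shrink with \<open>m\<close>. Fatou is applied to the measurable majorants, not to the
  slices.\<close>

lemma hausdorff_outer_null_slices:
  fixes K W :: "'a::euclidean_space set" and \<nu> :: "'a \<Rightarrow> 'a" and \<rho>\<^sub>0 :: real
  assumes inv: "tube_injective \<rho>\<^sub>0 K \<nu>"
    and K: "bounded K" and n: "\<And>\<xi>. \<xi> \<in> K \<Longrightarrow> norm (\<nu> \<xi>) = 1" and W: "W \<in> null_sets lborel"
  shows "AE \<rho> in lborel. \<rho> \<in> {0<..<\<rho>\<^sub>0} \<longrightarrow> hausdorff_outer (DIM('a) - 1) {\<xi> \<in> K. \<xi> - \<rho> *\<^sub>R \<nu> \<xi> \<in> W} = 0"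
proof -
  obtain B where B: "\<And>x. x \<in> K \<Longrightarrow> norm x \<le> B" using K by (auto simp: bounded_iff)
  \<comment> \<open>The points over \<open>K\<close> at depth below \<open>\<rho>\<^sub>0\<close>
    lie in this ball, and the cover by cubes asks for a bounded set.\<close>
  define W' where "W' = W \<inter> ball (0::'a) (B + \<rho>\<^sub>0 + 1)"
  have Wb: "bounded W'" unfolding W'_def by (simp add: bounded_Int)
  have "W' \<in> null_sets lborel" unfolding W'_def by (rule null_set_Int2[OF W]) simp
  then have W's: "W' \<in> sets lborel" and W'0: "emeasure lborel W' = 0" by (rule null_setsD2, rule null_setsD1)
  then have W'l: "W' \<in> sets lebesgue" by simp
  define M where "M = ennreal (4 * unit_ball_vol (real (DIM('a) - 1))) * ennreal (real DIM('a) ^ DIM('a))"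
  define E where "E = (\<lambda>\<rho>. {\<xi> \<in> K. \<xi> - \<rho> *\<^sub>R \<nu> \<xi> \<in> W})"
  have EW: "\<xi> - \<rho> *\<^sub>R \<nu> \<xi> \<in> W'" if "\<rho> \<in> {0<..<\<rho>\<^sub>0}" "\<xi> \<in> E \<rho>" for \<rho> \<xi>
    using that norm_triangle_ineq4[of \<xi> "\<rho> *\<^sub>R \<nu> \<xi>"] B[of \<xi>] n[of \<xi>] by (simp add: W'_def E_def)
  have "\<exists>h. h \<in> borel_measurable lborel \<and> (\<integral>\<^sup>+\<rho>. h \<rho> \<partial>lborel) \<le> M * ennreal ((1/2)^m) \<and>
      (\<forall>\<rho>\<in>{0<..<\<rho>\<^sub>0}. hausdorff_pre (DIM('a) - 1) (2 * (1/2)^m) (E \<rho>) \<le> h \<rho>)" for m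
  proof -
    obtain U where U: "open U" "W' \<subseteq> U" "emeasure lebesgue (U - W') < ennreal ((1/2)^m)"
    proof -
      have "0 < (1/2::real)^m" by simp
      from sets_lebesgue_outer_open[OF W'l this] show ?thesis using that by blast
    qed
    have Us: "U \<in> sets lborel" using U(1) by simp
    then have UW: "U - W' \<in> sets lborel" using W's by (rule sets.Diff)
    have "U = W' \<union> (U - W')" using U(2) by blast
    then have "emeasure lborel U \<le> emeasure lborel W' + emeasure lborel (U - W')"
      using emeasure_subadditive[OF W's UW] by simp
    also have "emeasure lborel (U - W') = emeasure lebesgue (U - W')"
      using UW by simp
    also have "emeasure lborel W' + \<dots> \<le> ennreal ((1/2)^m)" unfolding W'0 using U(3) by simp
    finally have Um: "emeasure lborel U \<le> ennreal ((1/2)^m)" .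
    have "0 < (1/2::real)^m" by simp
    from cube_cover[OF Wb U(2,1) this] obtain C :: "nat \<Rightarrow> 'a set" where
      C: "W' \<subseteq> (\<Union>i. C i)" "\<And>i. bounded (C i)" "\<And>i. diameter (C i) \<le> (1/2)^m"
      "(\<Sum>i. ennreal (diameter (C i) ^ DIM('a))) \<le> ennreal (real DIM('a) ^ DIM('a)) * emeasure lborel U"
      by blast
    from hausdorff_slices[OF inv, of C, OF C(2,3)] obtain h where
      h: "h \<in> borel_measurable lborel"
      "(\<integral>\<^sup>+\<rho>. h \<rho> \<partial>lborel) \<le> ennreal (4 * unit_ball_vol (real (DIM('a) - 1))) * (\<Sum>i. ennreal (diameter (C i) ^ DIM('a)))"
      "\<forall>\<rho>\<in>{0<..<\<rho>\<^sub>0}. \<forall>E\<subseteq>K. (\<forall>\<xi>\<in>E. \<xi> - \<rho> *\<^sub>R \<nu> \<xi> \<in> (\<Union>i. C i)) \<longrightarrow>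
       hausdorff_pre (DIM('a) - 1) (2 * (1/2)^m) E \<le> h \<rho>" by blast
    have "(\<integral>\<^sup>+\<rho>. h \<rho> \<partial>lborel) \<le> M * ennreal ((1/2)^m)"
      unfolding M_def mult.assoc
      by (intro order_trans[OF h(2)] mult_left_mono order_trans[OF C(4)] Um) auto
    moreover have "hausdorff_pre (DIM('a) - 1) (2 * (1/2)^m) (E \<rho>) \<le> h \<rho>" if "\<rho> \<in> {0<..<\<rho>\<^sub>0}" for \<rho>
    proof -
      have "E \<rho> \<subseteq> K" by (auto simp: E_def)
      moreover have "\<forall>\<xi>\<in>E \<rho>. \<xi> - \<rho> *\<^sub>R \<nu> \<xi> \<in> (\<Union>i. C i)" using EW[OF that] C(1) by blast
      ultimately show ?thesis using h(3) that by blast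
    qed
    ultimately show ?thesis using h(1) by blast
  qed
  then obtain h where h: "\<And>m. h m \<in> borel_measurable lborel" "\<And>m. (\<integral>\<^sup>+\<rho>. h m \<rho> \<partial>lborel) \<le> M * ennreal ((1/2)^m)"
      "\<And>m \<rho>. \<rho>\<in>{0<..<\<rho>\<^sub>0} \<Longrightarrow> hausdorff_pre (DIM('a) - 1) (2 * (1/2)^m) (E \<rho>) \<le> h m \<rho>" by metis
  have Mfin: "M < top" by (simp add: M_def ennreal_mult_less_top)
  have lim: "(\<lambda>m. ennreal ((1/2)^m)) \<longlonglongrightarrow> ennreal 0"
    by (intro tendsto_ennrealI LIMSEQ_power_zero) simp
  have "(\<lambda>m. M * ennreal ((1/2)^m)) \<longlonglongrightarrow> M * 0"
    using ennreal_tendsto_cmult[OF Mfin lim] by simp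
  then have lim0: "(\<lambda>m. M * ennreal ((1/2)^m)) \<longlonglongrightarrow> 0" by simp
  have "(\<lambda>m. \<integral>\<^sup>+\<rho>. h m \<rho> \<partial>lborel) \<longlonglongrightarrow> 0"
    by (rule tendsto_sandwich[OF always_eventually always_eventually tendsto_const lim0])
      (intro allI zero_le h(2))+
  then have "liminf (\<lambda>m. \<integral>\<^sup>+\<rho>. h m \<rho> \<partial>lborel) = 0" by (intro lim_imp_Liminf) auto
  then have "(\<integral>\<^sup>+\<rho>. liminf (\<lambda>m. h m \<rho>) \<partial>lborel) = 0"
    using nn_integral_liminf[of h, OF h(1)] by simp
  moreover have "(\<lambda>\<rho>. liminf (\<lambda>m. h m \<rho>)) \<in> borel_measurable lborel" using h(1) by measurable
  ultimately have "AE \<rho> in lborel. liminf (\<lambda>m. h m \<rho>) = 0" by (simp add: nn_integral_0_iff_AE)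
  then show ?thesis
  proof eventually_elim
    case (elim \<rho>)
    have "hausdorff_pre (DIM('a) - 1) \<delta> (E \<rho>) \<le> 0" if \<rho>: "\<rho> \<in> {0<..<\<rho>\<^sub>0}" and \<delta>: "\<delta> > 0" for \<delta>
    proof -
      have "(\<lambda>m. 2 * (1/2::real)^m) \<longlonglongrightarrow> 2 * 0" by (intro tendsto_mult tendsto_const LIMSEQ_power_zero) simp
      then have "\<forall>\<^sub>F m in sequentially. 2 * (1/2::real)^m < \<delta>" using \<delta> by (intro order_tendstoD(2)) auto
      then have "\<forall>\<^sub>F m in sequentially. hausdorff_pre (DIM('a) - 1) \<delta> (E \<rho>) \<le> h m \<rho>"
      proof eventually_elim
        case (elim m)
        show ?case by (rule order_trans[OF hausdorff_pre_antimono h(3)[OF \<rho>]]) (use elim in simp)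
      qed
      then have "hausdorff_pre (DIM('a) - 1) \<delta> (E \<rho>) \<le> liminf (\<lambda>m. h m \<rho>)" by (rule Liminf_bounded)
      then show ?thesis using elim by simp
    qed
    then have "hausdorff_outer (DIM('a) - 1) (E \<rho>) \<le> 0" if "\<rho> \<in> {0<..<\<rho>\<^sub>0}"
      unfolding hausdorff_outer_def using that by (intro SUP_least) simp
    then show ?case by (simp add: E_def)
  qed
qed

section \<open>Surface and lateral measure\<close>

lemma space_surface_measure: "space (surface_measure \<Omega>) = frontier \<Omega>"
  by (simp add: surface_measure_def space_restrict_space hausdorff_measure_def space_measure_of_conv)

lemma sets_hausdorff_measure: "sets (hausdorff_measure d) = sets borel"
  using sets.sigma_sets_eq[of borel] by (simp add: hausdorff_measure_def sets_measure_of_conv)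

lemma sets_surface_measure: "sets (surface_measure \<Omega>) = sets (restrict_space borel (frontier \<Omega>))"
  by (simp add: surface_measure_def sets_restrict_space sets_hausdorff_measure)

text \<open>\<open>measure_of\<close> returns the prescribed set function on its sigma-algebra if
  that is a measure, and 0 otherwise; the outer measure is an upper bound in each case.\<close>

lemma emeasure_surface_measure_le:
  fixes A :: "'a::euclidean_space set"
  assumes "A \<subseteq> frontier \<Omega>"
  shows "emeasure (surface_measure \<Omega>) A \<le> hausdorff_outer (DIM('a) - 1) A"
proof -
  have "frontier \<Omega> \<in> sets (hausdorff_measure (DIM('a) - 1))"
    by (simp add: sets_hausdorff_measure borel_closed)
  then have "emeasure (surface_measure \<Omega>) A = emeasure (hausdorff_measure (DIM('a) - 1)) A"
    using assms unfolding surface_measure_def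
    by (intro emeasure_restrict_space) (simp_all add: hausdorff_measure_def space_measure_of_conv)
  also have "\<dots> \<le> hausdorff_outer (DIM('a) - 1) A"
    unfolding hausdorff_measure_def emeasure_measure_of_conv by simp
  finally show ?thesis .
qed

lemma normal_tube_cover:
  fixes \<Omega> :: "'a::euclidean_space set"
  assumes \<Omega>: "open \<Omega>" "bounded \<Omega>" "smooth_boundary \<Omega>"
  defines "\<nu> \<equiv> exterior_normal \<Omega>"
  obtains \<rho>\<^sub>0 \<K> where "0 < \<rho>\<^sub>0" "finite \<K>" "\<Union>\<K> = frontier \<Omega>"
    "\<forall>K\<in>\<K>. K \<in> sets (surface_measure \<Omega>) \<and> tube_injective \<rho>\<^sub>0 K \<nu>"
    "\<forall>\<xi>\<in>frontier \<Omega>. \<forall>\<rho>\<in>{0<..<\<rho>\<^sub>0}. \<xi> - \<rho> *\<^sub>R \<nu> \<xi> \<in> \<Omega>"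
proof -
  define P where "P = (\<lambda>x r \<rho>\<^sub>0. 0 < r \<and> 0 < \<rho>\<^sub>0 \<and> tube_injective \<rho>\<^sub>0 (frontier \<Omega> \<inter> ball x r) \<nu> \<and>
    (\<forall>\<xi>\<in>frontier \<Omega> \<inter> ball x r. \<forall>\<rho>\<in>{0<..<\<rho>\<^sub>0}. \<xi> - \<rho> *\<^sub>R \<nu> \<xi> \<in> \<Omega>))"
  have "\<exists>r \<rho>\<^sub>0. P x r \<rho>\<^sub>0" if "x \<in> frontier \<Omega>" for x
  proof (rule normal_tube_local[OF \<Omega>(1,3) that])
    fix r \<rho>\<^sub>0 :: real
    assume "0 < r" "0 < \<rho>\<^sub>0" "tube_injective \<rho>\<^sub>0 (frontier \<Omega> \<inter> ball x r) (exterior_normal \<Omega>)"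
      "\<forall>\<xi>\<in>frontier \<Omega> \<inter> ball x r. \<forall>\<rho>\<in>{0<..<\<rho>\<^sub>0}. \<xi> - \<rho> *\<^sub>R exterior_normal \<Omega> \<xi> \<in> \<Omega>"
    then have "P x r \<rho>\<^sub>0" unfolding P_def \<nu>_def by (intro conjI)
    then show ?thesis by (intro exI)
  qed
  then obtain r s where P: "\<And>x. x \<in> frontier \<Omega> \<Longrightarrow> P x (r x) (s x)" by metis
  have "compact (frontier \<Omega>)" using \<Omega>(2) by (simp add: compact_frontier_bounded)
  moreover have "\<And>x. x \<in> frontier \<Omega> \<Longrightarrow> open (ball x (r x))" by simp
  moreover have "frontier \<Omega> \<subseteq> (\<Union>x\<in>frontier \<Omega>. ball x (r x))"
  proof
    fix x assume x: "x \<in> frontier \<Omega>"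
    then have "x \<in> ball x (r x)" using P[OF x] by (simp add: P_def)
    then show "x \<in> (\<Union>x\<in>frontier \<Omega>. ball x (r x))" using x by blast
  qed
  ultimately obtain F where F: "F \<subseteq> frontier \<Omega>" "finite F" "frontier \<Omega> \<subseteq> (\<Union>x\<in>F. ball x (r x))"
    by (rule compactE_image)
  \<comment> \<open>The 1 keeps the minimum meaningful when \<open>F\<close> is empty.\<close>
  define \<rho>\<^sub>0 where "\<rho>\<^sub>0 = Min (insert 1 (s ` F))"
  have s0: "0 < s x" if "x \<in> F" for x using F(1) P[of x] that by (auto simp: P_def)
  have pos: "0 < \<rho>\<^sub>0" using F(2) s0 by (simp add: \<rho>\<^sub>0_def)
  have le: "\<rho>\<^sub>0 \<le> s x" if "x \<in> F" for x using F(2) that by (auto simp: \<rho>\<^sub>0_def intro: Min_le)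
  have PF: "P x (r x) \<rho>\<^sub>0" if "x \<in> F" for x
  proof -
    have "{0<..<\<rho>\<^sub>0} \<subseteq> {0<..<s x}" using le[OF that] by auto
    moreover have "P x (r x) (s x)" using P F(1) that by blast
    ultimately show ?thesis using pos unfolding P_def tube_injective_def by blast
  qed
  show ?thesis
  proof (rule that[OF pos, of "(\<lambda>x. frontier \<Omega> \<inter> ball x (r x)) ` F"])
    show "finite ((\<lambda>x. frontier \<Omega> \<inter> ball x (r x)) ` F)" using F(2) by simp
    show "\<Union>((\<lambda>x. frontier \<Omega> \<inter> ball x (r x)) ` F) = frontier \<Omega>" using F(3) by blast
    have "frontier \<Omega> \<inter> ball x (r x) \<in> sets (surface_measure \<Omega>)" for x
      unfolding sets_surface_measure sets_restrict_space by (rule imageI) simp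
    then show "\<forall>K\<in>(\<lambda>x. frontier \<Omega> \<inter> ball x (r x)) ` F. K \<in> sets (surface_measure \<Omega>) \<and> tube_injective \<rho>\<^sub>0 K \<nu>"
      using PF unfolding P_def by blast
    show "\<forall>\<xi>\<in>frontier \<Omega>. \<forall>\<rho>\<in>{0<..<\<rho>\<^sub>0}. \<xi> - \<rho> *\<^sub>R \<nu> \<xi> \<in> \<Omega>"
    proof (intro ballI)
      fix \<xi> \<rho> assume \<xi>: "\<xi> \<in> frontier \<Omega>" "\<rho> \<in> {0<..<\<rho>\<^sub>0}"
      then obtain x where x: "x \<in> F" "\<xi> \<in> ball x (r x)" using F(3) by blast
      then show "\<xi> - \<rho> *\<^sub>R \<nu> \<xi> \<in> \<Omega>" using PF[OF x(1)] \<xi> unfolding P_def by blast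
    qed
  qed
qed

lemma exterior_normal_measurable:
  fixes \<Omega> :: "'a::euclidean_space set"
  assumes "open \<Omega>" "smooth_boundary \<Omega>"
  shows "exterior_normal \<Omega> \<in> borel_measurable (surface_measure \<Omega>)"
proof -
  have "exterior_normal \<Omega> \<in> borel_measurable (restrict_space borel (frontier \<Omega>))"
    by (rule borel_measurable_continuous_on_restrict[OF continuous_on_exterior_normal[OF assms]])
  then show ?thesis using measurable_cong_sets[OF sets_surface_measure refl] by blast
qed

lemma ident_surface_measurable: "(\<lambda>\<xi>. \<xi>) \<in> borel_measurable (surface_measure \<Omega>)"
proof -
  have "(\<lambda>\<xi>. \<xi>) \<in> borel_measurable (restrict_space borel (frontier \<Omega>))"
    by (rule measurable_restrict_space1) simp
  then show ?thesis using measurable_cong_sets[OF sets_surface_measure refl] by blast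
qed

lemma finite_surface_measure:
  fixes \<Omega> :: "'a::euclidean_space set"
  assumes "open \<Omega>" "bounded \<Omega>" "smooth_boundary \<Omega>"
  shows "finite_measure (surface_measure \<Omega>)"
proof (rule finite_measureI)
  obtain \<rho>\<^sub>0 \<K> where K: "0 < \<rho>\<^sub>0" "finite \<K>" "\<Union>\<K> = frontier \<Omega>"
    "\<forall>K\<in>\<K>. K \<in> sets (surface_measure \<Omega>) \<and> tube_injective \<rho>\<^sub>0 K (exterior_normal \<Omega>)"
    by (rule normal_tube_cover[OF assms])
  have bf: "bounded (frontier \<Omega>)" by (rule compact_imp_bounded[OF compact_frontier_bounded[OF assms(2)]])
  have "emeasure (surface_measure \<Omega>) K < \<infinity>" if "K \<in> \<K>" for K
  proof (rule le_less_trans[OF emeasure_surface_measure_le])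
    show sub: "K \<subseteq> frontier \<Omega>" using K(3) that by blast
    show "hausdorff_outer (DIM('a) - 1) K < \<infinity>"
    proof (rule hausdorff_outer_finite)
      show "tube_injective \<rho>\<^sub>0 K (exterior_normal \<Omega>)" using K(4) that by blast
      show "norm (exterior_normal \<Omega> \<xi>) = 1" if "\<xi> \<in> K" for \<xi>
        using norm_exterior_normal[OF assms(1,3)] sub that by blast
    qed (use K(1) bounded_subset[OF bf sub] in auto)
  qed
  then have "(\<Sum>K\<in>\<K>. emeasure (surface_measure \<Omega>) K) < \<infinity>" by (simp add: ennreal_sum_less_top K(2))
  moreover have "emeasure (surface_measure \<Omega>) (\<Union>K\<in>\<K>. K) \<le> (\<Sum>K\<in>\<K>. emeasure (surface_measure \<Omega>) K)"
    using K(2,4) by (intro emeasure_subadditive_finite) auto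
  ultimately have "emeasure (surface_measure \<Omega>) (\<Union>K\<in>\<K>. K) < \<infinity>" by (rule le_less_trans[rotated])
  then have "emeasure (surface_measure \<Omega>) (frontier \<Omega>) < \<infinity>" using K(3) by simp
  then show "emeasure (surface_measure \<Omega>) (space (surface_measure \<Omega>)) \<noteq> \<infinity>"
    by (simp add: space_surface_measure)
qed

lemma surface_measure_null_slices:
  fixes \<Omega> :: "'a::euclidean_space set"
  assumes \<Omega>: "open \<Omega>" "bounded \<Omega>" "smooth_boundary \<Omega>"
    and \<K>: "finite \<K>" "\<Union>\<K> = frontier \<Omega>"
      "\<forall>K\<in>\<K>. K \<in> sets (surface_measure \<Omega>) \<and> tube_injective \<rho>\<^sub>0 K (exterior_normal \<Omega>)"
    and W: "W \<in> null_sets lborel"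
  shows "AE \<rho> in lborel. \<rho> \<in> {0<..<\<rho>\<^sub>0} \<longrightarrow>
    emeasure (surface_measure \<Omega>) {\<xi> \<in> frontier \<Omega>. \<xi> - \<rho> *\<^sub>R exterior_normal \<Omega> \<xi> \<in> W} = 0"
proof -
  note [measurable] = exterior_normal_measurable[OF \<Omega>(1,3)]
  have bf: "bounded (frontier \<Omega>)" by (rule compact_imp_bounded[OF compact_frontier_bounded[OF \<Omega>(2)]])
  have [measurable]: "(\<lambda>\<xi>. \<xi>) \<in> borel_measurable (surface_measure \<Omega>)"
    by (rule ident_surface_measurable)
  have [measurable]: "W \<in> sets borel" using W by auto
  define E where "E = (\<lambda>K \<rho>. {\<xi> \<in> K. \<xi> - \<rho> *\<^sub>R exterior_normal \<Omega> \<xi> \<in> W})"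
  have "AE \<rho> in lborel. \<rho> \<in> {0<..<\<rho>\<^sub>0} \<longrightarrow> hausdorff_outer (DIM('a) - 1) (E K \<rho>) = 0" if "K \<in> \<K>" for K
    unfolding E_def
  proof (rule hausdorff_outer_null_slices[OF _ _ _ W])
    have sub: "K \<subseteq> frontier \<Omega>" using \<K>(2) that by blast
    show "tube_injective \<rho>\<^sub>0 K (exterior_normal \<Omega>)" using \<K>(3) that by blast
    show "bounded K" using bounded_subset[OF bf sub] .
    show "norm (exterior_normal \<Omega> \<xi>) = 1" if "\<xi> \<in> K" for \<xi>
      using norm_exterior_normal[OF \<Omega>(1,3)] sub that by blast
  qed
  then have "AE \<rho> in lborel. \<forall>K\<in>\<K>. \<rho> \<in> {0<..<\<rho>\<^sub>0} \<longrightarrow> hausdorff_outer (DIM('a) - 1) (E K \<rho>) = 0"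
    using \<K>(1) by (intro AE_finite_allI)
  then show ?thesis
  proof eventually_elim
    case (elim \<rho>)
    show ?case
    proof
      assume \<rho>: "\<rho> \<in> {0<..<\<rho>\<^sub>0}"
      have "E K \<rho> \<in> null_sets (surface_measure \<Omega>)" if "K \<in> \<K>" for K
      proof
        have "E K \<rho> = K \<inter> {\<xi> \<in> space (surface_measure \<Omega>). \<xi> - \<rho> *\<^sub>R exterior_normal \<Omega> \<xi> \<in> W}"
          using \<K>(2) that by (auto simp: E_def space_surface_measure)
        also have "\<dots> \<in> sets (surface_measure \<Omega>)"
        proof (rule sets.Int)
          show "K \<in> sets (surface_measure \<Omega>)" using \<K>(3) that by blast
        qed measurable
        finally show "E K \<rho> \<in> sets (surface_measure \<Omega>)" .
        have "E K \<rho> \<subseteq> frontier \<Omega>" using \<K>(2) that by (auto simp: E_def)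
        then show "emeasure (surface_measure \<Omega>) (E K \<rho>) = 0"
          using emeasure_surface_measure_le[of "E K \<rho>" \<Omega>] elim that \<rho> by simp
      qed
      then have "(\<Union>K\<in>\<K>. E K \<rho>) \<in> null_sets (surface_measure \<Omega>)" using \<K>(1) by (intro null_sets_UN') (auto intro: countable_finite)
      moreover have "(\<Union>K\<in>\<K>. E K \<rho>) = {\<xi> \<in> frontier \<Omega>. \<xi> - \<rho> *\<^sub>R exterior_normal \<Omega> \<xi> \<in> W}"
        using \<K>(2) by (auto simp: E_def)
      ultimately show "emeasure (surface_measure \<Omega>) {\<xi> \<in> frontier \<Omega>. \<xi> - \<rho> *\<^sub>R exterior_normal \<Omega> \<xi> \<in> W} = 0"
        by auto
    qed
  qed
qed

section \<open>Null sets and measurability on the lateral boundary\<close>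

lemma space_lateral_measure: "space (lateral_measure T \<Omega>) = {0..T} \<times> frontier \<Omega>"
  by (simp add: lateral_measure_def space_pair_measure space_surface_measure space_restrict_space)

lemma finite_time_measure: "finite_measure (restrict_space lborel {0..T::real})"
  by (intro finite_measureI)
    (simp add: emeasure_restrict_space space_restrict_space emeasure_lborel_Icc_eq)

lemma finite_lateral_measure:
  fixes \<Omega> :: "'a::euclidean_space set"
  assumes "open \<Omega>" "bounded \<Omega>" "smooth_boundary \<Omega>"
  shows "finite_measure (lateral_measure T \<Omega>)"
proof -
  interpret S: finite_measure "surface_measure \<Omega>" by (rule finite_surface_measure[OF assms])
  interpret R: finite_measure "restrict_space lborel {0..T}" by (rule finite_time_measure)
  interpret finite_measure "restrict_space lborel {0..T} \<Otimes>\<^sub>M surface_measure \<Omega>"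
    by (rule finite_measure_pair_measure) unfold_locales
  show ?thesis
    unfolding lateral_measure_def by (rule finite_measureI) (simp add: emeasure_eq_measure)
qed

text \<open>Almost every time section of \<open>Z\<close> is null, so for almost every
  \<open>t\<close> the surface result holds at almost every depth; exchanging \<open>t\<close> and
  \<rho> yields, at almost every depth, a null set in the product. The indicator \<open>G\<close>
  turns these statements into vanishing integrals, to which Tonelli applies.\<close>

lemma lateral_null_slices:
  fixes \<Omega> :: "'a::euclidean_space set"
  assumes \<Omega>: "open \<Omega>" "bounded \<Omega>" "smooth_boundary \<Omega>"
    and \<K>: "finite \<K>" "\<Union>\<K> = frontier \<Omega>"
      "\<forall>K\<in>\<K>. K \<in> sets (surface_measure \<Omega>) \<and> tube_injective \<rho>\<^sub>0 K (exterior_normal \<Omega>)"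
    and Z: "Z \<in> null_sets (lborel :: (real \<times> 'a) measure)"
  shows "AE \<rho> in lborel. \<rho> \<in> {0<..<\<rho>\<^sub>0} \<longrightarrow>
    (AE (t, \<xi>) in restrict_space lborel {0..T} \<Otimes>\<^sub>M surface_measure \<Omega>. (t, \<xi> - \<rho> *\<^sub>R exterior_normal \<Omega> \<xi>) \<notin> Z)"
proof -
  define \<tau> where "\<tau> = restrict_space lborel {0..T}"
  define \<sigma> where "\<sigma> = surface_measure \<Omega>"
  define l where "l = restrict_space lborel {0<..<\<rho>\<^sub>0}"
  interpret S: finite_measure \<sigma> unfolding \<sigma>_def by (rule finite_surface_measure[OF \<Omega>])
  interpret R: finite_measure \<tau> unfolding \<tau>_def by (rule finite_time_measure)
  interpret L: sigma_finite_measure l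
    unfolding l_def by (intro sigma_finite_measure_restrict_space lborel.sigma_finite_measure_axioms) simp
  interpret LR: pair_sigma_finite l \<tau> ..
  have [measurable]: "exterior_normal \<Omega> \<in> borel_measurable \<sigma>"
    unfolding \<sigma>_def by (rule exterior_normal_measurable[OF \<Omega>(1,3)])
  have [measurable]: "(\<lambda>\<xi>. \<xi>) \<in> borel_measurable \<sigma>"
    unfolding \<sigma>_def by (rule ident_surface_measurable)
  have [measurable]: "(\<lambda>t. t) \<in> borel_measurable \<tau>" "(\<lambda>t. t) \<in> borel_measurable l"
    unfolding \<tau>_def l_def by (auto intro: measurable_restrict_space1)
  have [measurable]: "Z \<in> sets borel" using Z by auto
  define G where "G = (\<lambda>\<rho> t \<xi>. indicator Z (t, \<xi> - \<rho> *\<^sub>R exterior_normal \<Omega> \<xi>) :: ennreal)"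
  have Gm [measurable]: "(\<lambda>((\<rho>, t), \<xi>). G \<rho> t \<xi>) \<in> borel_measurable ((l \<Otimes>\<^sub>M \<tau>) \<Otimes>\<^sub>M \<sigma>)"
    unfolding G_def case_prod_unfold by measurable
  have Im [measurable]: "(\<lambda>(\<rho>, t). \<integral>\<^sup>+\<xi>. G \<rho> t \<xi> \<partial>\<sigma>) \<in> borel_measurable (l \<Otimes>\<^sub>M \<tau>)"
    using S.borel_measurable_nn_integral[of "\<lambda>x \<xi>. G (fst x) (snd x) \<xi>" "l \<Otimes>\<^sub>M \<tau>"] Gm
    by (simp add: case_prod_unfold)
  have "AE t in lborel. {x. (t, x) \<in> Z} \<in> null_sets lborel"
  proof -
    have "Z \<in> null_sets (lborel \<Otimes>\<^sub>M lborel)" using Z by (simp add: lborel_prod)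
    then have "AE x in lborel \<Otimes>\<^sub>M lborel. x \<notin> Z" by (rule AE_not_in)
    then have "AE t in lborel. AE x in lborel. (t, x) \<notin> Z" by (rule lborel_pair.AE_pair)
    then show ?thesis
    proof eventually_elim
      case (elim t)
      have "{x \<in> space borel. (t, x) \<in> Z} \<in> sets borel" by measurable
      then show ?case using elim AE_iff_null_sets[of "{x. (t, x) \<in> Z}" lborel] by simp
    qed
  qed
  then have "AE t in \<tau>. {x. (t, x) \<in> Z} \<in> null_sets lborel"
    unfolding \<tau>_def by (subst AE_restrict_space_iff) auto
  then have zero: "AE t in \<tau>. (\<integral>\<^sup>+\<rho>. \<integral>\<^sup>+\<xi>. G \<rho> t \<xi> \<partial>\<sigma> \<partial>l) = 0"
  proof eventually_elim
    case (elim t)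
    have "AE \<rho> in l. emeasure \<sigma> {\<xi> \<in> frontier \<Omega>. \<xi> - \<rho> *\<^sub>R exterior_normal \<Omega> \<xi> \<in> {x. (t, x) \<in> Z}} = 0"
      using surface_measure_null_slices[OF \<Omega> \<K> elim] unfolding l_def \<sigma>_def
      by (subst AE_restrict_space_iff) auto
    then have "AE \<rho> in l. (\<integral>\<^sup>+\<xi>. G \<rho> t \<xi> \<partial>\<sigma>) = 0"
    proof eventually_elim
      case (elim \<rho>)
      have "(\<integral>\<^sup>+\<xi>. G \<rho> t \<xi> \<partial>\<sigma>) = (\<integral>\<^sup>+\<xi>. indicator {\<xi> \<in> space \<sigma>. (t, \<xi> - \<rho> *\<^sub>R exterior_normal \<Omega> \<xi>) \<in> Z} \<xi> \<partial>\<sigma>)"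
        by (intro nn_integral_cong) (simp add: G_def indicator_def)
      also have "\<dots> = emeasure \<sigma> {\<xi> \<in> space \<sigma>. (t, \<xi> - \<rho> *\<^sub>R exterior_normal \<Omega> \<xi>) \<in> Z}"
        by (intro nn_integral_indicator) measurable
      also have "\<dots> = 0" using elim by (simp add: \<sigma>_def space_surface_measure)
      finally show ?case .
    qed
    then show ?case by (simp add: nn_integral_0_iff_AE cong: nn_integral_cong_AE)
  qed
  have "(\<integral>\<^sup>+\<rho>. \<integral>\<^sup>+t. \<integral>\<^sup>+\<xi>. G \<rho> t \<xi> \<partial>\<sigma> \<partial>\<tau> \<partial>l) = (\<integral>\<^sup>+t. \<integral>\<^sup>+\<rho>. \<integral>\<^sup>+\<xi>. G \<rho> t \<xi> \<partial>\<sigma> \<partial>l \<partial>\<tau>)"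
    using LR.Fubini'[OF Im] by simp
  also have "\<dots> = (\<integral>\<^sup>+t. 0 \<partial>\<tau>)" using zero by (intro nn_integral_cong_AE)
  finally have "(\<integral>\<^sup>+\<rho>. \<integral>\<^sup>+t. \<integral>\<^sup>+\<xi>. G \<rho> t \<xi> \<partial>\<sigma> \<partial>\<tau> \<partial>l) = 0" by simp
  moreover have "(\<lambda>\<rho>. \<integral>\<^sup>+t. \<integral>\<^sup>+\<xi>. G \<rho> t \<xi> \<partial>\<sigma> \<partial>\<tau>) \<in> borel_measurable l"
    using R.borel_measurable_nn_integral[of "\<lambda>\<rho> t. \<integral>\<^sup>+\<xi>. G \<rho> t \<xi> \<partial>\<sigma>" l] Im by simp
  ultimately have "AE \<rho> in l. (\<integral>\<^sup>+t. \<integral>\<^sup>+\<xi>. G \<rho> t \<xi> \<partial>\<sigma> \<partial>\<tau>) = 0"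
    by (simp add: nn_integral_0_iff_AE)
  then have "AE \<rho> in l. AE (t, \<xi>) in \<tau> \<Otimes>\<^sub>M \<sigma>. (t, \<xi> - \<rho> *\<^sub>R exterior_normal \<Omega> \<xi>) \<notin> Z"
  proof eventually_elim
    case (elim \<rho>)
    have [measurable]: "(\<lambda>x. G \<rho> (fst x) (snd x)) \<in> borel_measurable (\<tau> \<Otimes>\<^sub>M \<sigma>)"
      unfolding G_def by measurable
    have "(\<integral>\<^sup>+x. G \<rho> (fst x) (snd x) \<partial>(\<tau> \<Otimes>\<^sub>M \<sigma>)) = 0"
      using elim S.nn_integral_fst[of "\<lambda>x. G \<rho> (fst x) (snd x)" \<tau>] by simp
    then have "AE x in \<tau> \<Otimes>\<^sub>M \<sigma>. G \<rho> (fst x) (snd x) = 0" by (simp add: nn_integral_0_iff_AE)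
    then show ?case by eventually_elim (auto simp: G_def indicator_def split: if_splits)
  qed
  then show ?thesis unfolding l_def \<tau>_def \<sigma>_def by (subst (asm) AE_restrict_space_iff) auto
qed

text \<open>In a completed measure a set that agrees almost everywhere with a measurable one is
  measurable. This lets a Borel representative stand in for \<open>u\<close> on the lateral
  boundary.\<close>

lemma borel_measurable_completion_AE_cong:
  fixes f g :: "'a \<Rightarrow> 'b::topological_space"
  assumes f: "f \<in> borel_measurable P" and eq: "AE x in P. f x = g x"
  shows "g \<in> borel_measurable (completion P)"
proof (rule measurableI)
  fix A :: "'b set" assume "A \<in> sets borel"
  then have "f -` A \<inter> space P \<in> sets (completion P)"
    using measurable_sets[OF measurable_completion[OF f]] by simp
  moreover have "AE x in completion P. (x \<in> f -` A \<inter> space P) = (x \<in> g -` A \<inter> space (completion P))"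
    using AE_completion[OF eq] by eventually_elim simp
  ultimately show "g -` A \<inter> space (completion P) \<in> sets (completion P)"
    by (intro completion.in_sets_AE[of "f -` A \<inter> space P" "g -` A \<inter> space (completion P)" P]) auto
qed simp

lemma AE_lborelE:
  assumes "AE x in lborel. P x"
  obtains N where "N \<in> null_sets lborel" "\<forall>x. x \<notin> N \<longrightarrow> P x"
  using assms unfolding eventually_ae_filter space_lborel space_borel by blast

text \<open>
  \<open>u\<close> is only Lebesgue measurable, so its translates are measurable on the lateral boundary only
  because null sets pull back to null sets for almost every \<open>\<rho>\<close>.
\<close>

lemma normal_translates_measurable:
  fixes \<Omega> :: "'a::euclidean_space set" and u :: "real \<Rightarrow> 'a \<Rightarrow> real"
  assumes \<Omega>: "open \<Omega>" "bounded \<Omega>" "smooth_boundary \<Omega>"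
    and u: "L_infinity (lebesgue_on ({0..T} \<times> \<Omega>)) (\<lambda>(t, x). u t x)"
  shows "\<exists>N C. \<exists>\<rho>\<^sub>0>0. negligible N \<and> (\<forall>\<rho>\<in>{0<..<\<rho>\<^sub>0} - N.
    (\<lambda>(t, \<xi>). u t (\<xi> - \<rho> *\<^sub>R exterior_normal \<Omega> \<xi>)) \<in> borel_measurable (lateral_measure T \<Omega>) \<and>
    (AE (t, \<xi>) in lateral_measure T \<Omega>. \<bar>u t (\<xi> - \<rho> *\<^sub>R exterior_normal \<Omega> \<xi>)\<bar> \<le> C))"
proof -
  obtain \<rho>\<^sub>0 \<K> where \<rho>\<^sub>0: "0 < \<rho>\<^sub>0" and \<K>: "finite \<K>" "\<Union>\<K> = frontier \<Omega>"
    "\<forall>K\<in>\<K>. K \<in> sets (surface_measure \<Omega>) \<and> tube_injective \<rho>\<^sub>0 K (exterior_normal \<Omega>)"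
    and ins: "\<forall>\<xi>\<in>frontier \<Omega>. \<forall>\<rho>\<in>{0<..<\<rho>\<^sub>0}. \<xi> - \<rho> *\<^sub>R exterior_normal \<Omega> \<xi> \<in> \<Omega>"
    by (rule normal_tube_cover[OF \<Omega>])
  define S where "S = {0..T} \<times> \<Omega>"
  have S: "S \<in> sets lebesgue" unfolding S_def
    using \<Omega>(1) by (intro sets_completionI_sets) (simp add: borel_Times borel_open borel_closed)
  define v where "v = (\<lambda>x. if x \<in> S then (\<lambda>(t, x). u t x) x else 0)"
  obtain C where um: "(\<lambda>(t, x). u t x) \<in> borel_measurable (lebesgue_on S)"
    and C: "AE x in lebesgue_on S. norm ((\<lambda>(t, x). u t x) x) \<le> C"
    using u unfolding L_infinity_def S_def by blast
  have "v \<in> borel_measurable lebesgue" unfolding v_def using um S by (rule borel_measurable_if_I)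
  \<comment> \<open>A Borel representative can be composed with the tube map. \<open>Z\<close>
    collects the points where it differs from \<open>v\<close> or where the bound fails, and its
    preimage is null at almost every depth.\<close>
  then obtain v' where v': "v' \<in> borel_measurable lborel" "AE x in lborel. v x = v' x"
    using completion_ex_borel_measurable_real by blast
  have "AE x in lebesgue. x \<in> S \<longrightarrow> norm ((\<lambda>(t, x). u t x) x) \<le> C"
    using C S by (subst (asm) AE_restrict_space_iff) auto
  then have "AE x in lborel. x \<in> S \<longrightarrow> norm ((\<lambda>(t, x). u t x) x) \<le> C" by (simp add: AE_completion_iff)
  with v'(2) have "AE x in lborel. v x = v' x \<and> (x \<in> S \<longrightarrow> norm ((\<lambda>(t, x). u t x) x) \<le> C)" by eventually_elim simp
  then obtain Z where Z1: "Z \<in> null_sets lborel"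
    and Z2: "\<forall>x. x \<notin> Z \<longrightarrow> v x = v' x \<and> (x \<in> S \<longrightarrow> norm ((\<lambda>(t, x). u t x) x) \<le> C)"
    by (rule AE_lborelE)
  from lateral_null_slices[OF \<Omega> \<K> Z1, of T] obtain N where N: "N \<in> null_sets lborel"
    "\<forall>\<rho>. \<rho> \<notin> N \<longrightarrow> \<rho> \<in> {0<..<\<rho>\<^sub>0} \<longrightarrow>
    (AE (t, \<xi>) in restrict_space lborel {0..T} \<Otimes>\<^sub>M surface_measure \<Omega>. (t, \<xi> - \<rho> *\<^sub>R exterior_normal \<Omega> \<xi>) \<notin> Z)"
    by (rule AE_lborelE)
  have "negligible N" using N(1) by (simp add: negligible_iff_null_sets null_sets_completionI)
  moreover have "(\<lambda>(t, \<xi>). u t (\<xi> - \<rho> *\<^sub>R exterior_normal \<Omega> \<xi>)) \<in> borel_measurable (lateral_measure T \<Omega>) \<and>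
    (AE (t, \<xi>) in lateral_measure T \<Omega>. \<bar>u t (\<xi> - \<rho> *\<^sub>R exterior_normal \<Omega> \<xi>)\<bar> \<le> C)" if \<rho>: "\<rho> \<in> {0<..<\<rho>\<^sub>0} - N" for \<rho>
  proof -
    define P where "P = restrict_space lborel {0..T} \<Otimes>\<^sub>M surface_measure \<Omega>"
    define y where "y = (\<lambda>x::real \<times> 'a. (fst x, snd x - \<rho> *\<^sub>R exterior_normal \<Omega> (snd x)))"
    have lat: "lateral_measure T \<Omega> = completion P" by (simp add: lateral_measure_def P_def)
    have ae: "AE x in P. y x \<notin> Z"
      unfolding P_def y_def using N(2) \<rho> by (simp add: case_prod_unfold)
    have yS: "y x \<in> S" if "x \<in> space P" for x
      using that \<rho> ins by (auto simp: P_def y_def S_def space_pair_measure space_surface_measure space_restrict_space)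
    have [measurable]: "exterior_normal \<Omega> \<in> borel_measurable (surface_measure \<Omega>)"
      by (rule exterior_normal_measurable[OF \<Omega>(1,3)])
    have [measurable]: "(\<lambda>\<xi>. \<xi>) \<in> borel_measurable (surface_measure \<Omega>)"
      by (rule ident_surface_measurable)
    have [measurable]: "(\<lambda>t. t) \<in> borel_measurable (restrict_space lborel {0..T})"
      by (auto intro: measurable_restrict_space1)
    have [measurable]: "y \<in> borel_measurable P" unfolding y_def P_def by measurable
    have [measurable]: "v' \<in> borel_measurable borel" using v'(1) by simp
    have v'P: "(\<lambda>x. v' (y x)) \<in> borel_measurable P" by measurable
    have eq: "AE x in P. v' (y x) = (\<lambda>(t, \<xi>). u t (\<xi> - \<rho> *\<^sub>R exterior_normal \<Omega> \<xi>)) x \<and>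
       \<bar>(\<lambda>(t, \<xi>). u t (\<xi> - \<rho> *\<^sub>R exterior_normal \<Omega> \<xi>)) x\<bar> \<le> C"
      using ae AE_space
    proof eventually_elim
      case (elim x)
      then have "v (y x) = v' (y x)" "\<bar>u (fst (y x)) (snd (y x))\<bar> \<le> C"
        using Z2[rule_format, of "y x"] yS[of x] by (auto simp: case_prod_unfold)
      then show ?case using yS[OF elim(2)] by (simp add: v_def y_def case_prod_unfold)
    qed
    then have 1: "AE x in P. v' (y x) = (\<lambda>(t, \<xi>). u t (\<xi> - \<rho> *\<^sub>R exterior_normal \<Omega> \<xi>)) x" by eventually_elim simp
    from eq have "AE x in P. \<bar>(\<lambda>(t, \<xi>). u t (\<xi> - \<rho> *\<^sub>R exterior_normal \<Omega> \<xi>)) x\<bar> \<le> C"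
      by eventually_elim simp
    then have "AE x in completion P. \<bar>(\<lambda>(t, \<xi>). u t (\<xi> - \<rho> *\<^sub>R exterior_normal \<Omega> \<xi>)) x\<bar> \<le> C"
      by (rule AE_completion)
    moreover have "(\<lambda>(t, \<xi>). u t (\<xi> - \<rho> *\<^sub>R exterior_normal \<Omega> \<xi>)) \<in> borel_measurable (completion P)"
      by (rule borel_measurable_completion_AE_cong[OF v'P 1])
    ultimately show ?thesis unfolding lat by (simp add: case_prod_unfold)
  qed
  ultimately show ?thesis using \<rho>\<^sub>0 by blast
qed

section \<open>Pointwise entropy inequalities\<close>

lemma interval_between_iff: "k \<in> interval_between a b \<longleftrightarrow> (a \<le> k \<and> k \<le> b) \<or> (b \<le> k \<and> k \<le> a)"
  unfolding interval_between_def by (auto simp: zero_le_mult_iff)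

text \<open>The median of the three numbers, written as the projection of \<open>z\<close> onto the
  interval with end points \<open>w\<close> and \<open>k\<close>. \<open>F_flux\<close> is the
  increment of \<open>f\<close> between \<open>z\<close> and this median, taken upwards, a form in
  which its continuity is visible.\<close>

definition clamp3 :: "real \<Rightarrow> real \<Rightarrow> real \<Rightarrow> real" where
  "clamp3 z w k = max (min w k) (min (max w k) z)"

lemma F_flux_clamp: "F_flux f t x z w k = f t x (max z (clamp3 z w k)) - f t x (min z (clamp3 z w k))"
  unfolding F_flux_def clamp3_def by (auto simp: max_def min_def)

text \<open>As \<open>k\<close> runs over the reals, the median of \<open>z\<close>,
  \<open>w\<close> and \<open>k\<close> runs over exactly the interval between \<open>z\<close> and
  \<open>w\<close>, and it equals \<open>k\<close> there. The sign factor accounts for increments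
  being taken upwards. Conditions 3 and 4 therefore agree point by point.\<close>

lemma F_flux_nonneg_iff:
  "(\<forall>k. 0 \<le> F_flux f t x z w k \<bullet> n) \<longleftrightarrow>
   (\<forall>k\<in>interval_between z w. 0 \<le> (sgn (z - w) *\<^sub>R (f t x z - f t x k)) \<bullet> n)"
proof safe
  fix k assume *: "\<forall>k. 0 \<le> F_flux f t x z w k \<bullet> n" and k: "k \<in> interval_between z w"
  show "0 \<le> (sgn (z - w) *\<^sub>R (f t x z - f t x k)) \<bullet> n"
  proof (cases z w rule: linorder_cases)
    case less
    then have "z \<le> k" "k \<le> w" using k by (auto simp: interval_between_iff)
    moreover from this have "clamp3 z w k = k" by (simp add: clamp3_def)
    ultimately show ?thesis using *[rule_format, of k] less by (simp add: F_flux_clamp inner_diff_left)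
  next
    case greater
    then have "w \<le> k" "k \<le> z" using k by (auto simp: interval_between_iff)
    moreover from this have "clamp3 z w k = k" by (simp add: clamp3_def)
    ultimately show ?thesis using *[rule_format, of k] greater by (simp add: F_flux_clamp)
  qed simp
next
  fix k assume *: "\<forall>k\<in>interval_between z w. 0 \<le> (sgn (z - w) *\<^sub>R (f t x z - f t x k)) \<bullet> n"
  define c where "c = clamp3 z w k"
  have c: "z \<le> c \<and> c \<le> w \<or> w \<le> c \<and> c \<le> z" by (auto simp: c_def clamp3_def max_def min_def)
  then have **: "0 \<le> (sgn (z - w) *\<^sub>R (f t x z - f t x c)) \<bullet> n"
    using * by (simp add: interval_between_iff)
  consider "z = c" | "z < c" "c \<le> w" | "c < z" "w \<le> c" using c by linarith
  then show "0 \<le> F_flux f t x z w k \<bullet> n"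
    unfolding F_flux_clamp c_def[symmetric] using ** by cases (auto simp: inner_diff_left)
qed

text \<open>
  The entropy expression is the increment of this function from \<open>b\<close> to \<open>a\<close>, so its sign is a matter of
  monotonicity.
\<close>

lemma entropy_aux_derivative:
  fixes q \<phi> \<eta>' :: "real \<Rightarrow> real"
  assumes "(\<phi> has_real_derivative \<phi>' s) (at s)" "(\<eta>' has_real_derivative \<eta>'' s) (at s)"
    and "(q has_real_derivative \<eta>' s * \<phi>' s) (at s)"
  shows "((\<lambda>s. q s + \<eta>' s * (\<phi> a - \<phi> s)) has_real_derivative \<eta>'' s * (\<phi> a - \<phi> s)) (at s)"
  by (rule derivative_eq_intros assms refl)+ (simp add: algebra_simps)

lemma entropy_inequality:
  fixes q \<phi> \<eta>' :: "real \<Rightarrow> real"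
  assumes \<phi>: "\<And>s. (\<phi> has_real_derivative \<phi>' s) (at s)"
    and \<eta>: "\<And>s. (\<eta>' has_real_derivative \<eta>'' s) (at s)" "\<And>s. 0 \<le> \<eta>'' s"
    and q: "\<And>s. (q has_real_derivative \<eta>' s * \<phi>' s) (at s)"
    and sg: "\<And>k. k \<in> interval_between a b \<Longrightarrow> 0 \<le> sgn (a - b) * (\<phi> a - \<phi> k)"
  shows "0 \<le> q a - q b - \<eta>' b * (\<phi> a - \<phi> b)"
proof -
  define G where "G = (\<lambda>s. q s + \<eta>' s * (\<phi> a - \<phi> s))"
  have D: "(G has_real_derivative \<eta>'' s * (\<phi> a - \<phi> s)) (at s)" for s
    unfolding G_def by (rule entropy_aux_derivative[where \<phi>' = \<phi>']) (rule \<phi> \<eta> q)+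
  have "G b \<le> G a"
  proof (cases a b rule: linorder_cases)
    case less
    show ?thesis
    proof (rule DERIV_nonpos_imp_nonincreasing[of a b G])
      fix s assume "a \<le> s" "s \<le> b"
      then have "\<phi> a - \<phi> s \<le> 0" using sg[of s] less by (simp add: interval_between_iff)
      then show "\<exists>y. (G has_real_derivative y) (at s) \<and> y \<le> 0"
        by (intro exI[of _ "\<eta>'' s * (\<phi> a - \<phi> s)"] conjI D mult_nonneg_nonpos \<eta>(2))
    qed (use less in simp)
  next
    case greater
    show ?thesis
    proof (rule DERIV_nonneg_imp_nondecreasing[of b a G])
      fix s assume "b \<le> s" "s \<le> a"
      then have "0 \<le> \<phi> a - \<phi> s" using sg[of s] greater by (simp add: interval_between_iff)
      then show "\<exists>y. (G has_real_derivative y) (at s) \<and> 0 \<le> y"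
        by (intro exI[of _ "\<eta>'' s * (\<phi> a - \<phi> s)"] conjI D mult_nonneg_nonneg \<eta>(2))
    qed (use greater in simp)
  qed simp
  then show ?thesis by (simp add: G_def algebra_simps)
qed

section \<open>Tests concentrated on a small interval\<close>

text \<open>Squaring removes the kink of the positive part and makes the function C^1; for
  \<open>p < r\<close> it is positive exactly on the open interval. Used as second derivative of an
  entropy, it needs this one derivative to make the flux, and \<open>bump_H\<close> as a function of
  \<open>w\<close>, of class C^2.\<close>

definition bump :: "real \<Rightarrow> real \<Rightarrow> real \<Rightarrow> real" where
  "bump p r s = (max 0 ((s - p) * (r - s)))\<^sup>2"

lemma bump_nonneg: "0 \<le> bump p r s"
  by (simp add: bump_def)

lemma bump_pos: "p < s \<Longrightarrow> s < r \<Longrightarrow> 0 < bump p r s"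
  by (simp add: bump_def max_def)

lemma bump_zero:
  assumes "p < r" "s \<notin> {p<..<r}"
  shows "bump p r s = 0"
proof -
  have "(s - p) * (r - s) \<le> 0" using assms by (auto simp: mult_le_0_iff)
  then show ?thesis by (simp add: bump_def max_def)
qed

lemma Ck_on_bump: "Ck_on 1 UNIV (bump p r)"
proof -
  have m: "((\<lambda>y::real. (max 0 y)\<^sup>2) has_real_derivative 2 * max 0 y) (at y)" for y
  proof (cases y "0::real" rule: linorder_cases)
    case less
    have "((\<lambda>y::real. 0) has_real_derivative 0) (at y)" by simp
    then have "((\<lambda>y::real. (max 0 y)\<^sup>2) has_real_derivative 0) (at y)"
      by (rule has_field_derivative_transform_within_open[of _ _ _ "{..<0}"]) (use less in auto)
    then show ?thesis using less by simp
  next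
    case equal
    have "(\<lambda>h. ((max 0 (y + h))\<^sup>2 - (max 0 y)\<^sup>2) / h) \<midarrow>0\<rightarrow> 0"
    proof (rule Lim_null_comparison)
      show "\<forall>\<^sub>F h in at 0. norm (((max 0 (y + h))\<^sup>2 - (max 0 y)\<^sup>2) / h) \<le> \<bar>h\<bar>"
        by (rule always_eventually) (auto simp: equal max_def power2_eq_square)
      show "(\<lambda>h::real. \<bar>h\<bar>) \<midarrow>0\<rightarrow> 0" by (rule tendsto_rabs_zero) (rule tendsto_ident_at)
    qed
    then show ?thesis using equal by (simp add: DERIV_def)
  next
    case greater
    have "((\<lambda>y::real. y\<^sup>2) has_real_derivative 2 * y) (at y)" by (auto intro!: derivative_eq_intros)
    then have "((\<lambda>y::real. (max 0 y)\<^sup>2) has_real_derivative 2 * y) (at y)"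
      by (rule has_field_derivative_transform_within_open[of _ _ _ "{0<..}"]) (use greater in auto)
    then show ?thesis using greater by simp
  qed
  have "(bump p r has_real_derivative 2 * max 0 ((s - p) * (r - s)) * (r + p - 2 * s)) (at s)" for s
  proof -
    have "((\<lambda>s. (s - p) * (r - s)) has_real_derivative (r + p - 2 * s)) (at s)"
      by (auto intro!: derivative_eq_intros)
    from DERIV_chain2[OF m this] show ?thesis unfolding bump_def .
  qed
  then have "Ck_on (Suc 0) UNIV (bump p r)"
    by (rule Ck_on_real_derivative) (auto intro!: continuous_intros)
  then show ?thesis by simp
qed

lemma continuous_on_bump: "continuous_on UNIV (bump p r)"
  using Ck_on_mono[OF Ck_on_bump, of 0] by simp

text \<open>
  Conversely, if \<open>\<phi> a - \<phi>\<close> had the wrong sign somewhere between \<open>a\<close> and \<open>b\<close>, an entropy whose second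
  derivative is a bump concentrated there would violate the entropy inequality.
\<close>

lemma entropy_inequality_converse:
  fixes \<phi> :: "real \<Rightarrow> real" and q \<eta>' :: "real \<Rightarrow> real \<Rightarrow> real \<Rightarrow> real"
  assumes \<phi>: "\<And>s. (\<phi> has_real_derivative \<phi>' s) (at s)"
    and \<eta>: "\<And>p r s. (\<eta>' p r has_real_derivative bump p r s) (at s)"
    and q: "\<And>p r s. (q p r has_real_derivative \<eta>' p r s * \<phi>' s) (at s)"
    and E: "\<And>p r. p \<in> \<rat> \<Longrightarrow> r \<in> \<rat> \<Longrightarrow> 0 \<le> q p r a - q p r b - \<eta>' p r b * (\<phi> a - \<phi> b)"
    and k: "k \<in> interval_between a b"
  shows "0 \<le> sgn (a - b) * (\<phi> a - \<phi> k)"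
proof (rule ccontr)
  assume "\<not> ?thesis"
  then have neg: "sgn (a - b) * (\<phi> a - \<phi> k) < 0" by simp
  have \<phi>c: "continuous_on UNIV \<phi>"
    using \<phi> by (meson DERIV_isCont continuous_at_imp_continuous_on)
  define V where "V = {s. sgn (a - b) * (\<phi> a - \<phi> s) < 0}"
  have "open V" unfolding V_def by (intro open_Collect_less continuous_intros \<phi>c)
  moreover have "k \<in> V" using neg by (simp add: V_def)
  ultimately obtain e where e: "e > 0" "ball k e \<subseteq> V" by (rule openE) blast
  have ab: "a \<noteq> b" using neg by auto
  \<comment> \<open>The part of the ball that lies between \<open>a\<close> and \<open>b\<close>. It
    is a proper interval even when \<open>k\<close> is one of the end points, because
    \<open>a \<noteq> b\<close>.\<close>
  define lo hi where "lo = max (k - e) (min a b)" and "hi = min (k + e) (max a b)"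
  have "lo < hi" using k e(1) ab by (auto simp: lo_def hi_def interval_between_iff min_def max_def)
  then obtain p where p: "p \<in> \<rat>" "lo < p" "p < hi" using Rats_dense_in_real by blast
  then obtain r where r: "r \<in> \<rat>" "p < r" "r < hi" using Rats_dense_in_real by blast
  have V: "s \<in> V" if "p < s" "s < r" for s
  proof -
    have "s \<in> ball k e" using that p r by (auto simp: lo_def hi_def dist_real_def)
    then show ?thesis using e by blast
  qed
  define G where "G = (\<lambda>s. q p r s + \<eta>' p r s * (\<phi> a - \<phi> s))"
  have D: "(G has_real_derivative bump p r s * (\<phi> a - \<phi> s)) (at s)" for s
    unfolding G_def by (rule entropy_aux_derivative[where \<phi>' = \<phi>']) (rule \<phi> \<eta> q)+
  then have Gc: "continuous_on A G" for A
    by (meson DERIV_isCont continuous_at_imp_continuous_on)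
  have const: "(G has_real_derivative 0) (at s)" if "s \<notin> {p<..<r}" for s
    using D[of s] bump_zero[OF r(2) that] by simp
  \<comment> \<open>\<open>G\<close> is constant off the support of the bump, so its increment from
    \<open>b\<close> to \<open>a\<close> is the one across \<open>{p<..<r}\<close>, where it is
    strictly monotone in the forbidden direction.\<close>
  have flat: "G x = G y" if "x \<le> y" "y \<le> p \<or> r \<le> x" for x y
  proof (rule antisym)
    show "G x \<le> G y"
    proof (rule DERIV_nonneg_imp_nondecreasing[OF that(1), of G])
      fix s assume "x \<le> s" "s \<le> y"
      then have "s \<notin> {p<..<r}" using that(2) by auto
      from const[OF this] show "\<exists>D. (G has_real_derivative D) (at s) \<and> 0 \<le> D" by blast
    qed
    show "G y \<le> G x"
    proof (rule DERIV_nonpos_imp_nonincreasing[OF that(1), of G])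
      fix s assume "x \<le> s" "s \<le> y"
      then have "s \<notin> {p<..<r}" using that(2) by auto
      from const[OF this] show "\<exists>D. (G has_real_derivative D) (at s) \<and> D \<le> 0" by blast
    qed
  qed
  have G0: "G a - G b \<ge> 0" using E[OF p(1) r(1)] by (simp add: G_def algebra_simps)
  show False
  proof (cases a b rule: linorder_cases)
    case less
    then have pr: "a \<le> p" "r \<le> b" using p r by (auto simp: lo_def hi_def)
    have "G p < G r"
    proof (rule DERIV_pos_imp_increasing_open[OF r(2) _ Gc])
      fix s assume s: "p < s" "s < r"
      then have "0 < \<phi> a - \<phi> s" using V[OF s] less by (simp add: V_def)
      then show "\<exists>y. (G has_real_derivative y) (at s) \<and> 0 < y"
        by (intro exI[of _ "bump p r s * (\<phi> a - \<phi> s)"] conjI D mult_pos_pos bump_pos[OF s])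
    qed
    then show False using flat[of a p] flat[of r b] pr G0 by simp
  next
    case greater
    then have pr: "b \<le> p" "r \<le> a" using p r by (auto simp: lo_def hi_def)
    have "G r < G p"
    proof (rule DERIV_neg_imp_decreasing_open[OF r(2) _ Gc])
      fix s assume s: "p < s" "s < r"
      then have "\<phi> a - \<phi> s < 0" using V[OF s] greater by (simp add: V_def)
      then show "\<exists>y. (G has_real_derivative y) (at s) \<and> y < 0"
        by (intro exI[of _ "bump p r s * (\<phi> a - \<phi> s)"] conjI D mult_pos_neg bump_pos[OF s])
    qed
    then show False using flat[of b p] flat[of r a] pr G0 by simp
  qed (use ab in simp)
qed

section \<open>Derivatives in the state variable, and convexity\<close>

text \<open>The derivative within the set can be one-sided in \<open>t\<close> and \<open>x\<close>,
  but the fibre in \<open>z\<close> is the whole line. Along it the derivative is two-sided, and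
  \<open>d3\<close> is the value in the direction \<open>(0, 0, 1)\<close>; its continuity up to the
  boundary is then part of \<open>Ck_on\<close>.\<close>

lemma Ck_on_d3:
  fixes h :: "real \<Rightarrow> 'a::euclidean_space \<Rightarrow> real \<Rightarrow> 'b::euclidean_space"
  assumes "Ck_on (Suc k) (I \<times> A \<times> UNIV) (\<lambda>(t, x, z). h t x z)"
  shows "\<And>t x z. t \<in> I \<Longrightarrow> x \<in> A \<Longrightarrow> (h t x has_vector_derivative d3 h t x z) (at z)"
    and "continuous_on (I \<times> A \<times> UNIV) (\<lambda>(t, x, z). d3 h t x z)"
proof -
  obtain D where D: "\<forall>y\<in>I \<times> A \<times> UNIV. ((\<lambda>(t, x, z). h t x z) has_derivative D y) (at y within I \<times> A \<times> UNIV)"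
    "\<forall>v. Ck_on k (I \<times> A \<times> UNIV) (\<lambda>y. D y v)"
    using assms by (subst (asm) Ck_on.simps(2)) blast
  have vd: "(h t x has_vector_derivative D (t, x, z) (0, 0, 1)) (at z)" if "t \<in> I" "x \<in> A" for t x z
  proof -
    have y: "(t, x, z) \<in> I \<times> A \<times> UNIV" for z using that by simp
    have "((\<lambda>s. (t, x, s)) has_derivative (\<lambda>s. (0, 0, s))) (at z within UNIV)"
      by (auto intro!: derivative_eq_intros)
    then have comp: "((\<lambda>s. (case (t, x, s) of (t, x, z) \<Rightarrow> h t x z)) has_derivative (\<lambda>s. D (t, x, z) (0, 0, s))) (at z within UNIV)"
      by (rule has_derivative_in_compose2[of "I \<times> A \<times> UNIV" _ D, rotated -1])
        (use D(1) that in auto)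
    have lin: "linear (D (t, x, z))" using D(1) y[of z] has_derivative_linear by blast
    have eq: "(\<lambda>s. D (t, x, z) (0, 0, s)) = (\<lambda>s. s *\<^sub>R D (t, x, z) (0, 0, 1))"
    proof
      show "D (t, x, z) (0, 0, s) = s *\<^sub>R D (t, x, z) (0, 0, 1)" for s
        using linear_cmul[OF lin, of s "(0, 0, 1)"] by simp
    qed
    show ?thesis using comp unfolding eq by (simp add: has_vector_derivative_def)
  qed
  then have d3: "d3 h t x z = D (t, x, z) (0, 0, 1)" if "t \<in> I" "x \<in> A" for t x z
    unfolding d3_def using that by (intro vector_derivative_at) auto
  show "\<And>t x z. t \<in> I \<Longrightarrow> x \<in> A \<Longrightarrow> (h t x has_vector_derivative d3 h t x z) (at z)"
    using vd d3 by simp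
  have "continuous_on (I \<times> A \<times> UNIV) (\<lambda>y. D y (0, 0, 1))"
    using Ck_on_mono[of k "I \<times> A \<times> UNIV" "\<lambda>y. D y (0, 0, 1)" 0] D(2) by simp
  then show "continuous_on (I \<times> A \<times> UNIV) (\<lambda>(t, x, z). d3 h t x z)"
    by (rule continuous_on_eq) (auto simp: d3)
qed

lemmas C2_d3 = Ck_on_d3[where k = 1, unfolded Suc_1]

text \<open>Adding the tangent inequalities of the convex function at two points shows that its
  derivative is monotone, so the second derivative is nonnegative.\<close>

lemma C2_convex_derivatives:
  fixes \<eta> :: "real \<Rightarrow> real"
  assumes "Ck_on 2 UNIV \<eta>" "convex_on UNIV \<eta>"
  obtains \<eta>'' where "\<forall>s. (deriv \<eta> has_real_derivative \<eta>'' s) (at s)" "\<forall>s. 0 \<le> \<eta>'' s"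
proof -
  have "Ck_on (Suc (Suc 0)) UNIV \<eta>" using assms(1) by (simp only: numeral_2_eq_2)
  then obtain D where D: "\<And>s. (\<eta> has_derivative D s) (at s)" "\<And>v. Ck_on (Suc 0) UNIV (\<lambda>s. D s v)"
    by (subst (asm) Ck_on.simps(2)) blast
  have real: "(h has_real_derivative D 1) (at s)" if "(h has_derivative D) (at s)" for h :: "real \<Rightarrow> real" and D s
  proof -
    have "D = (*) (D 1)"
    proof
      show "D v = D 1 * v" for v
        using linear_cmul[OF has_derivative_linear[OF that], of v 1] by (simp add: mult.commute)
    qed
    then show ?thesis unfolding has_field_derivative_def by (rule has_derivative_eq_rhs[OF that])
  qed
  have D1: "(\<eta> has_real_derivative D s 1) (at s)" for s by (rule real[OF D(1)])
  then have dD: "deriv \<eta> s = D s 1" for s by (rule DERIV_imp_deriv)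
  obtain D2 where D2: "\<And>s. ((\<lambda>s. D s 1) has_derivative D2 s) (at s)"
    using D(2)[of 1] by (subst (asm) Ck_on.simps(2)) blast
  have D21: "((\<lambda>s. D s 1) has_real_derivative D2 s 1) (at s)" for s by (rule real[OF D2])
  have tangent: "D x 1 * (y - x) \<le> \<eta> y - \<eta> x" for x y
    using convex_on_imp_above_tangent[OF assms(2) _ _ _ D1, of x y] by simp
  have "mono_on UNIV (\<lambda>s. D s 1)"
  proof (rule mono_onI)
    fix x y :: real assume "x \<le> y"
    then show "D x 1 \<le> D y 1"
    proof (cases "x = y")
      case False
      with \<open>x \<le> y\<close> have "0 < y - x" by simp
      moreover have "D x 1 * (y - x) \<le> D y 1 * (y - x)"
        using tangent[of x y] tangent[of y x] by (simp add: right_diff_distrib)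
      ultimately show ?thesis by (rule mult_right_le_imp_le[rotated])
    qed simp
  qed
  then have D2_nonneg: "0 \<le> D2 s 1" for s
    using D21 by (rule mono_on_imp_deriv_nonneg) simp
  have d\<eta>: "deriv \<eta> = (\<lambda>s. D s 1)" using dD by (rule ext)
  show ?thesis
    by (rule that[of "\<lambda>s. D2 s 1"]) (unfold d\<eta>, (rule allI D21 D2_nonneg)+)
qed

text \<open>Projection onto \<open>n\<close> reduces the claim to scalars. It serves an entropy pair
  as well as a boundary pair whose second argument is frozen at \<open>b\<close>; in the latter case
  the terms at \<open>b\<close> vanish.\<close>

lemma entropy_flux_inequality:
  fixes f q :: "real \<Rightarrow> 'a::real_inner" and \<eta> :: "real \<Rightarrow> real"
  assumes \<eta>: "Ck_on 2 UNIV \<eta>" "convex_on UNIV \<eta>"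
    and f: "\<And>s. (f has_vector_derivative f' s) (at s)"
    and q: "\<And>s. (q has_vector_derivative deriv \<eta> s *\<^sub>R f' s) (at s)"
    and sg: "\<And>k. k \<in> interval_between a b \<Longrightarrow> 0 \<le> (sgn (a - b) *\<^sub>R (f a - f k)) \<bullet> n"
  shows "0 \<le> (q a - q b - deriv \<eta> b *\<^sub>R (f a - f b)) \<bullet> n"
proof -
  obtain \<eta>'' where \<eta>'': "\<forall>s. (deriv \<eta> has_real_derivative \<eta>'' s) (at s)" "\<forall>s. 0 \<le> \<eta>'' s"
    by (rule C2_convex_derivatives[OF \<eta>])
  have inner: "((\<lambda>s. h s \<bullet> n) has_real_derivative h' \<bullet> n) (at s)"
    if "(h has_vector_derivative h') (at s)" for h h' s
    using bounded_linear.has_vector_derivative[OF bounded_linear_inner_left that]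
    by (simp add: has_real_derivative_iff_has_vector_derivative)
  have "0 \<le> q a \<bullet> n - q b \<bullet> n - deriv \<eta> b * (f a \<bullet> n - f b \<bullet> n)"
  proof (rule entropy_inequality[where \<phi>' = "\<lambda>s. f' s \<bullet> n"])
    show "((\<lambda>s. q s \<bullet> n) has_real_derivative deriv \<eta> s * (f' s \<bullet> n)) (at s)" for s
      using inner[OF q, of s] by simp
    show "0 \<le> sgn (a - b) * (f a \<bullet> n - f k \<bullet> n)" if "k \<in> interval_between a b" for k
      using sg[OF that] by (simp add: inner_diff_left)
  qed (rule inner[OF f] \<eta>''[rule_format])+
  then show ?thesis by (simp add: inner_diff_left)
qed

section \<open>Bump entropies, their boundary versions and their fluxes\<close>

definition bump_entropy' :: "real \<Rightarrow> real \<Rightarrow> real \<Rightarrow> real" where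
  "bump_entropy' p r = prim (bump p r)"

definition bump_entropy :: "real \<Rightarrow> real \<Rightarrow> real \<Rightarrow> real" where
  "bump_entropy p r = prim (bump_entropy' p r)"

text \<open>The primitive from 0 of \<open>bump_entropy'\<close> times \<open>d3 f\<close>, after
  integration by parts; the term at 0 drops out because \<open>bump_entropy'\<close> vanishes there.
  No derivative of \<open>f\<close> is left, so the flux keeps both derivatives of
  \<open>f\<close>.\<close>

definition bump_flux ::
  "(real \<Rightarrow> 'a \<Rightarrow> real \<Rightarrow> 'b::euclidean_space) \<Rightarrow> real \<Rightarrow> real \<Rightarrow> real \<Rightarrow> 'a \<Rightarrow> real \<Rightarrow> 'b" where
  "bump_flux f p r t x z = bump_entropy' p r z *\<^sub>R f t x z - prim (\<lambda>s. bump p r s *\<^sub>R f t x s) z"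

lemma bump_entropy_derivs:
  "(bump_entropy' p r has_real_derivative bump p r s) (at s)"
  "(bump_entropy p r has_real_derivative bump_entropy' p r s) (at s)"
proof -
  show 1: "(bump_entropy' p r has_real_derivative bump p r s) (at s)" for s
    unfolding bump_entropy'_def has_real_derivative_iff_has_vector_derivative
    by (rule prim_has_vector_derivative[OF continuous_on_bump])
  have "continuous_on UNIV (bump_entropy' p r)"
    using 1 by (meson DERIV_isCont continuous_at_imp_continuous_on)
  then show "(bump_entropy p r has_real_derivative bump_entropy' p r s) (at s)"
    unfolding bump_entropy_def has_real_derivative_iff_has_vector_derivative
    by (rule prim_has_vector_derivative)
qed

lemma deriv_bump_entropy: "deriv (bump_entropy p r) s = bump_entropy' p r s"
  by (rule DERIV_imp_deriv[OF bump_entropy_derivs(2)])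

lemma Ck_on_bump_entropy:
  "Ck_on 2 UNIV (bump_entropy' p r)" "Ck_on 3 UNIV (bump_entropy p r)"
proof -
  have "Ck_on (Suc 1) UNIV (bump_entropy' p r)"
    by (rule Ck_on_real_derivative[OF bump_entropy_derivs(1) Ck_on_bump])
  then show 1: "Ck_on 2 UNIV (bump_entropy' p r)" by (simp only: Suc_1)
  have "Ck_on (Suc 2) UNIV (bump_entropy p r)"
    by (rule Ck_on_real_derivative[OF bump_entropy_derivs(2) 1])
  then show "Ck_on 3 UNIV (bump_entropy p r)" by (simp only: eval_nat_numeral)
qed

lemma bump_flux_derivative:
  assumes f: "\<And>s. (f t x has_vector_derivative f' s) (at s)"
  shows "(bump_flux f p r t x has_vector_derivative bump_entropy' p r z *\<^sub>R f' z) (at z)"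
proof -
  have "continuous_on UNIV (f t x)"
    using f by (meson continuous_at_imp_continuous_on has_vector_derivative_continuous)
  then have "continuous_on UNIV (\<lambda>s. bump p r s *\<^sub>R f t x s)"
    by (intro continuous_on_scaleR continuous_on_bump)
  then have "(prim (\<lambda>s. bump p r s *\<^sub>R f t x s) has_vector_derivative bump p r z *\<^sub>R f t x z) (at z)"
    by (rule prim_has_vector_derivative)
  moreover have "((\<lambda>z. bump_entropy' p r z *\<^sub>R f t x z) has_vector_derivative
      bump_entropy' p r z *\<^sub>R f' z + bump p r z *\<^sub>R f t x z) (at z)"
    by (rule has_vector_derivative_scaleR[OF bump_entropy_derivs(1) f])
  ultimately show ?thesis unfolding bump_flux_def
    by (auto dest: has_vector_derivative_diff)
qed

lemma Ck_on_bump_flux: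
  fixes f :: "real \<Rightarrow> 'a::euclidean_space \<Rightarrow> real \<Rightarrow> 'b::euclidean_space"
  assumes A: "compact A" "quasiconvex_set A"
    and f: "Ck_on 2 ({0..T} \<times> A \<times> UNIV) (\<lambda>(t, x, z). f t x z)"
  shows "Ck_on 2 ({0..T} \<times> A \<times> UNIV) (\<lambda>(t, x, z). bump_flux f p r t x z)"
proof -
  define B where "B = {0..T} \<times> A"
  have B: "compact B" "quasiconvex_set B"
    unfolding B_def using A by (auto intro: compact_Times quasiconvex_Times)
  \<comment> \<open>\<open>prim_param_Ck\<close> wants \<open>(t, x)\<close> as one parameter next
    to \<open>z\<close>; \<open>L\<close> and \<open>M\<close> regroup the triple in the two
    directions.\<close>
  define L where "L = (\<lambda>y :: (real \<times> 'a) \<times> real. (fst (fst y), snd (fst y), snd y))"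
  define M where "M = (\<lambda>y :: real \<times> 'a \<times> real. ((fst y, fst (snd y)), snd (snd y)))"
  have L: "bounded_linear L" unfolding L_def
    by (intro bounded_linear_Pair bounded_linear_fst_comp bounded_linear_snd_comp bounded_linear_fst bounded_linear_snd)
  have M: "bounded_linear M" unfolding M_def
    by (intro bounded_linear_Pair bounded_linear_fst_comp bounded_linear_snd_comp bounded_linear_fst bounded_linear_snd)
  have "Ck_on 2 (B \<times> UNIV) (\<lambda>y. (\<lambda>(t, x, z). f t x z) (L y))"
    by (rule Ck_on_comp_linear[OF L _ f]) (auto simp: L_def B_def)
  then have fB: "Ck_on (Suc 1) (B \<times> UNIV) (\<lambda>y. f (fst (fst y)) (snd (fst y)) (snd y))"
    by (simp add: L_def numeral_2_eq_2 case_prod_unfold del: Ck_on.simps)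
  from prim_param_Ck[OF B Ck_on_bump fB, of p r]
  have PB: "Ck_on (Suc 1) (B \<times> UNIV) (\<lambda>(b, z). prim (\<lambda>s. bump p r s *\<^sub>R f (fst b) (snd b) s) z)"
    by (simp del: Ck_on.simps)
  have "M ` ({0..T} \<times> A \<times> UNIV) \<subseteq> B \<times> UNIV" by (auto simp: M_def B_def)
  from Ck_on_comp_linear[OF M this PB]
  have P: "Ck_on 2 ({0..T} \<times> A \<times> UNIV) (\<lambda>(t, x, z). prim (\<lambda>s. bump p r s *\<^sub>R f t x s) z)"
    by (simp add: M_def numeral_2_eq_2 case_prod_unfold del: Ck_on.simps)
  have "Ck_on 2 ({0..T} \<times> A \<times> UNIV) (\<lambda>y. bump_entropy' p r (snd (snd y)))"
    by (rule Ck_on_comp_linear[OF bounded_linear_snd_comp[OF bounded_linear_snd] _ Ck_on_bump_entropy(1)]) simp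
  from Ck_on_diff[OF Ck_on_scaleR[OF this f] P] show ?thesis
    by (simp add: bump_flux_def case_prod_unfold)
qed

lemma entropy_pair_bump:
  assumes \<Omega>: "open \<Omega>" "bounded \<Omega>" "smooth_boundary \<Omega>"
    and f: "Ck_on 2 ({0..T} \<times> closure \<Omega> \<times> UNIV) (\<lambda>(t, x, z). f t x z)"
  shows "entropy_pair T \<Omega> f (bump_entropy p r) (bump_flux f p r)"
  unfolding entropy_pair_def
proof (intro conjI ballI allI)
  show "Ck_on 2 UNIV (bump_entropy p r)" by (rule Ck_on_mono[OF Ck_on_bump_entropy(2)]) simp
  show "Ck_on 2 ({0..T} \<times> closure \<Omega> \<times> UNIV) (\<lambda>(t, x, z). bump_flux f p r t x z)"
    using \<Omega> f by (intro Ck_on_bump_flux quasiconvex_closure_smooth) (simp_all add: compact_closure)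
  show "convex_on UNIV (bump_entropy p r)"
    by (rule f''_ge0_imp_convex[OF _ bump_entropy_derivs(2) bump_entropy_derivs(1) bump_nonneg]) simp
  fix t x z assume tx: "t \<in> {0..T}" "x \<in> \<Omega>"
  then have "x \<in> closure \<Omega>" using closure_subset by blast
  then have "(f t x has_vector_derivative d3 f t x s) (at s)" for s
    by (rule C2_d3(1)[OF f tx(1)])
  from bump_flux_derivative[of f t x "d3 f t x", OF this] have
    "(bump_flux f p r t x has_vector_derivative bump_entropy' p r z *\<^sub>R d3 f t x z) (at z)" .
  then show "d3 (bump_flux f p r) t x z = deriv (bump_entropy p r) z *\<^sub>R d3 f t x z"
    unfolding d3_def[of "bump_flux f p r"] deriv_bump_entropy by (intro vector_derivative_at) simp
qed

text \<open>The Bregman divergence of \<open>bump_entropy\<close>, which vanishes on the diagonal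
  together with its \<open>z\<close>-derivative. Its second derivatives in \<open>w\<close> involve
  those of \<open>bump_entropy'\<close>, hence the interest in an entropy of class C^3.\<close>

definition bump_H :: "real \<Rightarrow> real \<Rightarrow> real \<Rightarrow> real \<Rightarrow> real" where
  "bump_H p r z w = bump_entropy p r z - bump_entropy p r w - bump_entropy' p r w * (z - w)"

text \<open>At the trace and the boundary datum this is the bracket of condition 5 for the bump
  entropy, so conditions 1 and 5 deliver the same inequality.\<close>

definition bump_Q ::
  "(real \<Rightarrow> 'a \<Rightarrow> real \<Rightarrow> 'b::euclidean_space) \<Rightarrow> real \<Rightarrow> real \<Rightarrow> real \<Rightarrow> 'a \<Rightarrow> real \<Rightarrow> real \<Rightarrow> 'b" where
  "bump_Q f p r t x z w = bump_flux f p r t x z - bump_flux f p r t x w - bump_entropy' p r w *\<^sub>R (f t x z - f t x w)"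

lemma boundary_entropy_pair_bump:
  assumes \<Omega>: "open \<Omega>" "bounded \<Omega>" "smooth_boundary \<Omega>"
    and f: "Ck_on 2 ({0..T} \<times> closure \<Omega> \<times> UNIV) (\<lambda>(t, x, z). f t x z)"
  shows "boundary_entropy_pair T \<Omega> f (bump_H p r) (bump_Q f p r)"
proof -
  have e2: "Ck_on 2 UNIV (bump_entropy p r)" by (rule Ck_on_mono[OF Ck_on_bump_entropy(2)]) simp
  have H: "Ck_on 2 UNIV (\<lambda>(z, w). bump_H p r z w)"
  proof -
    have "Ck_on 2 UNIV (\<lambda>y :: real \<times> real. bump_entropy p r (fst y) - bump_entropy p r (snd y)
        - bump_entropy' p r (snd y) *\<^sub>R (fst y - snd y))"
      by (intro Ck_on_diff Ck_on_scaleR Ck_on_linear bounded_linear_fst bounded_linear_snd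
          Ck_on_comp_linear[OF bounded_linear_fst _ e2] Ck_on_comp_linear[OF bounded_linear_snd _ e2]
          Ck_on_comp_linear[OF bounded_linear_snd _ Ck_on_bump_entropy(1)]) auto
    then show ?thesis by (simp add: bump_H_def case_prod_unfold)
  qed
  let ?S = "{0..T} \<times> closure \<Omega> \<times> (UNIV :: (real \<times> real) set)"
  have bl: "bounded_linear (\<lambda>y :: real \<times> (real^'n) \<times> real \<times> real. (fst y, fst (snd y), fst (snd (snd y))))"
    "bounded_linear (\<lambda>y :: real \<times> (real^'n) \<times> real \<times> real. (fst y, fst (snd y), snd (snd (snd y))))"
    "bounded_linear (\<lambda>y :: real \<times> (real^'n) \<times> real \<times> real. snd (snd (snd y)))"
    by (intro bounded_linear_Pair bounded_linear_fst_comp bounded_linear_snd_comp bounded_linear_fst bounded_linear_snd)+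
  have Q: "Ck_on 2 ?S (\<lambda>(t, x, z, w). bump_Q f p r t x z w)"
  proof -
    have q: "Ck_on 2 ({0..T} \<times> closure \<Omega> \<times> UNIV) (\<lambda>(t, x, z). bump_flux f p r t x z)"
      using \<Omega> f by (intro Ck_on_bump_flux quasiconvex_closure_smooth) (simp_all add: compact_closure)
    have sub: "(\<lambda>y. (fst y, fst (snd y), fst (snd (snd y)))) ` ?S \<subseteq> {0..T} \<times> closure \<Omega> \<times> UNIV"
      "(\<lambda>y. (fst y, fst (snd y), snd (snd (snd y)))) ` ?S \<subseteq> {0..T} \<times> closure \<Omega> \<times> UNIV" by auto
    from Ck_on_diff[OF Ck_on_diff[OF Ck_on_comp_linear[OF bl(1) sub(1) q] Ck_on_comp_linear[OF bl(2) sub(2) q]]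
       Ck_on_scaleR[OF Ck_on_comp_linear[OF bl(3) subset_UNIV Ck_on_bump_entropy(1)]
         Ck_on_diff[OF Ck_on_comp_linear[OF bl(1) sub(1) f] Ck_on_comp_linear[OF bl(2) sub(2) f]]]]
    show ?thesis by (simp add: bump_Q_def case_prod_unfold)
  qed
  have Hd: "((\<lambda>s. bump_H p r s w) has_real_derivative bump_entropy' p r z - bump_entropy' p r w) (at z)" for z w
    unfolding bump_H_def by (rule derivative_eq_intros bump_entropy_derivs refl)+ simp
  have Hd2: "((\<lambda>z. bump_entropy' p r z - bump_entropy' p r w) has_real_derivative bump p r z) (at z)" for z w
    by (rule derivative_eq_intros bump_entropy_derivs refl)+ simp
  have Qd: "d3 (\<lambda>t x z. bump_Q f p r t x z w) t x z = (bump_entropy' p r z - bump_entropy' p r w) *\<^sub>R d3 f t x z"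
    if "t \<in> {0..T}" "x \<in> closure \<Omega>" for t x z w
  proof -
    have fd: "(f t x has_vector_derivative d3 f t x s) (at s)" for s
      by (rule C2_d3(1)[OF f that])
    have "((\<lambda>z. bump_Q f p r t x z w) has_vector_derivative
        bump_entropy' p r z *\<^sub>R d3 f t x z - bump_entropy' p r w *\<^sub>R d3 f t x z) (at z)"
      unfolding bump_Q_def
      by (rule derivative_eq_intros bump_flux_derivative[of f t x "d3 f t x", OF fd] fd refl)+ simp
    then show ?thesis unfolding d3_def[of "\<lambda>t x z. bump_Q f p r t x z w"]
      by (simp add: vector_derivative_at scaleR_diff_left)
  qed
  show ?thesis unfolding boundary_entropy_pair_def
  proof (intro conjI ballI allI H Q)
    show "convex_on UNIV (\<lambda>z. bump_H p r z w)" for w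
      by (rule f''_ge0_imp_convex[OF _ Hd Hd2 bump_nonneg]) simp
  qed (use Qd Hd[THEN DERIV_imp_deriv] in \<open>auto simp: bump_H_def bump_Q_def\<close>)
qed

section \<open>Essential limits and traces\<close>

text \<open>A null set contains no interval \<open>{0<..<e}\<close>, so its complement accumulates
  at 0. This is what makes limits along such a complement unique.\<close>

lemma ess_lim_nontrivial:
  assumes "negligible Z" shows "at (0::real) within ({0<..} - Z) \<noteq> bot"
proof -
  have "\<exists>x\<in>{0<..} - Z. x \<noteq> 0 \<and> dist x 0 < e" if "e > 0" for e :: real
  proof -
    have "\<not> negligible {0<..<e}"
      using negligible_interval(2)[of 0 e] that by simp
    then have "\<not> {0<..<e} \<subseteq> Z" using assms negligible_subset by blast
    then show ?thesis by (force simp: dist_real_def)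
  qed
  then show ?thesis by (simp add: trivial_limit_within islimpt_approachable)
qed

text \<open>Two essential limits can be compared off the union of their exceptional sets, so they
  coincide. Once one limit is known, the existential quantifier in conditions 1 and 2 reduces to the
  sign of that value.\<close>

lemma ess_lim_nonneg_iff:
  fixes L :: real
  assumes L: "ess_lim g L" shows "(\<exists>L'\<ge>0. ess_lim g L') \<longleftrightarrow> 0 \<le> L"
proof
  assume "\<exists>L'\<ge>0. ess_lim g L'"
  then obtain L' where L': "0 \<le> L'" "ess_lim g L'" by blast
  obtain Z Z' where Z: "negligible Z" "(g \<longlongrightarrow> L) (at 0 within ({0<..} - Z))"
    "negligible Z'" "(g \<longlongrightarrow> L') (at 0 within ({0<..} - Z'))"
    using L L'(2) unfolding ess_lim_def by blast
  have "negligible (Z \<union> Z')" using Z by simp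
  then have "at (0::real) within ({0<..} - (Z \<union> Z')) \<noteq> bot" by (rule ess_lim_nontrivial)
  moreover have "(g \<longlongrightarrow> L) (at 0 within ({0<..} - (Z \<union> Z')))" "(g \<longlongrightarrow> L') (at 0 within ({0<..} - (Z \<union> Z')))"
    by (rule tendsto_within_subset[OF Z(2)], blast) (rule tendsto_within_subset[OF Z(4)], blast)
  ultimately have "L = L'" by (rule tendsto_unique)
  then show "0 \<le> L" using L' by simp
qed (use L in blast)

text \<open>Convergence in mean gives almost everywhere convergence only along a subsequence; this
  criterion carries the limits so obtained back to the full sequence.\<close>

lemma LIMSEQ_subsubseq:
  fixes f :: "nat \<Rightarrow> 'a::topological_space"
  assumes "\<And>r :: nat \<Rightarrow> nat. strict_mono r \<Longrightarrow> \<exists>s :: nat \<Rightarrow> nat. strict_mono s \<and> (\<lambda>n. f (r (s n))) \<longlonglongrightarrow> L"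
  shows "f \<longlonglongrightarrow> L"
proof (rule ccontr)
  assume "\<not> f \<longlonglongrightarrow> L"
  then obtain S where S: "open S" "L \<in> S" "\<not> (\<forall>\<^sub>F n in sequentially. f n \<in> S)"
    unfolding tendsto_def by blast
  then have inf: "infinite {n. f n \<notin> S}"
    by (simp add: not_eventually cofinite_eq_sequentially[symmetric] frequently_cofinite)
  define r where "r = enumerate {n. f n \<notin> S}"
  have "strict_mono r" unfolding r_def by (rule strict_mono_enumerate[OF inf])
  from assms[OF this] obtain s where s: "(\<lambda>n. f (r (s n))) \<longlonglongrightarrow> L" by blast
  have "f (r (s n)) \<notin> S" for n using enumerate_in_set[OF inf, of "s n"] by (simp add: r_def)
  then show False using topological_tendstoD[OF s S(1,2)] by simp
qed

section \<open>Passage to the trace in boundary integrals\<close>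

lemma fst_snd_lateral_measurable:
  fixes \<Omega> :: "'a::euclidean_space set"
  shows "fst \<in> borel_measurable (lateral_measure T \<Omega>)" "snd \<in> borel_measurable (lateral_measure T \<Omega>)"
proof -
  have [measurable]: "(\<lambda>\<xi>. \<xi>) \<in> borel_measurable (surface_measure \<Omega>)"
    by (rule ident_surface_measurable)
  have [measurable]: "(\<lambda>t. t) \<in> borel_measurable (restrict_space lborel {0..T})"
    by (auto intro: measurable_restrict_space1)
  have "(\<lambda>x. fst x) \<in> borel_measurable (restrict_space lborel {0..T} \<Otimes>\<^sub>M surface_measure \<Omega>)"
    "(\<lambda>x. snd x) \<in> borel_measurable (restrict_space lborel {0..T} \<Otimes>\<^sub>M surface_measure \<Omega>)" by measurable
  then show "fst \<in> borel_measurable (lateral_measure T \<Omega>)" "snd \<in> borel_measurable (lateral_measure T \<Omega>)"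
    unfolding lateral_measure_def by (intro measurable_completion; simp)+
qed

lemma caratheodory_measurable:
  fixes \<Omega> :: "'a::euclidean_space set" and G :: "real \<times> 'a \<times> real \<times> real \<Rightarrow> real"
  assumes G: "continuous_on ({0..T} \<times> frontier \<Omega> \<times> UNIV) G"
    and ab: "a \<in> borel_measurable (lateral_measure T \<Omega>)" "b \<in> borel_measurable (lateral_measure T \<Omega>)"
  shows "(\<lambda>x. G (fst x, snd x, a x, b x)) \<in> borel_measurable (lateral_measure T \<Omega>)"
proof -
  note [measurable] = fst_snd_lateral_measurable[of T \<Omega>] ab
  have "(\<lambda>x. (fst x, snd x, a x, b x)) \<in> borel_measurable (lateral_measure T \<Omega>)" by measurable
  then have "(\<lambda>x. (fst x, snd x, a x, b x)) \<in> lateral_measure T \<Omega> \<rightarrow>\<^sub>M restrict_space borel ({0..T} \<times> frontier \<Omega> \<times> UNIV)"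
    by (intro measurable_restrict_space2) (auto simp: space_lateral_measure)
  from measurable_compose[OF this borel_measurable_continuous_on_restrict[OF G]] show ?thesis .
qed

text \<open>The test function is the negative part of \<open>h\<close> itself, admissible because
  \<open>h\<close> is bounded and the measure finite; it turns the integrand into minus its
  square.\<close>

lemma AE_nonneg_of_tests:
  fixes h :: "'a \<Rightarrow> real"
  assumes M: "finite_measure M" and h: "h \<in> borel_measurable M" "AE x in M. \<bar>h x\<bar> \<le> C"
    and test: "\<And>\<beta>. L1_nonneg M \<beta> \<Longrightarrow> 0 \<le> (\<integral>x. h x * \<beta> x \<partial>M)"
  shows "AE x in M. 0 \<le> h x"
proof -
  interpret finite_measure M by (rule M)
  note [measurable] = h(1)
  define \<beta> where "\<beta> = (\<lambda>x. max 0 (- h x))"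
  have \<beta>b: "AE x in M. norm (\<beta> x) \<le> C" using h(2) by eventually_elim (auto simp: \<beta>_def)
  have [measurable]: "\<beta> \<in> borel_measurable M" unfolding \<beta>_def by measurable
  have "integrable M \<beta>" by (rule integrable_const_bound[OF \<beta>b]) measurable
  then have "L1_nonneg M \<beta>" by (simp add: L1_nonneg_def \<beta>_def)
  then have "0 \<le> (\<integral>x. h x * \<beta> x \<partial>M)" by (rule test)
  also have "(\<integral>x. h x * \<beta> x \<partial>M) = (\<integral>x. - (\<beta> x)\<^sup>2 \<partial>M)"
    by (rule Bochner_Integration.integral_cong) (auto simp: \<beta>_def max_def power2_eq_square)
  finally have le: "(\<integral>x. (\<beta> x)\<^sup>2 \<partial>M) \<le> 0" by simp
  have "AE x in M. norm ((\<beta> x)\<^sup>2) \<le> C\<^sup>2"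
    using \<beta>b
  proof eventually_elim
    case (elim x)
    then show ?case using power_mono[of "\<bar>\<beta> x\<bar>" C 2] by simp
  qed
  then have int: "integrable M (\<lambda>x. (\<beta> x)\<^sup>2)" by (rule integrable_const_bound) measurable
  have "(\<integral>x. (\<beta> x)\<^sup>2 \<partial>M) = 0" using le by (simp add: antisym)
  then have "AE x in M. (\<beta> x)\<^sup>2 = 0" using integral_nonneg_eq_0_iff_AE[OF int] by simp
  then show ?thesis by eventually_elim (auto simp: \<beta>_def max_def split: if_splits)
qed

lemma bounded_caratheodory:
  fixes \<Omega> :: "'a::euclidean_space set" and G :: "real \<times> 'a \<times> real \<times> real \<Rightarrow> real"
  assumes G: "continuous_on ({0..T} \<times> frontier \<Omega> \<times> UNIV) G" and \<Omega>: "bounded \<Omega>"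
  shows "\<exists>M. \<forall>x\<in>{0..T} \<times> frontier \<Omega>. \<forall>a b. \<bar>a\<bar> \<le> C \<longrightarrow> \<bar>b\<bar> \<le> C \<longrightarrow> \<bar>G (fst x, snd x, a, b)\<bar> \<le> M"
proof -
  have "compact ({0..T} \<times> frontier \<Omega> \<times> ({-C..C} \<times> {-C..C}))"
    using \<Omega> by (intro compact_Times) (auto simp: compact_frontier_bounded)
  then have "compact (G ` ({0..T} \<times> frontier \<Omega> \<times> ({-C..C} \<times> {-C..C})))"
    by (intro compact_continuous_image continuous_on_subset[OF G]) auto
  then obtain M where "\<forall>y\<in>G ` ({0..T} \<times> frontier \<Omega> \<times> ({-C..C} \<times> {-C..C})). norm y \<le> M"
    using compact_imp_bounded bounded_iff by blast
  then show ?thesis by (intro exI[of _ M]) (auto simp: abs_le_iff)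
qed

text \<open>\<open>G\<close> stands for both integrands, \<open>Q\<close> and \<open>F_flux\<close>
  in the normal direction. Continuity in all four variables provides the pointwise limit, and on
  bounded values also the dominating constant.\<close>

lemma ess_lim_trace:
  fixes \<Omega> :: "'a::euclidean_space set" and G :: "real \<times> 'a \<times> real \<times> real \<Rightarrow> real"
  assumes \<Omega>: "open \<Omega>" "bounded \<Omega>" "smooth_boundary \<Omega>"
    and ub: "L_infinity (lateral_measure T \<Omega>) (\<lambda>(t, \<xi>). u\<^sub>b t \<xi>)"
    and u: "L_infinity (lebesgue_on ({0..T} \<times> \<Omega>)) (\<lambda>(t, x). u t x)"
    and tr: "has_trace T \<Omega> u v"
    and G: "continuous_on ({0..T} \<times> frontier \<Omega> \<times> UNIV) G"
    and \<beta>: "L1_nonneg (lateral_measure T \<Omega>) (\<lambda>(t, \<xi>). \<beta> t \<xi>)"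
  shows "ess_lim (\<lambda>\<rho>. \<integral>(t, \<xi>). G (t, \<xi>, u t (\<xi> - \<rho> *\<^sub>R exterior_normal \<Omega> \<xi>), u\<^sub>b t \<xi>) * \<beta> t \<xi> \<partial>lateral_measure T \<Omega>)
    (\<integral>(t, \<xi>). G (t, \<xi>, v t \<xi>, u\<^sub>b t \<xi>) * \<beta> t \<xi> \<partial>lateral_measure T \<Omega>)"
proof -
  define \<mu> where "\<mu> = lateral_measure T \<Omega>"
  interpret finite_measure \<mu> unfolding \<mu>_def by (rule finite_lateral_measure[OF \<Omega>])
  define U where "U = (\<lambda>\<rho> x. u (fst x) (snd x - \<rho> *\<^sub>R exterior_normal \<Omega> (snd x)))"
  define V where "V = (\<lambda>x. v (fst x) (snd x))"
  define B where "B = (\<lambda>x. u\<^sub>b (fst x) (snd x))"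
  define b where "b = (\<lambda>x. \<beta> (fst x) (snd x))"
  obtain N C1 \<rho>\<^sub>0 where N: "\<rho>\<^sub>0 > 0" "negligible N"
    "\<forall>\<rho>\<in>{0<..<\<rho>\<^sub>0} - N. (\<lambda>(t, \<xi>). u t (\<xi> - \<rho> *\<^sub>R exterior_normal \<Omega> \<xi>)) \<in> borel_measurable (lateral_measure T \<Omega>) \<and>
    (AE (t, \<xi>) in lateral_measure T \<Omega>. \<bar>u t (\<xi> - \<rho> *\<^sub>R exterior_normal \<Omega> \<xi>)\<bar> \<le> C1)"
    using normal_translates_measurable[OF \<Omega> u] by blast
  obtain C2 where V: "V \<in> borel_measurable \<mu>" "AE x in \<mu>. \<bar>V x\<bar> \<le> C2"
    using tr unfolding has_trace_def L_infinity_def V_def \<mu>_def by (auto simp: case_prod_unfold)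
  obtain C3 where B: "B \<in> borel_measurable \<mu>" "AE x in \<mu>. \<bar>B x\<bar> \<le> C3"
    using ub unfolding L_infinity_def B_def \<mu>_def by (auto simp: case_prod_unfold)
  obtain Z where Z: "negligible Z"
    "((\<lambda>r. \<integral>\<^sup>+x. ennreal \<bar>U r x - V x\<bar> \<partial>\<mu>) \<longlongrightarrow> 0) (at 0 within ({0<..} - Z))"
    using tr unfolding has_trace_def ess_lim_def U_def V_def \<mu>_def by (auto simp: case_prod_unfold)
  have bint: "integrable \<mu> b" using \<beta> by (simp add: L1_nonneg_def b_def \<mu>_def case_prod_unfold)
  define C where "C = max C1 (max C2 C3)"
  obtain M where M: "\<forall>x\<in>{0..T} \<times> frontier \<Omega>. \<forall>a b. \<bar>a\<bar> \<le> C \<longrightarrow> \<bar>b\<bar> \<le> C \<longrightarrow> \<bar>G (fst x, snd x, a, b)\<bar> \<le> M"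
    using bounded_caratheodory[OF G \<Omega>(2)] by blast
  have good: "U \<rho> \<in> borel_measurable \<mu>" "AE x in \<mu>. \<bar>U \<rho> x\<bar> \<le> C1" if "\<rho> \<in> {0<..<\<rho>\<^sub>0} - N" for \<rho>
    using N(3) that unfolding U_def \<mu>_def by (simp_all add: case_prod_unfold)
  have sp: "x \<in> {0..T} \<times> frontier \<Omega>" if "x \<in> space \<mu>" for x
    using that by (simp add: \<mu>_def space_lateral_measure)
  define I where "I = (\<lambda>a :: real \<times> 'a \<Rightarrow> real. \<integral>x. G (fst x, snd x, a x, B x) * b x \<partial>\<mu>)"
  have seq: "(\<lambda>n. I (U (X n))) \<longlonglongrightarrow> I V" if X: "\<And>n. X n \<in> {0<..} - (N \<union> Z)" "X \<longlonglongrightarrow> 0" for X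
  proof (rule LIMSEQ_subsubseq)
    fix r :: "nat \<Rightarrow> nat" assume r: "strict_mono r"
    have "\<forall>\<^sub>F n in sequentially. X n < \<rho>\<^sub>0" using order_tendstoD(2)[OF X(2) N(1)] .
    then obtain k where k: "\<And>n. n \<ge> k \<Longrightarrow> X n < \<rho>\<^sub>0" by (auto simp: eventually_sequentially)
    \<comment> \<open>Discarding the first \<open>k\<close> terms puts all radii below
      \<open>\<rho>\<^sub>0\<close>, where the translates are measurable and bounded; the shift
      reappears in the subsequence \<open>s n + k\<close> returned at the end.\<close>
    define Y where "Y = (\<lambda>n. X (r (n + k)))"
    have Yg: "Y n \<in> {0<..<\<rho>\<^sub>0} - N" for n
      using X(1)[of "r (n + k)"] k[of "r (n + k)"] seq_suble[OF r, of "n + k"] by (auto simp: Y_def)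
    have YS: "strict_mono (\<lambda>n. r (n + k))" using r by (auto simp: strict_mono_def)
    have "(X \<circ> (\<lambda>n. r (n + k))) \<longlonglongrightarrow> 0" by (rule LIMSEQ_subseq_LIMSEQ[OF X(2) YS])
    then have Y0: "Y \<longlonglongrightarrow> 0" by (simp add: Y_def o_def)
    have "Y n \<in> {0<..} - Z \<and> Y n \<noteq> 0" for n using X(1)[of "r (n + k)"] by (auto simp: Y_def)
    then have "filterlim Y (at 0 within ({0<..} - Z)) sequentially"
      unfolding filterlim_at using Y0 by (simp add: always_eventually)
    then have nn: "(\<lambda>n. \<integral>\<^sup>+x. ennreal \<bar>U (Y n) x - V x\<bar> \<partial>\<mu>) \<longlonglongrightarrow> 0"
      by (rule filterlim_compose[OF Z(2)])
    have Dm: "(\<lambda>x. U (Y n) x - V x) \<in> borel_measurable \<mu>" for n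
      using good(1)[OF Yg[of n]] V(1) by simp
    have "AE x in \<mu>. norm (U (Y n) x - V x) \<le> C1 + C2" for n
      using good(2)[OF Yg[of n]] V(2) by eventually_elim simp
    then have Dint: "integrable \<mu> (\<lambda>x. U (Y n) x - V x)" for n
      by (rule integrable_const_bound[OF _ Dm])
    \<comment> \<open>The trace is defined by a nonnegative integral. The differences are bounded on
      a finite measure space, hence integrable, so that integral can be read as an L^1 norm.\<close>
    have "(\<lambda>n. enn2real (\<integral>\<^sup>+x. ennreal \<bar>U (Y n) x - V x\<bar> \<partial>\<mu>)) \<longlonglongrightarrow> 0"
      by (rule tendsto_enn2real) (use nn in simp_all)
    moreover have "enn2real (\<integral>\<^sup>+x. ennreal \<bar>U (Y n) x - V x\<bar> \<partial>\<mu>) = (\<integral>x. norm (U (Y n) x - V x) \<partial>\<mu>)" for n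
      by (subst integral_eq_nn_integral) (use Dm in auto)
    ultimately have "(\<lambda>n. \<integral>x. norm (U (Y n) x - V x) \<partial>\<mu>) \<longlonglongrightarrow> 0" by simp
    from tendsto_L1_AE_subseq[OF Dint this] obtain s where s: "strict_mono s"
      "AE x in \<mu>. (\<lambda>n. U (Y (s n)) x - V x) \<longlonglongrightarrow> 0" by blast
    have lim: "(\<lambda>n. I (U (Y (s n)))) \<longlonglongrightarrow> I V"
      unfolding I_def
    proof (rule integral_dominated_convergence[where w = "\<lambda>x. M * \<bar>b x\<bar>"])
      show "(\<lambda>x. G (fst x, snd x, V x, B x) * b x) \<in> borel_measurable \<mu>"
        using caratheodory_measurable[OF G, of V B] V(1) B(1) bint by (simp add: \<mu>_def)
      show "(\<lambda>x. G (fst x, snd x, U (Y (s n)) x, B x) * b x) \<in> borel_measurable \<mu>" for n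
        using caratheodory_measurable[OF G, of "U (Y (s n))" B] good(1)[OF Yg] B(1) bint by (simp add: \<mu>_def)
      show "integrable \<mu> (\<lambda>x. M * \<bar>b x\<bar>)" using bint by simp
      show "AE x in \<mu>. (\<lambda>n. G (fst x, snd x, U (Y (s n)) x, B x) * b x) \<longlonglongrightarrow> G (fst x, snd x, V x, B x) * b x"
        using s(2) AE_space
      proof eventually_elim
        case (elim x)
        have "(\<lambda>n. (U (Y (s n)) x - V x) + V x) \<longlonglongrightarrow> 0 + V x"
          by (intro tendsto_add elim(1) tendsto_const)
        then have "(\<lambda>n. (fst x, snd x, U (Y (s n)) x, B x)) \<longlonglongrightarrow> (fst x, snd x, V x, B x)"
          by (intro tendsto_Pair tendsto_const) simp
        then have "(\<lambda>n. G (fst x, snd x, U (Y (s n)) x, B x)) \<longlonglongrightarrow> G (fst x, snd x, V x, B x)"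
          using sp[OF elim(2)] by (intro continuous_on_tendsto_compose[OF G]) (auto simp: mem_Times_iff)
        then show ?case by (intro tendsto_mult tendsto_const)
      qed
      show "AE x in \<mu>. norm (G (fst x, snd x, U (Y (s n)) x, B x) * b x) \<le> M * \<bar>b x\<bar>" for n
        using good(2)[OF Yg[of "s n"]] B(2) AE_space
      proof eventually_elim
        case (elim x)
        then have "\<bar>G (fst x, snd x, U (Y (s n)) x, B x)\<bar> \<le> M"
          using bspec[OF M sp[OF elim(3)]] by (simp add: C_def)
        then show ?case by (simp add: abs_mult mult_right_mono)
      qed
    qed
    show "\<exists>s. strict_mono s \<and> (\<lambda>n. I (U (X (r (s n))))) \<longlonglongrightarrow> I V"
      using lim s(1) by (intro exI[of _ "\<lambda>n. s n + k"]) (simp add: Y_def strict_mono_def)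
  qed
  have "((\<lambda>\<rho>. I (U \<rho>)) \<longlongrightarrow> I V) (at 0 within ({0<..} - (N \<union> Z)))"
    unfolding tendsto_at_iff_sequentially using seq by (auto simp: o_def)
  moreover have "negligible (N \<union> Z)" using N(2) Z(1) by simp
  ultimately have "ess_lim (\<lambda>\<rho>. I (U \<rho>)) (I V)" unfolding ess_lim_def by blast
  then show ?thesis by (simp add: I_def U_def V_def B_def b_def \<mu>_def case_prod_unfold)
qed

lemma trace_test_iff:
  fixes \<Omega> :: "'a::euclidean_space set" and G :: "real \<times> 'a \<times> real \<times> real \<Rightarrow> real"
  assumes \<Omega>: "open \<Omega>" "bounded \<Omega>" "smooth_boundary \<Omega>"
    and ub: "L_infinity (lateral_measure T \<Omega>) (\<lambda>(t, \<xi>). u\<^sub>b t \<xi>)"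
    and u: "L_infinity (lebesgue_on ({0..T} \<times> \<Omega>)) (\<lambda>(t, x). u t x)"
    and tr: "has_trace T \<Omega> u v"
    and G: "continuous_on ({0..T} \<times> frontier \<Omega> \<times> UNIV) G"
  shows "(\<forall>\<beta>. L1_nonneg (lateral_measure T \<Omega>) (\<lambda>(t, \<xi>). \<beta> t \<xi>) \<longrightarrow>
      (\<exists>L\<ge>0. ess_lim (\<lambda>\<rho>. \<integral>(t, \<xi>). G (t, \<xi>, u t (\<xi> - \<rho> *\<^sub>R exterior_normal \<Omega> \<xi>), u\<^sub>b t \<xi>) * \<beta> t \<xi> \<partial>lateral_measure T \<Omega>) L))
    \<longleftrightarrow> (AE (t, \<xi>) in lateral_measure T \<Omega>. 0 \<le> G (t, \<xi>, v t \<xi>, u\<^sub>b t \<xi>))" (is "?L \<longleftrightarrow> ?R")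
proof -
  define \<mu> where "\<mu> = lateral_measure T \<Omega>"
  define h where "h = (\<lambda>x. G (fst x, snd x, v (fst x) (snd x), u\<^sub>b (fst x) (snd x)))"
  have iff: "?L \<longleftrightarrow> (\<forall>\<beta>. L1_nonneg \<mu> (\<lambda>(t, \<xi>). \<beta> t \<xi>) \<longrightarrow> 0 \<le> (\<integral>(t, \<xi>). G (t, \<xi>, v t \<xi>, u\<^sub>b t \<xi>) * \<beta> t \<xi> \<partial>\<mu>))"
    using ess_lim_nonneg_iff[OF ess_lim_trace[OF assms]] unfolding \<mu>_def by simp
  obtain C2 where V: "(\<lambda>x. v (fst x) (snd x)) \<in> borel_measurable \<mu>" "AE x in \<mu>. \<bar>v (fst x) (snd x)\<bar> \<le> C2"
    using tr unfolding has_trace_def L_infinity_def \<mu>_def by (auto simp: case_prod_unfold)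
  obtain C3 where B: "(\<lambda>x. u\<^sub>b (fst x) (snd x)) \<in> borel_measurable \<mu>" "AE x in \<mu>. \<bar>u\<^sub>b (fst x) (snd x)\<bar> \<le> C3"
    using ub unfolding L_infinity_def \<mu>_def by (auto simp: case_prod_unfold)
  have hm: "h \<in> borel_measurable \<mu>"
    using caratheodory_measurable[OF G] V(1) B(1) unfolding h_def \<mu>_def by blast
  obtain M where M: "\<forall>x\<in>{0..T} \<times> frontier \<Omega>. \<forall>a b. \<bar>a\<bar> \<le> max C2 C3 \<longrightarrow> \<bar>b\<bar> \<le> max C2 C3 \<longrightarrow> \<bar>G (fst x, snd x, a, b)\<bar> \<le> M"
    using bounded_caratheodory[OF G \<Omega>(2)] by blast
  have hb: "AE x in \<mu>. \<bar>h x\<bar> \<le> M"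
    using V(2) B(2) AE_space
  proof eventually_elim
    case (elim x)
    then have "x \<in> {0..T} \<times> frontier \<Omega>" by (simp add: \<mu>_def space_lateral_measure)
    with M have "\<forall>a b. \<bar>a\<bar> \<le> max C2 C3 \<longrightarrow> \<bar>b\<bar> \<le> max C2 C3 \<longrightarrow> \<bar>G (fst x, snd x, a, b)\<bar> \<le> M" by (rule bspec)
    then show ?case unfolding h_def using elim by simp
  qed
  have "?R \<longleftrightarrow> (AE x in \<mu>. 0 \<le> h x)" unfolding h_def \<mu>_def case_prod_unfold ..
  also have "\<dots> \<longleftrightarrow> (\<forall>\<beta>. L1_nonneg \<mu> (\<lambda>(t, \<xi>). \<beta> t \<xi>) \<longrightarrow> 0 \<le> (\<integral>(t, \<xi>). G (t, \<xi>, v t \<xi>, u\<^sub>b t \<xi>) * \<beta> t \<xi> \<partial>\<mu>))"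
  proof safe
    fix \<beta> assume h0: "AE x in \<mu>. 0 \<le> h x" and \<beta>: "L1_nonneg \<mu> (\<lambda>(t, \<xi>). \<beta> t \<xi>)"
    have "AE x in \<mu>. 0 \<le> \<beta> (fst x) (snd x)"
      using \<beta> by (simp add: L1_nonneg_def case_prod_unfold)
    with h0 have "AE x in \<mu>. 0 \<le> h x * \<beta> (fst x) (snd x)" by eventually_elim simp
    then have "0 \<le> (\<integral>x. h x * \<beta> (fst x) (snd x) \<partial>\<mu>)" by (rule integral_nonneg_AE)
    then show "0 \<le> (\<integral>(t, \<xi>). G (t, \<xi>, v t \<xi>, u\<^sub>b t \<xi>) * \<beta> t \<xi> \<partial>\<mu>)" by (simp add: h_def case_prod_unfold)
  next
    assume *: "\<forall>\<beta>. L1_nonneg \<mu> (\<lambda>(t, \<xi>). \<beta> t \<xi>) \<longrightarrow> 0 \<le> (\<integral>(t, \<xi>). G (t, \<xi>, v t \<xi>, u\<^sub>b t \<xi>) * \<beta> t \<xi> \<partial>\<mu>)"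
    show "AE x in \<mu>. 0 \<le> h x"
    proof (rule AE_nonneg_of_tests[OF _ hm hb])
      show "finite_measure \<mu>" unfolding \<mu>_def by (rule finite_lateral_measure[OF \<Omega>])
      fix \<beta> :: "real \<times> 'a \<Rightarrow> real" assume "L1_nonneg \<mu> \<beta>"
      then show "0 \<le> (\<integral>x. h x * \<beta> x \<partial>\<mu>)"
        using *[rule_format, of "\<lambda>t \<xi>. \<beta> (t, \<xi>)"] by (simp add: h_def case_prod_unfold)
    qed
  qed
  finally show ?thesis using iff by simp
qed

lemma trace_flux_iff:
  fixes \<Omega> :: "'a::euclidean_space set" and Q :: "real \<Rightarrow> 'a \<Rightarrow> real \<Rightarrow> real \<Rightarrow> 'a"
  assumes \<Omega>: "open \<Omega>" "bounded \<Omega>" "smooth_boundary \<Omega>"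
    and ub: "L_infinity (lateral_measure T \<Omega>) (\<lambda>(t, \<xi>). u\<^sub>b t \<xi>)"
    and u: "L_infinity (lebesgue_on ({0..T} \<times> \<Omega>)) (\<lambda>(t, x). u t x)"
    and tr: "has_trace T \<Omega> u v"
    and Q: "continuous_on ({0..T} \<times> closure \<Omega> \<times> UNIV) (\<lambda>(t, x, z, w). Q t x z w)"
  shows "(\<forall>\<beta>. L1_nonneg (lateral_measure T \<Omega>) (\<lambda>(t, \<xi>). \<beta> t \<xi>) \<longrightarrow>
      (\<exists>L\<ge>0. ess_lim (\<lambda>\<rho>. \<integral>(t, \<xi>). (Q t \<xi> (u t (\<xi> - \<rho> *\<^sub>R exterior_normal \<Omega> \<xi>)) (u\<^sub>b t \<xi>)
         \<bullet> exterior_normal \<Omega> \<xi>) * \<beta> t \<xi> \<partial>lateral_measure T \<Omega>) L))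
    \<longleftrightarrow> (AE (t, \<xi>) in lateral_measure T \<Omega>. 0 \<le> Q t \<xi> (v t \<xi>) (u\<^sub>b t \<xi>) \<bullet> exterior_normal \<Omega> \<xi>)"
proof -
  have sub: "{0..T} \<times> frontier \<Omega> \<times> UNIV \<subseteq> {0..T} \<times> closure \<Omega> \<times> (UNIV :: (real \<times> real) set)"
    by (auto simp: frontier_def)
  have "continuous_on ({0..T} \<times> frontier \<Omega> \<times> UNIV)
      (\<lambda>y :: real \<times> 'a \<times> real \<times> real. (\<lambda>(t, x, z, w). Q t x z w) y \<bullet> exterior_normal \<Omega> (fst (snd y)))"
    by (intro continuous_on_inner continuous_on_subset[OF Q sub]
        continuous_on_compose2[OF continuous_on_exterior_normal[OF \<Omega>(1,3)]] continuous_intros) auto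
  then have "continuous_on ({0..T} \<times> frontier \<Omega> \<times> UNIV) (\<lambda>(t, \<xi>, z, w). Q t \<xi> z w \<bullet> exterior_normal \<Omega> \<xi>)"
    by (simp add: case_prod_unfold)
  from trace_test_iff[OF \<Omega> ub u tr this] show ?thesis by simp
qed

text \<open>The definition by cases is not visibly continuous, whereas the median form is. Joint
  continuity feeds the passage to the trace; continuity in \<open>k\<close> allows a restriction to
  rational \<open>k\<close>.\<close>

lemma continuous_on_F_flux:
  fixes f :: "real \<Rightarrow> 'a::euclidean_space \<Rightarrow> real \<Rightarrow> 'b::euclidean_space"
  assumes f: "continuous_on (I \<times> A \<times> UNIV) (\<lambda>(t, x, z). f t x z)"
  shows "continuous_on (I \<times> A \<times> UNIV) (\<lambda>(t, x, z, w). F_flux f t x z w k)"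
    and "t \<in> I \<Longrightarrow> x \<in> A \<Longrightarrow> continuous_on UNIV (\<lambda>k. F_flux f t x z w k)"
proof -
  have f': "continuous_on (I \<times> A \<times> UNIV) (\<lambda>y. f (fst y) (fst (snd y)) (snd (snd y)))"
    using f by (simp add: case_prod_unfold)
  have *: "continuous_on S (\<lambda>y. f (a y) (b y) (c y))"
    if "continuous_on S a" "continuous_on S b" "continuous_on S c" "\<And>y. y \<in> S \<Longrightarrow> a y \<in> I \<and> b y \<in> A"
    for S :: "'c::topological_space set" and a b c
    using continuous_on_compose2[OF f' continuous_on_Pair[OF that(1) continuous_on_Pair[OF that(2,3)]]] that(4)
    by (simp add: image_subset_iff)
  have cl: "continuous_on S (\<lambda>y. clamp3 (z y) (w y) (k y))"
    if "continuous_on S z" "continuous_on S w" "continuous_on S k" for S :: "'c::topological_space set" and z w k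
    unfolding clamp3_def by (intro continuous_on_max continuous_on_min that)
  show "continuous_on (I \<times> A \<times> UNIV) (\<lambda>(t, x, z, w). F_flux f t x z w k)"
    unfolding F_flux_clamp case_prod_unfold
    by (intro continuous_on_diff * continuous_on_max continuous_on_min cl continuous_intros) auto
  show "continuous_on UNIV (\<lambda>k. F_flux f t x z w k)" if "t \<in> I" "x \<in> A"
    unfolding F_flux_clamp using that
    by (intro continuous_on_diff * continuous_on_max continuous_on_min cl continuous_intros) auto
qed

lemma nonneg_of_rational:
  fixes h :: "real \<Rightarrow> real"
  assumes "continuous_on UNIV h" "\<And>k. k \<in> \<rat> \<Longrightarrow> 0 \<le> h k"
  shows "0 \<le> h k"
proof -
  have "closed {k. 0 \<le> h k}" by (intro closed_Collect_le continuous_on_const assms(1))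
  moreover have "\<rat> \<subseteq> {k. 0 \<le> h k}" using assms(2) by blast
  ultimately have "closure \<rat> \<subseteq> {k. 0 \<le> h k}" by (rule closure_minimal[rotated])
  then show ?thesis unfolding Rats_closure_real by blast
qed

text \<open>\<open>entropy_pair\<close> relates the derivatives in the open set only, while the
  boundary conditions are evaluated on its frontier. Both sides are continuous up to the boundary,
  so the identity extends by density.\<close>

lemma entropy_pair_closure:
  fixes f :: "real \<Rightarrow> real^'n \<Rightarrow> real \<Rightarrow> real^'n"
  assumes f: "Ck_on 2 ({0..T} \<times> closure \<Omega> \<times> UNIV) (\<lambda>(t, x, z). f t x z)"
    and e: "entropy_pair T \<Omega> f \<eta> q" and tx: "t \<in> {0..T}" "x \<in> closure \<Omega>"
  shows "(q t x has_vector_derivative deriv \<eta> z *\<^sub>R d3 f t x z) (at z)"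
proof -
  have q: "Ck_on 2 ({0..T} \<times> closure \<Omega> \<times> UNIV) (\<lambda>(t, x, z). q t x z)"
    and eq: "\<And>x. x \<in> \<Omega> \<Longrightarrow> d3 q t x z = deriv \<eta> z *\<^sub>R d3 f t x z"
    using e tx(1) unfolding entropy_pair_def by blast+
  have c: "continuous_on (closure \<Omega>) (\<lambda>x. d3 h t x z)"
    if "Ck_on 2 ({0..T} \<times> closure \<Omega> \<times> UNIV) (\<lambda>(t, x, z). h t x z)" for h :: "real \<Rightarrow> real^'n \<Rightarrow> real \<Rightarrow> real^'n"
  proof -
    have "continuous_on (closure \<Omega>) (\<lambda>x. (\<lambda>(t, x, z). d3 h t x z) (t, x, z))"
      by (rule continuous_on_compose2[OF C2_d3(2)[OF that]]) (use tx(1) in \<open>auto intro!: continuous_intros\<close>)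
    then show ?thesis by simp
  qed
  have "d3 q t x z - deriv \<eta> z *\<^sub>R d3 f t x z = 0"
    by (rule continuous_constant_on_closure[OF _ _ tx(2)])
      (intro continuous_on_diff continuous_on_scaleR continuous_on_const c q f, simp add: eq)
  then show ?thesis using C2_d3(1)[OF q tx, of z] by simp
qed

lemma C2_has_deriv:
  fixes \<eta> :: "real \<Rightarrow> real"
  assumes "Ck_on 2 UNIV \<eta>" shows "(\<eta> has_real_derivative deriv \<eta> z) (at z)"
proof -
  have "Ck_on (Suc 1) UNIV \<eta>" using assms by (simp only: Suc_1)
  then have "\<eta> differentiable (at z)"
    by (subst (asm) Ck_on.simps(2)) (auto simp: differentiable_def)
  then show ?thesis by (simp add: DERIV_deriv_iff_real_differentiable)
qed

section \<open>Equivalence of the six boundary conditions\<close>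

theorem proposition5p7:
  fixes \<Omega> :: "(real^'n) set" and T :: real
    and f :: "real \<Rightarrow> real^'n \<Rightarrow> real \<Rightarrow> real^'n"
    and u u\<^sub>b tr_u :: "real \<Rightarrow> real^'n \<Rightarrow> real"
  assumes "open \<Omega>" and "bounded \<Omega>" and "smooth_boundary \<Omega>" and "0 < T"
    and "admissible_flux T \<Omega> f"
    and "L_infinity (lateral_measure T \<Omega>) (\<lambda>(t, \<xi>). u\<^sub>b t \<xi>)"
    and "L_infinity (lebesgue_on ({0..T} \<times> \<Omega>)) (\<lambda>(t, x). u t x)"
    and "has_trace T \<Omega> u tr_u"
  shows "let
      \<nu> = exterior_normal \<Omega>;
      \<mu> = lateral_measure T \<Omega>;
      S1 = (\<forall>H Q \<beta>. boundary_entropy_pair T \<Omega> f H Q \<and> L1_nonneg \<mu> (\<lambda>(t, \<xi>). \<beta> t \<xi>) \<longrightarrow>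
              (\<exists>L\<ge>0. ess_lim (\<lambda>\<rho>. \<integral>(t, \<xi>).
                 (Q t \<xi> (u t (\<xi> - \<rho> *\<^sub>R \<nu> \<xi>)) (u\<^sub>b t \<xi>) \<bullet> \<nu> \<xi>) * \<beta> t \<xi> \<partial>\<mu>) L));
      S2 = (\<forall>\<beta> k. L1_nonneg \<mu> (\<lambda>(t, \<xi>). \<beta> t \<xi>) \<longrightarrow>
              (\<exists>L\<ge>0. ess_lim (\<lambda>\<rho>. \<integral>(t, \<xi>).
                 (F_flux f t \<xi> (u t (\<xi> - \<rho> *\<^sub>R \<nu> \<xi>)) (u\<^sub>b t \<xi>) k \<bullet> \<nu> \<xi>) * \<beta> t \<xi> \<partial>\<mu>) L));
      S3 = (AE (t, \<xi>) in \<mu>. \<forall>k. F_flux f t \<xi> (tr_u t \<xi>) (u\<^sub>b t \<xi>) k \<bullet> \<nu> \<xi> \<ge> 0);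
      S4 = (AE (t, \<xi>) in \<mu>. \<forall>k\<in>interval_between (tr_u t \<xi>) (u\<^sub>b t \<xi>).
              (sgn (tr_u t \<xi> - u\<^sub>b t \<xi>) *\<^sub>R (f t \<xi> (tr_u t \<xi>) - f t \<xi> k)) \<bullet> \<nu> \<xi> \<ge> 0);
      S5 = (AE (t, \<xi>) in \<mu>. \<forall>\<eta> q. entropy_pair T \<Omega> f \<eta> q \<longrightarrow>
              (q t \<xi> (tr_u t \<xi>) - q t \<xi> (u\<^sub>b t \<xi>)
                 - deriv \<eta> (u\<^sub>b t \<xi>) *\<^sub>R (f t \<xi> (tr_u t \<xi>) - f t \<xi> (u\<^sub>b t \<xi>))) \<bullet> \<nu> \<xi> \<ge> 0);
      S6 = (AE (t, \<xi>) in \<mu>. \<forall>\<eta> q. entropy_pair T \<Omega> f \<eta> q \<and>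
                deriv \<eta> (u\<^sub>b t \<xi>) = 0 \<and> q t \<xi> (u\<^sub>b t \<xi>) = 0 \<longrightarrow>
              q t \<xi> (tr_u t \<xi>) \<bullet> \<nu> \<xi> \<ge> 0)
    in (S1 \<longleftrightarrow> S2) \<and> (S2 \<longleftrightarrow> S3) \<and> (S3 \<longleftrightarrow> S4) \<and> (S4 \<longleftrightarrow> S5) \<and> (S5 \<longleftrightarrow> S6)"
proof -
  define \<nu> where "\<nu> = exterior_normal \<Omega>"
  define \<mu> where "\<mu> = lateral_measure T \<Omega>"
  note \<Omega> = assms(1-3) and ub = assms(6) and u = assms(7) and tr = assms(8)
  have f: "Ck_on 2 ({0..T} \<times> closure \<Omega> \<times> UNIV) (\<lambda>(t, x, z). f t x z)"
    using assms(5) by (simp add: admissible_flux_def)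
  have fc: "continuous_on ({0..T} \<times> closure \<Omega> \<times> UNIV) (\<lambda>(t, x, z). f t x z)"
    using Ck_on_mono[OF f, of 0] by simp
  note test = trace_flux_iff[OF \<Omega> ub u tr, folded \<mu>_def \<nu>_def]
  have cl: "fst x \<in> {0..T}" "snd x \<in> closure \<Omega>" if "x \<in> space \<mu>" for x
    using that by (auto simp: \<mu>_def space_lateral_measure frontier_def)
  have fd: "(f t x has_vector_derivative d3 f t x s) (at s)" if "t \<in> {0..T}" "x \<in> closure \<Omega>" for t x s
    by (rule C2_d3(1)[OF f that])

  let ?a = "\<lambda>x. tr_u (fst x) (snd x)" and ?b = "\<lambda>x. u\<^sub>b (fst x) (snd x)"
  let ?E = "\<lambda>\<eta> q x. (q (fst x) (snd x) (?a x) - q (fst x) (snd x) (?b x)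
       - deriv \<eta> (?b x) *\<^sub>R (f (fst x) (snd x) (?a x) - f (fst x) (snd x) (?b x))) \<bullet> \<nu> (snd x)"
  let ?F = "\<lambda>k x. F_flux f (fst x) (snd x) (?a x) (?b x) k \<bullet> \<nu> (snd x)"
  let ?B = "\<lambda>p r x. bump_Q f p r (fst x) (snd x) (?a x) (?b x) \<bullet> \<nu> (snd x)"
  define S1 where "S1 = (\<forall>H Q \<beta>. boundary_entropy_pair T \<Omega> f H Q \<and> L1_nonneg \<mu> (\<lambda>(t, \<xi>). \<beta> t \<xi>) \<longrightarrow>
              (\<exists>L\<ge>0. ess_lim (\<lambda>\<rho>. \<integral>(t, \<xi>).
                 (Q t \<xi> (u t (\<xi> - \<rho> *\<^sub>R \<nu> \<xi>)) (u\<^sub>b t \<xi>) \<bullet> \<nu> \<xi>) * \<beta> t \<xi> \<partial>\<mu>) L))"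
  define S2 where "S2 = (\<forall>\<beta> k. L1_nonneg \<mu> (\<lambda>(t, \<xi>). \<beta> t \<xi>) \<longrightarrow>
              (\<exists>L\<ge>0. ess_lim (\<lambda>\<rho>. \<integral>(t, \<xi>).
                 (F_flux f t \<xi> (u t (\<xi> - \<rho> *\<^sub>R \<nu> \<xi>)) (u\<^sub>b t \<xi>) k \<bullet> \<nu> \<xi>) * \<beta> t \<xi> \<partial>\<mu>) L))"
  define S3 where "S3 = (AE (t, \<xi>) in \<mu>. \<forall>k. F_flux f t \<xi> (tr_u t \<xi>) (u\<^sub>b t \<xi>) k \<bullet> \<nu> \<xi> \<ge> 0)"
  define S4 where "S4 = (AE (t, \<xi>) in \<mu>. \<forall>k\<in>interval_between (tr_u t \<xi>) (u\<^sub>b t \<xi>).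
              (sgn (tr_u t \<xi> - u\<^sub>b t \<xi>) *\<^sub>R (f t \<xi> (tr_u t \<xi>) - f t \<xi> k)) \<bullet> \<nu> \<xi> \<ge> 0)"
  define S5 where "S5 = (AE (t, \<xi>) in \<mu>. \<forall>\<eta> q. entropy_pair T \<Omega> f \<eta> q \<longrightarrow>
              (q t \<xi> (tr_u t \<xi>) - q t \<xi> (u\<^sub>b t \<xi>)
                 - deriv \<eta> (u\<^sub>b t \<xi>) *\<^sub>R (f t \<xi> (tr_u t \<xi>) - f t \<xi> (u\<^sub>b t \<xi>))) \<bullet> \<nu> \<xi> \<ge> 0)"
  define S6 where "S6 = (AE (t, \<xi>) in \<mu>. \<forall>\<eta> q. entropy_pair T \<Omega> f \<eta> q \<and>
                deriv \<eta> (u\<^sub>b t \<xi>) = 0 \<and> q t \<xi> (u\<^sub>b t \<xi>) = 0 \<longrightarrow>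
              q t \<xi> (tr_u t \<xi>) \<bullet> \<nu> \<xi> \<ge> 0)"

  \<comment> \<open>Conditions 1 and 5 reach 4 by the same route: each gives the inequality for
    \<open>bump_Q\<close> outside a null set depending on \<open>p\<close> and \<open>r\<close>, and
    rational end points leave only countably many of these sets.\<close>
  have bump_S4: S4
    if "\<And>p r. p \<in> \<rat> \<Longrightarrow> r \<in> \<rat> \<Longrightarrow> AE (t, \<xi>) in \<mu>. 0 \<le> bump_Q f p r t \<xi> (tr_u t \<xi>) (u\<^sub>b t \<xi>) \<bullet> \<nu> \<xi>"
  proof -
    have "AE x in \<mu>. \<forall>p\<in>\<rat>. \<forall>r\<in>\<rat>. 0 \<le> ?B p r x"
      using that by (simp add: AE_ball_countable countable_rat case_prod_unfold)
    then have "AE x in \<mu>. \<forall>k\<in>interval_between (?a x) (?b x).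
       0 \<le> (sgn (?a x - ?b x) *\<^sub>R
         (f (fst x) (snd x) (?a x) - f (fst x) (snd x) k)) \<bullet> \<nu> (snd x)"
      using AE_space
    proof eventually_elim
      case (elim x)
      define t \<xi> a b n where "t = fst x" and "\<xi> = snd x" and "a = tr_u t \<xi>" and "b = u\<^sub>b t \<xi>" and "n = \<nu> \<xi>"
      have tx: "t \<in> {0..T}" "\<xi> \<in> closure \<Omega>" using cl[OF elim(2)] by (simp_all add: t_def \<xi>_def)
      have inner: "((\<lambda>s. h s \<bullet> n) has_real_derivative h' \<bullet> n) (at s)"
        if "(h has_vector_derivative h') (at s)" for h h' s
        using bounded_linear.has_vector_derivative[OF bounded_linear_inner_left that]
        by (simp add: has_real_derivative_iff_has_vector_derivative)
      have "0 \<le> (sgn (a - b) *\<^sub>R (f t \<xi> a - f t \<xi> k)) \<bullet> n" if k: "k \<in> interval_between a b" for k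
      proof -
        have "0 \<le> sgn (a - b) * (f t \<xi> a \<bullet> n - f t \<xi> k \<bullet> n)"
        proof (rule entropy_inequality_converse[where \<eta>' = bump_entropy' and \<phi>' = "\<lambda>s. d3 f t \<xi> s \<bullet> n"
              and q = "\<lambda>p r s. bump_flux f p r t \<xi> s \<bullet> n"])
          show "((\<lambda>s. f t \<xi> s \<bullet> n) has_real_derivative d3 f t \<xi> s \<bullet> n) (at s)" for s
            by (rule inner[OF fd[OF tx]])
          show "((\<lambda>s. bump_flux f p r t \<xi> s \<bullet> n) has_real_derivative bump_entropy' p r s * (d3 f t \<xi> s \<bullet> n)) (at s)" for p r s
            using inner[OF bump_flux_derivative[of f t \<xi> "d3 f t \<xi>", OF fd[OF tx]]] by simp
          show "0 \<le> bump_flux f p r t \<xi> a \<bullet> n - bump_flux f p r t \<xi> b \<bullet> n - bump_entropy' p r b * (f t \<xi> a \<bullet> n - f t \<xi> b \<bullet> n)"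
            if "p \<in> \<rat>" "r \<in> \<rat>" for p r
            using elim(1) that by (simp add: bump_Q_def inner_diff_left a_def b_def t_def \<xi>_def n_def)
        qed (rule bump_entropy_derivs(1) k)+
        then show ?thesis by (simp add: inner_diff_left)
      qed
      then show ?case by (simp add: a_def b_def t_def \<xi>_def n_def)
    qed
    then show ?thesis by (simp add: S4_def case_prod_unfold)
  qed

  have "S1 \<longrightarrow> S4"
  proof
    assume S1
    show S4
    proof (rule bump_S4)
      fix p r
      have bp: "boundary_entropy_pair T \<Omega> f (bump_H p r) (bump_Q f p r)"
        by (rule boundary_entropy_pair_bump[OF \<Omega> f])
      then have "Ck_on 2 ({0..T} \<times> closure \<Omega> \<times> UNIV) (\<lambda>(t, x, z, w). bump_Q f p r t x z w)"
        by (simp add: boundary_entropy_pair_def)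
      from Ck_on_mono[OF this, of 0]
      have "continuous_on ({0..T} \<times> closure \<Omega> \<times> UNIV) (\<lambda>(t, x, z, w). bump_Q f p r t x z w)" by simp
      from test[OF this] \<open>S1\<close> bp
      show "AE (t, \<xi>) in \<mu>. 0 \<le> bump_Q f p r t \<xi> (tr_u t \<xi>) (u\<^sub>b t \<xi>) \<bullet> \<nu> \<xi>"
        unfolding S1_def by blast
    qed
  qed

  moreover have "S4 \<longrightarrow> S1"
  proof
    assume S4
    have "AE (t, \<xi>) in \<mu>. 0 \<le> Q t \<xi> (tr_u t \<xi>) (u\<^sub>b t \<xi>) \<bullet> \<nu> \<xi>"
      and "continuous_on ({0..T} \<times> closure \<Omega> \<times> UNIV) (\<lambda>(t, x, z, w). Q t x z w)"
      if bp: "boundary_entropy_pair T \<Omega> f H Q" for H Q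
    proof -
      have H: "Ck_on 2 UNIV (\<lambda>(z, w). H z w)" "\<And>w. convex_on UNIV (\<lambda>z. H z w)"
        and Q: "Ck_on 2 ({0..T} \<times> closure \<Omega> \<times> UNIV) (\<lambda>(t, x, z, w). Q t x z w)"
        and HQ: "\<And>t x z w. t \<in> {0..T} \<Longrightarrow> x \<in> closure \<Omega> \<Longrightarrow>
           d3 (\<lambda>t x z. Q t x z w) t x z = deriv (\<lambda>s. H s w) z *\<^sub>R d3 f t x z"
        and z: "\<And>t x w. t \<in> {0..T} \<Longrightarrow> x \<in> closure \<Omega> \<Longrightarrow> Q t x w w = 0 \<and> deriv (\<lambda>s. H s w) w = 0"
        using bp unfolding boundary_entropy_pair_def by blast+
      show "continuous_on ({0..T} \<times> closure \<Omega> \<times> UNIV) (\<lambda>(t, x, z, w). Q t x z w)"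
        using Ck_on_mono[OF Q, of 0] by simp
      \<comment> \<open>Freezing the second argument is composition with the affine map
        \<open>z \<mapsto> (z, 0) + (0, w)\<close>. The value \<open>w\<close> will be the boundary
        datum, so the pair is frozen separately at each boundary point.\<close>
      have Hw: "Ck_on 2 UNIV (\<lambda>z. H z w)" for w
      proof -
        have "bounded_linear (\<lambda>z :: real. (z, 0 :: real))"
          by (intro bounded_linear_Pair bounded_linear_ident bounded_linear_zero)
        from Ck_on_comp_affine[OF this _ H(1), of "(0, w)" UNIV] show ?thesis by simp
      qed
      have Qw: "Ck_on 2 ({0..T} \<times> closure \<Omega> \<times> UNIV) (\<lambda>(t, x, z). Q t x z w)" for w
      proof -
        have bl: "bounded_linear (\<lambda>y :: real \<times> (real^'n) \<times> real. (fst y, fst (snd y), snd (snd y), 0 :: real))"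
          by (intro bounded_linear_Pair bounded_linear_fst_comp bounded_linear_snd_comp
              bounded_linear_fst bounded_linear_snd bounded_linear_zero)
        have "(\<lambda>y. (fst y, fst (snd y), snd (snd y), 0 :: real) + (0, 0, 0, w)) ` ({0..T} \<times> closure \<Omega> \<times> UNIV)
          \<subseteq> {0..T} \<times> closure \<Omega> \<times> UNIV" by auto
        from Ck_on_comp_affine[OF bl this Q] show ?thesis by (simp add: case_prod_unfold)
      qed
      have "AE x in \<mu>. 0 \<le> Q (fst x) (snd x) (?a x) (?b x) \<bullet> \<nu> (snd x)"
        using \<open>S4\<close>[unfolded S4_def case_prod_unfold] AE_space
      proof eventually_elim
        case (elim x)
        define t \<xi> a b where "t = fst x" and "\<xi> = snd x" and "a = tr_u t \<xi>" and "b = u\<^sub>b t \<xi>"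
        have tx: "t \<in> {0..T}" "\<xi> \<in> closure \<Omega>" using cl[OF elim(2)] by (simp_all add: t_def \<xi>_def)
        have "0 \<le> (Q t \<xi> a b - Q t \<xi> b b - deriv (\<lambda>s. H s b) b *\<^sub>R (f t \<xi> a - f t \<xi> b)) \<bullet> \<nu> \<xi>"
        proof (rule entropy_flux_inequality[OF Hw H(2) fd[OF tx]])
          show "((\<lambda>z. Q t \<xi> z b) has_vector_derivative deriv (\<lambda>s. H s b) s *\<^sub>R d3 f t \<xi> s) (at s)" for s
            using C2_d3(1)[OF Qw tx, of b s] unfolding HQ[OF tx] .
          show "0 \<le> (sgn (a - b) *\<^sub>R (f t \<xi> a - f t \<xi> k)) \<bullet> \<nu> \<xi>" if "k \<in> interval_between a b" for k
            using elim(1) that by (simp add: a_def b_def t_def \<xi>_def)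
        qed
        then show ?case using z[OF tx, of b] by (simp add: a_def b_def t_def \<xi>_def)
      qed
      then show "AE (t, \<xi>) in \<mu>. 0 \<le> Q t \<xi> (tr_u t \<xi>) (u\<^sub>b t \<xi>) \<bullet> \<nu> \<xi>" by (simp add: case_prod_unfold)
    qed
    then show S1 unfolding S1_def using test by blast
  qed

  moreover have "S3 \<longleftrightarrow> S4"
    unfolding S3_def S4_def case_prod_unfold F_flux_nonneg_iff ..

  moreover have "S2 \<longleftrightarrow> S3"
  proof -
    have "S2 \<longleftrightarrow> (\<forall>k. AE (t, \<xi>) in \<mu>. 0 \<le> F_flux f t \<xi> (tr_u t \<xi>) (u\<^sub>b t \<xi>) k \<bullet> \<nu> \<xi>)"
      unfolding S2_def using test[OF continuous_on_F_flux(1)[OF fc]] by blast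
    also have "\<dots> \<longleftrightarrow> S3"
    proof
      \<comment> \<open>Here the null set still depends on \<open>k\<close>; the rational values
        share one, and continuity in \<open>k\<close> supplies the others.\<close>
      assume "\<forall>k. AE (t, \<xi>) in \<mu>. 0 \<le> F_flux f t \<xi> (tr_u t \<xi>) (u\<^sub>b t \<xi>) k \<bullet> \<nu> \<xi>"
      then have "AE x in \<mu>. \<forall>k\<in>\<rat>. 0 \<le> ?F k x"
        by (simp add: AE_ball_countable countable_rat case_prod_unfold)
      then have "AE x in \<mu>. \<forall>k. 0 \<le> ?F k x"
        using AE_space
      proof eventually_elim
        case (elim x)
        show ?case
        proof
          fix k
          show "0 \<le> ?F k x"
          proof (rule nonneg_of_rational[where h = "\<lambda>k. ?F k x"])
            show "continuous_on UNIV (\<lambda>k. ?F k x)"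
              by (intro continuous_on_inner continuous_on_const continuous_on_F_flux(2)[OF fc cl[OF elim(2)]])
          qed (use elim(1) in blast)
        qed
      qed
      then show S3 by (simp add: S3_def case_prod_unfold)
    next
      assume S3
      then show "\<forall>k. AE (t, \<xi>) in \<mu>. 0 \<le> F_flux f t \<xi> (tr_u t \<xi>) (u\<^sub>b t \<xi>) k \<bullet> \<nu> \<xi>"
        unfolding S3_def case_prod_unfold by (intro allI) (erule AE_mp, simp)
    qed
    finally show ?thesis .
  qed

  moreover have "S4 \<longrightarrow> S5"
  proof
    assume S4
    \<comment> \<open>The null set is the one of condition 4 and is fixed before \<eta> and
      \<open>q\<close>, as condition 5 demands.\<close>
    from this[unfolded S4_def case_prod_unfold] AE_space
    have "AE x in \<mu>. \<forall>\<eta> q. entropy_pair T \<Omega> f \<eta> q \<longrightarrow>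
       0 \<le> ?E \<eta> q x"
    proof eventually_elim
      case (elim x)
      note tx = cl[OF elim(2)]
      show ?case
      proof (intro allI impI)
        fix \<eta> q assume e: "entropy_pair T \<Omega> f \<eta> q"
        then have \<eta>: "Ck_on 2 UNIV \<eta>" "convex_on UNIV \<eta>" by (simp_all add: entropy_pair_def)
        show "0 \<le> ?E \<eta> q x"
          by (rule entropy_flux_inequality[OF \<eta> fd[OF tx] entropy_pair_closure[OF f e tx]])
            (rule bspec[OF elim(1)])
      qed
    qed
    then show S5 by (simp add: S5_def case_prod_unfold)
  qed

  moreover have "S5 \<longrightarrow> S4"
  proof
    assume S5
    show S4
    proof (rule bump_S4)
      fix p r
      from \<open>S5\<close>[unfolded S5_def case_prod_unfold]
      have "AE x in \<mu>. 0 \<le> ?B p r x"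
      proof eventually_elim
        case (elim x)
        from elim[rule_format, OF entropy_pair_bump[OF \<Omega> f, of p r]] show ?case
          by (simp add: bump_Q_def deriv_bump_entropy)
      qed
      then show "AE (t, \<xi>) in \<mu>. 0 \<le> bump_Q f p r t \<xi> (tr_u t \<xi>) (u\<^sub>b t \<xi>) \<bullet> \<nu> \<xi>"
        by (simp add: case_prod_unfold)
    qed
  qed

  moreover have "S5 \<longrightarrow> S6"
  proof
    assume S5
    from this[unfolded S5_def case_prod_unfold]
    have "AE x in \<mu>. \<forall>\<eta> q. entropy_pair T \<Omega> f \<eta> q \<and> deriv \<eta> (?b x) = 0 \<and>
       q (fst x) (snd x) (?b x) = 0 \<longrightarrow> 0 \<le> q (fst x) (snd x) (?a x) \<bullet> \<nu> (snd x)"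
    proof eventually_elim
      case (elim x)
      show ?case
      proof (intro allI impI, elim conjE)
        fix \<eta> q assume e: "entropy_pair T \<Omega> f \<eta> q" and "deriv \<eta> (?b x) = 0"
          "q (fst x) (snd x) (?b x) = 0"
        with elim[rule_format, OF e] show "0 \<le> q (fst x) (snd x) (?a x) \<bullet> \<nu> (snd x)" by simp
      qed
    qed
    then show S6 by (simp add: S6_def case_prod_unfold)
  qed

  moreover have "S6 \<longrightarrow> S5"
  proof
    assume S6
    from this[unfolded S6_def case_prod_unfold] AE_space
    have "AE x in \<mu>. \<forall>\<eta> q. entropy_pair T \<Omega> f \<eta> q \<longrightarrow>
       0 \<le> ?E \<eta> q x"
    proof eventually_elim
      case (elim x)
      define b where "b = ?b x"
      show ?case
      proof (intro allI impI)
        fix \<eta> q assume e: "entropy_pair T \<Omega> f \<eta> q"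
        \<comment> \<open>Subtracting a linear function of slope \<open>m\<close> from \<eta>, with
          the corresponding multiple of \<open>f\<close> and a constant vector from the flux,
          achieves both normalisations of condition 6 at this point. The new pair depends on the
          point, which is legitimate because condition 6 quantifies over pairs inside the
          almost-everywhere statement.\<close>
        define m where "m = deriv \<eta> b"
        define c where "c = q (fst x) (snd x) b - m *\<^sub>R f (fst x) (snd x) b"
        define \<eta>1 where "\<eta>1 = (\<lambda>z. \<eta> z - m * z)"
        define q1 where "q1 = (\<lambda>t x z. q t x z - m *\<^sub>R f t x z - c)"
        have e': "Ck_on 2 UNIV \<eta>" "convex_on UNIV \<eta>" "Ck_on 2 ({0..T} \<times> closure \<Omega> \<times> UNIV) (\<lambda>(t, x, z). q t x z)"
          using e by (simp_all add: entropy_pair_def)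
        have \<eta>d: "(\<eta> has_real_derivative deriv \<eta> z) (at z)" for z
          by (rule C2_has_deriv[OF e'(1)])
        have \<eta>1d: "deriv \<eta>1 z = deriv \<eta> z - m" for z
          unfolding \<eta>1_def by (rule DERIV_imp_deriv) (rule derivative_eq_intros \<eta>d refl | simp)+
        have "entropy_pair T \<Omega> f \<eta>1 q1"
          unfolding entropy_pair_def
        proof (intro conjI ballI allI)
          have "Ck_on 2 UNIV (\<lambda>z. \<eta> z - m *\<^sub>R z)"
            by (intro Ck_on_diff Ck_on_scaleR Ck_on_const Ck_on_linear bounded_linear_ident e'(1))
          then show "Ck_on 2 UNIV \<eta>1" by (simp add: \<eta>1_def)
          have "Ck_on 2 ({0..T} \<times> closure \<Omega> \<times> UNIV)
             (\<lambda>y. (\<lambda>(t, x, z). q t x z) y - m *\<^sub>R (\<lambda>(t, x, z). f t x z) y - c)"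
            by (intro Ck_on_diff Ck_on_scaleR Ck_on_const e'(3) f)
          then show "Ck_on 2 ({0..T} \<times> closure \<Omega> \<times> UNIV) (\<lambda>(t, x, z). q1 t x z)"
            by (simp add: q1_def case_prod_unfold)
          have "convex_on UNIV (\<lambda>z :: real. - m * z)"
            by (intro convex_onI) (simp_all add: algebra_simps)
          from convex_on_add[OF e'(2) this] show "convex_on UNIV \<eta>1" by (simp add: \<eta>1_def)
          fix t y z assume ty: "t \<in> {0..T}" "y \<in> \<Omega>"
          then have "y \<in> closure \<Omega>" using closure_subset by blast
          note ty' = ty(1) this
          have "((\<lambda>z. q t y z - m *\<^sub>R f t y z - c) has_vector_derivative
              deriv \<eta> z *\<^sub>R d3 f t y z - m *\<^sub>R d3 f t y z - 0) (at z)"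
            by (intro has_vector_derivative_diff has_vector_derivative_const entropy_pair_closure[OF f e ty']
                bounded_linear.has_vector_derivative[OF bounded_linear_scaleR_right fd[OF ty']])
          then have "(q1 t y has_vector_derivative deriv \<eta>1 z *\<^sub>R d3 f t y z) (at z)"
            by (simp add: q1_def \<eta>1d scaleR_diff_left)
          then show "d3 q1 t y z = deriv \<eta>1 z *\<^sub>R d3 f t y z"
            unfolding d3_def[of q1] by (rule vector_derivative_at)
        qed
        moreover have "deriv \<eta>1 b = 0" by (simp add: \<eta>1d m_def)
        moreover have "q1 (fst x) (snd x) b = 0" by (simp add: q1_def c_def)
        ultimately have "0 \<le> q1 (fst x) (snd x) (?a x) \<bullet> \<nu> (snd x)"
          using elim(1) unfolding b_def by blast
        \<comment> \<open>At the trace, \<open>q1\<close> is exactly the bracket of condition 5 for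
          the original pair.\<close>
        then show "0 \<le> ?E \<eta> q x"
          by (simp add: q1_def c_def m_def b_def scaleR_diff_right algebra_simps)
      qed
    qed
    then show S5 by (simp add: S5_def case_prod_unfold)
  qed

  ultimately have "(S1 \<longleftrightarrow> S2) \<and> (S2 \<longleftrightarrow> S3) \<and> (S3 \<longleftrightarrow> S4) \<and> (S4 \<longleftrightarrow> S5) \<and> (S5 \<longleftrightarrow> S6)" by blast
  then show ?thesis
    unfolding Let_def S1_def S2_def S3_def S4_def S5_def S6_def \<nu>_def \<mu>_def .
qed

end
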